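(* Let $1\leq p\leq 2$ and let $u$ be a complex-valued function on $\mathcal{X}$. Suppose that $z=\alpha+i\delta_{p'}$, where $\alpha$ satisfies the following: (i) if $1\leq p<2$, then $\alpha\in\mathbb{R}$; (ii) if $p=2$, then $\alpha\in(\tau/2)\mathbb{Z}$. Then: (a) For every $1<r\leq\infty$: $u=\mathcal{P}_{z}F$ for some $F\in L^{r}(\Omega)$ if and only if $u\in\mathcal{H}^{r}_{p}(\mathcal{X})$ and $\mathcal{L}u=\gamma(z)u$. (b) For $r=1$: $u=\mathcal{P}_{z}\mu$ for some complex measure $\mu$ on $\Omega$ if and only if $u\in\mathcal{H}^{1}_{p}(\mathcal{X})$ and $\mathcal{L}u=\gamma(z)u$. (c) There exists a positive constant $C_{p}$ depending only on $p$ such that $$C_{p}\|F\|_{L^{r}(\Omega)}\leq\|\mathcal{P}_{z}F\|_{\mathcal{H}^{r}_{p}(\mathcal{X})}\leq\|F\|_{L^{r}(\Omega)}\quad\text{for all }F\in L^{r}(\Omega)\text{ and all }1\leq r\leq\infty.$$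
   Context: Fix an integer $q\geq 2$. $\mathcal{X}$ is (the vertex set of) the homogeneous tree of degree $q+1$, i.e. the connected graph without cycles in which every vertex has exactly $q+1$ neighbours; $d$ is the graph distance, $o\in\mathcal{X}$ is a fixed reference vertex, $|x|=d(o,x)$. Since $q$ is fixed throughout, constants may depend on $q$. Put $\tau=2\pi/\log q$. Exponents: for $p\in[1,\infty]$, $p'$ is the conjugate exponent ($1/p+1/p'=1$), and $\delta_p=1/p-1/2$, $\delta_{p'}=-\delta_p$ (so $\delta_1=1/2$, $\delta_\infty=-1/2$). Boundary: $\Omega$ is the set of infinite geodesic rays $\omega=\{o=x_0,x_1,x_2,\ldots\}$ starting at $o$. For $x\in\mathcal{X}$ and $\omega\in\Omega$, $c(x,\omega)$ is the last vertex on the geodesic path from $o$ to $x$ which lies on $\omega$. $E(x)=\{\omega\in\Omega: |c(x,\omega)|=|x|\}$ is the set of rays passing through $x$; the sets $E(x)$, $x\in\mathcal X$, generate the topology and the $\sigma$-algebra of $\Omega$. $\nu$ is the probability measure on $\Omega$ with $\nu(E(o))=1$ and $\nu(E(x))=1/((q+1)q^{|x|-1})$ for $x\neq o$. $L^r(\Omega)=L^r(\Omega,\nu)$. Poisson kernel and transform: $p(x,\omega)=q^{2|c(x,\omega)|-|x|}$. For $z\in\mathbb{C}$ and $F\in L^1(\Omega)$, $\mathcal{P}_zF(x)=\int_\Omega p(x,\omega)^{1/2+iz}F(\omega)\,d\nu(\omega)$, $x\in\mathcal{X}$; for a complex measure $\mu$ on $\Omega$, $\mathcal{P}_z\mu(x)=\int_\Omega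 p(x,\omega)^{1/2+iz}\,d\mu(\omega)$. The elementary spherical function is $\phi_z=\mathcal{P}_z\mathbf{1}$; it is radial (depends only on $|x|$), and $\phi_z(n)$ denotes its value at $|x|=n$. For $z\in i\mathbb{R}$ it is strictly positive. Laplacian: $\mathcal{L}u(x)=u(x)-\frac{1}{q+1}\sum_{y:d(x,y)=1}u(y)$, and $\gamma(z)=1-\frac{q^{1/2+iz}+q^{1/2-iz}}{q+1}$. Hardy-type spaces: let $K$ be the compact group of isometries of $\mathcal{X}$ fixing $o$, with normalized Haar measure $dk$, and let $\omega_o=\{\omega_0,\omega_1,\ldots\}\in\Omega$ be a fixed ray, so $|\omega_n|=n$. Then $\int_K f(k\cdot\omega_n)\,dk$ is the average of $f$ over the sphere $\{y\in\mathcal{X}:|y|=n\}$. For $1\leq p\leq 2$, $\mathcal{H}^r_p(\mathcal{X})$ is the space of functions $u:\mathcal{X}\to\mathbb{C}$ with $\|u\|_{\mathcal{H}^r_p(\mathcal{X})}<\infty$, where $$\|u\|_{\mathcal{H}^r_p(\mathcal{X})}=\sup_{n\geq 0}\ \phi_{i\delta_p}(n)^{-1}\Big(\int_K|u(k\cdot\omega_n)|^r\,dk\Big)^{1/r}\ (1\leq r<\infty),\qquad \|u\|_{\mathcal{H}^\infty_p(\mathcal{X})}=\sup_{x\in\mathcal{X}}\phi_{i\delta_p}(x)^{-1}|u(x)|.$$ *)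

theory Defs
  imports "HOL-Probability.Essential_Supremum"
begin

section \<open>Homogeneous trees\<close>

text \<open>The vertex set is the whole type \<open>'v\<close>; \<open>adj\<close> is the adjacency relation and
  every vertex has \<open>q + 1\<close> neighbours.\<close>

locale homogeneous_tree =
  fixes adj :: "'v \<Rightarrow> 'v \<Rightarrow> bool" and q :: nat
  assumes adj_sym: "adj x y \<Longrightarrow> adj y x"
    and adj_irrefl: "\<not> adj x x"
    and connected: "adj\<^sup>*\<^sup>* x y"
    and no_cycle: "\<not> (\<exists>xs. 3 \<le> length xs \<and> distinct xs \<and> successively adj xs \<and> adj (last xs) (hd xs))"
    and degree: "card {y. adj x y} = q + 1"

definition graph_dist :: "('v \<Rightarrow> 'v \<Rightarrow> bool) \<Rightarrow> 'v \<Rightarrow> 'v \<Rightarrow> nat" where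
  "graph_dist adj x y = (LEAST n. (adj ^^ n) x y)"

definition sphere_at :: "('v \<Rightarrow> 'v \<Rightarrow> bool) \<Rightarrow> 'v \<Rightarrow> nat \<Rightarrow> 'v set" where
  "sphere_at adj v0 n = {y. graph_dist adj v0 y = n}"


section \<open>The boundary and its canonical measure\<close>

definition boundary :: "('v \<Rightarrow> 'v \<Rightarrow> bool) \<Rightarrow> 'v \<Rightarrow> (nat \<Rightarrow> 'v) set" where
  "boundary adj v0 = {\<omega>. \<omega> 0 = v0 \<and> (\<forall>m n. m \<le> n \<longrightarrow> graph_dist adj (\<omega> m) (\<omega> n) = n - m)}"

definition geodesic_seg :: "('v \<Rightarrow> 'v \<Rightarrow> bool) \<Rightarrow> 'v \<Rightarrow> 'v \<Rightarrow> 'v set" where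
  "geodesic_seg adj x y = {z. graph_dist adj x z + graph_dist adj z y = graph_dist adj x y}"

text \<open>The last vertex on the geodesic path from \<open>v0\<close> to \<open>x\<close> lying on \<open>\<omega>\<close>: along that path
  the distance from \<open>v0\<close> is strictly increasing, so ``last'' means ``farthest from \<open>v0\<close>''.\<close>

definition confluence :: "('v \<Rightarrow> 'v \<Rightarrow> bool) \<Rightarrow> 'v \<Rightarrow> 'v \<Rightarrow> (nat \<Rightarrow> 'v) \<Rightarrow> 'v" where
  "confluence adj v0 x \<omega> = (ARG_MAX (graph_dist adj v0) y. y \<in> geodesic_seg adj v0 x \<and> y \<in> range \<omega>)"

definition rays_through :: "('v \<Rightarrow> 'v \<Rightarrow> bool) \<Rightarrow> 'v \<Rightarrow> 'v \<Rightarrow> (nat \<Rightarrow> 'v) set" where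
  "rays_through adj v0 x =
     {\<omega> \<in> boundary adj v0. graph_dist adj v0 (confluence adj v0 x \<omega>) = graph_dist adj v0 x}"

text \<open>The measure on the \<open>\<sigma>\<close>-algebra generated by the sets \<open>rays_through adj v0 x\<close> with the
  prescribed values on these generators (unique, since they form a \<open>\<inter>\<close>-stable system up to \<open>{}\<close>).\<close>

definition boundary_measure :: "('v \<Rightarrow> 'v \<Rightarrow> bool) \<Rightarrow> nat \<Rightarrow> 'v \<Rightarrow> (nat \<Rightarrow> 'v) measure" where
  "boundary_measure adj q v0 =
     extend_measure (boundary adj v0) UNIV (rays_through adj v0)
       (\<lambda>x. ennreal (if x = v0 then 1 else 1 / ((real q + 1) * real q ^ (graph_dist adj v0 x - 1))))"


section \<open>Lebesgue spaces\<close>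

definition Lp_space :: "'a measure \<Rightarrow> ereal \<Rightarrow> ('a \<Rightarrow> complex) set" where
  "Lp_space M r =
     {F \<in> borel_measurable M.
        if r = \<infinity> then esssup M (\<lambda>x. ereal (norm (F x))) < \<infinity>
        else integrable M (\<lambda>x. norm (F x) powr real_of_ereal r)}"

text \<open>Real-valued, hence meaningful only for functions in \<^term>\<open>Lp_space M r\<close>.\<close>

definition Lp_norm :: "'a measure \<Rightarrow> ereal \<Rightarrow> ('a \<Rightarrow> complex) \<Rightarrow> real" where
  "Lp_norm M r F =
     (if r = \<infinity> then real_of_ereal (esssup M (\<lambda>x. ereal (norm (F x))))
      else (LINT x|M. norm (F x) powr real_of_ereal r) powr (1 / real_of_ereal r))"


section \<open>Complex measures\<close>

text \<open>A complex measure is a countably additive complex set function on the \<open>\<sigma>\<close>-algebra of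
  \<open>M\<close>; the measure carried by \<open>M\<close> plays no role. (Additivity forces \<open>\<mu> {} = 0\<close>.)\<close>

definition complex_measure :: "'a measure \<Rightarrow> ('a set \<Rightarrow> complex) \<Rightarrow> bool" where
  "complex_measure M \<mu> \<longleftrightarrow>
     (\<forall>A :: nat \<Rightarrow> 'a set. range A \<subseteq> sets M \<longrightarrow> disjoint_family A \<longrightarrow>
        (\<lambda>i. \<mu> (A i)) sums \<mu> (\<Union>i. A i))"

text \<open>The positive variation of a real signed measure \<open>m\<close>, i.e. the positive part of its Jordan
  decomposition; the negative part is the positive variation of \<open>- m\<close>. The function \<open>ennreal\<close>
  truncates negative values to \<open>0\<close>, the value at \<open>B = {}\<close>.\<close>

definition pos_variation :: "'a measure \<Rightarrow> ('a set \<Rightarrow> real) \<Rightarrow> 'a measure" where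
  "pos_variation M m =
     measure_of (space M) (sets M) (\<lambda>A. SUP B \<in> {B \<in> sets M. B \<subseteq> A}. ennreal (m B))"

definition complex_measure_integral :: "'a measure \<Rightarrow> ('a set \<Rightarrow> complex) \<Rightarrow> ('a \<Rightarrow> complex) \<Rightarrow> complex" where
  "complex_measure_integral M \<mu> f =
     ((LINT x|pos_variation M (\<lambda>A. Re (\<mu> A)). f x) - (LINT x|pos_variation M (\<lambda>A. - Re (\<mu> A)). f x))
     + \<i> * ((LINT x|pos_variation M (\<lambda>A. Im (\<mu> A)). f x) - (LINT x|pos_variation M (\<lambda>A. - Im (\<mu> A)). f x))"


section \<open>Poisson transform, spherical functions, Laplacian\<close>

definition poisson_kernel :: "('v \<Rightarrow> 'v \<Rightarrow> bool) \<Rightarrow> nat \<Rightarrow> 'v \<Rightarrow> 'v \<Rightarrow> (nat \<Rightarrow> 'v) \<Rightarrow> real" where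
  "poisson_kernel adj q v0 x \<omega> =
     real q powi (2 * int (graph_dist adj v0 (confluence adj v0 x \<omega>)) - int (graph_dist adj v0 x))"

definition poisson_transform ::
  "('v \<Rightarrow> 'v \<Rightarrow> bool) \<Rightarrow> nat \<Rightarrow> 'v \<Rightarrow> complex \<Rightarrow> ((nat \<Rightarrow> 'v) \<Rightarrow> complex) \<Rightarrow> 'v \<Rightarrow> complex" where
  "poisson_transform adj q v0 z F x =
     (LINT \<omega>|boundary_measure adj q v0.
        complex_of_real (poisson_kernel adj q v0 x \<omega>) powr (1 / 2 + \<i> * z) * F \<omega>)"

definition poisson_transform_measure ::
  "('v \<Rightarrow> 'v \<Rightarrow> bool) \<Rightarrow> nat \<Rightarrow> 'v \<Rightarrow> complex \<Rightarrow> ((nat \<Rightarrow> 'v) set \<Rightarrow> complex) \<Rightarrow> 'v \<Rightarrow> complex" where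
  "poisson_transform_measure adj q v0 z \<mu> x =
     complex_measure_integral (boundary_measure adj q v0) \<mu>
       (\<lambda>\<omega>. complex_of_real (poisson_kernel adj q v0 x \<omega>) powr (1 / 2 + \<i> * z))"

definition spherical_fun :: "('v \<Rightarrow> 'v \<Rightarrow> bool) \<Rightarrow> nat \<Rightarrow> 'v \<Rightarrow> complex \<Rightarrow> 'v \<Rightarrow> complex" where
  "spherical_fun adj q v0 z = poisson_transform adj q v0 z (\<lambda>_. 1)"

text \<open>The common value of the radial function \<^term>\<open>spherical_fun adj q v0 z\<close> on the sphere of
  radius \<open>n\<close>.\<close>

definition spherical_fun_radial :: "('v \<Rightarrow> 'v \<Rightarrow> bool) \<Rightarrow> nat \<Rightarrow> 'v \<Rightarrow> complex \<Rightarrow> nat \<Rightarrow> complex" where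
  "spherical_fun_radial adj q v0 z n = spherical_fun adj q v0 z (SOME x. x \<in> sphere_at adj v0 n)"

definition laplacian :: "('v \<Rightarrow> 'v \<Rightarrow> bool) \<Rightarrow> nat \<Rightarrow> ('v \<Rightarrow> complex) \<Rightarrow> 'v \<Rightarrow> complex" where
  "laplacian adj q u x = u x - 1 / (of_nat q + 1) * (\<Sum>y | graph_dist adj x y = 1. u y)"

definition gamma_eigenvalue :: "nat \<Rightarrow> complex \<Rightarrow> complex" where
  "gamma_eigenvalue q z =
     1 - (of_nat q powr (1 / 2 + \<i> * z) + of_nat q powr (1 / 2 - \<i> * z)) / (of_nat q + 1)"

definition tau :: "nat \<Rightarrow> real" where
  "tau q = 2 * pi / ln (real q)"


section \<open>Hardy-type spaces\<close>

definition delta :: "real \<Rightarrow> real" where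
  "delta p = 1 / p - 1 / 2"

text \<open>The orbit integral of \<open>\<bar>u\<bar>\<^sup>r\<close> over the stabiliser of \<open>v0\<close> is the average over the sphere of
  radius \<open>n\<close>. The spherical function at \<open>\<i> * delta p\<close> takes positive real values, whence \<open>Re\<close>.\<close>

definition hardy_norm ::
  "('v \<Rightarrow> 'v \<Rightarrow> bool) \<Rightarrow> nat \<Rightarrow> 'v \<Rightarrow> real \<Rightarrow> ereal \<Rightarrow> ('v \<Rightarrow> complex) \<Rightarrow> ereal" where
  "hardy_norm adj q v0 p r u =
     (if r = \<infinity>
      then SUP x. ereal (norm (u x) / Re (spherical_fun adj q v0 (\<i> * delta p) x))
      else SUP n. ereal
        (((\<Sum>y \<in> sphere_at adj v0 n. norm (u y) powr real_of_ereal r) / card (sphere_at adj v0 n))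
            powr (1 / real_of_ereal r)
          / Re (spherical_fun_radial adj q v0 (\<i> * delta p) n)))"

definition hardy_space ::
  "('v \<Rightarrow> 'v \<Rightarrow> bool) \<Rightarrow> nat \<Rightarrow> 'v \<Rightarrow> real \<Rightarrow> ereal \<Rightarrow> ('v \<Rightarrow> complex) set" where
  "hardy_space adj q v0 p r = {u. hardy_norm adj q v0 p r u < \<infinity>}"

text \<open>\<open>z = \<alpha> + \<i> \<delta>\<^sub>p\<^sub>'\<close> with \<open>\<alpha>\<close> real and, if \<open>p = 2\<close>, \<open>\<alpha> \<in> (\<tau>/2) \<int>\<close>. For the conjugate exponent
  \<open>p'\<close> of \<open>p\<close> one has \<open>\<delta>\<^sub>p\<^sub>' = - \<delta>\<^sub>p\<close>, also when \<open>p = 1\<close> and \<open>p' = \<infinity>\<close>.\<close>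

definition admissible_parameter :: "nat \<Rightarrow> real \<Rightarrow> complex \<Rightarrow> bool" where
  "admissible_parameter q p z \<longleftrightarrow>
     (\<exists>\<alpha>::real. z = of_real \<alpha> + \<i> * of_real (- delta p)
        \<and> (p = 2 \<longrightarrow> (\<exists>k::int. \<alpha> = tau q / 2 * of_int k)))"

end

theory Submission
  imports Defs "HOL-Probability.Probability_Measure"
begin

text \<open>Write \<open>Q = q\<^bsup>1/2 + iz\<^esup>\<close>, so that \<open>\<bar>Q\<bar> = q\<^bsup>1/p\<^esup>\<close>. The kernel \<open>p(x, \<omega>)\<^bsup>1/2 + iz\<^esup>\<close> depends on \<open>\<omega>\<close> only through
the sets \<open>E y\<close> for the ancestors \<open>y\<close> of \<open>x\<close>, and summation by parts turns the Poisson integral of a measure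
with masses \<open>M y\<close> on \<open>E y\<close> into a finite sum \<open>tree_poisson Q M x\<close> over the geodesic from the root to \<open>x\<close>.
The quantity \<open>u x - u (par x) / Q\<close> then recovers \<open>M x\<close> up to an explicit non-zero factor. Under this
correspondence the eigenvalue equation for \<open>u\<close> says precisely that \<open>M\<close> is additive, so every
eigenfunction is the Poisson transform of exactly one finitely additive set function
(\<open>tree_poisson_eigenfunction\<close>, \<open>eigenfunction_is_tree_poisson\<close>). What remains is to compare the size
of \<open>u\<close> with that of the density \<open>g\<close> of \<open>M\<close> with respect to \<open>\<nu>\<close>; additivity of \<open>M\<close> means that
\<open>g\<close> is a martingale.

In one direction, \<open>\<bar>u\<bar>\<close> is at most the Poisson transform of \<open>\<bar>F\<bar>\<close> with the positive base \<open>\<bar>Q\<bar>\<close>, which at \<open>x\<close>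
is the spherical function times a weighted mean, with non-negative weights, of the values of the
density of \<open>\<bar>F\<bar>\<close> along the geodesic; Jensen's inequality gives the constant \<open>1\<close>
(\<open>pmean_tree_poisson_le\<close>). Here \<open>\<phi>\<^sub>z = \<phi>\<^bsub>-z\<^esub>\<close> is needed, because the spherical function in the norm
has the opposite parameter (\<open>sph_symmetric\<close>).

In the other direction (\<open>density_bound\<close>) two mechanisms are at work. If \<open>p < 2\<close>, then \<open>\<bar>Q\<bar>\<^sup>2 > q\<close> and the last
term of the sum has the size of the whole spherical function, so the inversion formula bounds \<open>g\<close> directly.
If \<open>p = 2\<close>, the condition on \<open>\<alpha>\<close> makes \<open>Q\<^sup>2 = q\<close>, all terms of the sum have equal size and
\<open>Q\<^sup>n u\<close> is a sum of the martingale; averaged over the descendants of \<open>x\<close> in generation \<open>k\<close> it grows like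
\<open>k\<close> times \<open>g x\<close>, at the same rate as the spherical function, and \<open>k \<rightarrow> \<infinity>\<close> gives the bound.

A martingale with bounded means in the power \<open>r\<close> finally has to be represented on the boundary. Averaging \<open>\<bar>g\<bar>\<close>
over descendants produces an additive majorant, so \<open>M\<close> is a combination of three positive
additive functions, which extend to measures because \<open>\<Omega>\<close> is compact (\<open>exists_measure_of_additive\<close>). For
\<open>r > 1\<close> these measures are absolutely continuous, and the Radon-Nikodym theorem yields \<open>F\<close>. The martingale of
an integrable \<open>F\<close> converges to \<open>F\<close> in mean, so along a subsequence almost everywhere, and Fatou's
lemma bounds the norm of \<open>F\<close> by those of the martingale (\<open>Lp_norm_le_martingale\<close>).\<close>

section \<open>Rooted homogeneous trees\<close>

locale rooted_homogeneous_tree = homogeneous_tree adj q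
  for adj :: "'v \<Rightarrow> 'v \<Rightarrow> bool" and q :: nat +
  fixes v0 :: 'v
  assumes q_ge_2: "2 \<le> q"
begin

definition lev :: "'v \<Rightarrow> nat" where "lev = graph_dist adj v0"

text \<open>The neighbour of \<open>x\<close> nearest to the root; the root is its own parent, so that \<open>par\<close> can be iterated.\<close>

definition par :: "'v \<Rightarrow> 'v" where
  "par x = (if x = v0 then v0 else (SOME y. adj x y \<and> Suc (lev y) = lev x))"

definition children :: "'v \<Rightarrow> 'v set" where
  "children x = {y. y \<noteq> v0 \<and> par y = x}"

text \<open>The vertex at distance \<open>j\<close> from the root on the geodesic to \<open>x\<close>, or \<open>x\<close> itself if that geodesic is
  shorter.\<close>

definition anc :: "nat \<Rightarrow> 'v \<Rightarrow> 'v" where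
  "anc j x = (par ^^ (lev x - j)) x"

abbreviation S :: "nat \<Rightarrow> 'v set" where "S n \<equiv> sphere_at adj v0 n"

lemma S_iff: "x \<in> S n \<longleftrightarrow> lev x = n"
  by (simp add: sphere_at_def lev_def)

lemma graph_dist_le: "(adj ^^ n) x y \<Longrightarrow> graph_dist adj x y \<le> n"
  unfolding graph_dist_def by (rule Least_le)

lemma graph_dist_walk: "(adj ^^ graph_dist adj x y) x y"
  unfolding graph_dist_def
  by (rule LeastI_ex) (use connected rtranclp_imp_relpowp in metis)

lemma graph_dist_triangle: "graph_dist adj x z \<le> graph_dist adj x y + graph_dist adj y z"
  by (rule graph_dist_le) (rule relpowp_trans[OF graph_dist_walk graph_dist_walk])

lemma graph_dist_refl [simp]: "graph_dist adj x x = 0"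
  using graph_dist_le[of 0 x x] by simp

lemma graph_dist_eq_0_iff [simp]: "graph_dist adj x y = 0 \<longleftrightarrow> x = y"
  using graph_dist_walk[of x y] by auto

lemma graph_dist_eq_1_iff: "graph_dist adj x y = 1 \<longleftrightarrow> adj x y"
proof
  assume "graph_dist adj x y = 1"
  then show "adj x y" using graph_dist_walk[of x y] by (simp only: relpowp_1)
next
  assume a: "adj x y"
  then have "graph_dist adj x y \<le> 1" by (intro graph_dist_le) (simp only: relpowp_1)
  moreover have "graph_dist adj x y \<noteq> 0" using a adj_irrefl by auto
  ultimately show "graph_dist adj x y = 1" by linarith
qed

lemma lev_v0 [simp]: "lev v0 = 0" and lev_eq_0_iff [simp]: "lev x = 0 \<longleftrightarrow> x = v0"
  by (auto simp: lev_def)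

lemma lev_adj: "adj x y \<Longrightarrow> lev y \<le> Suc (lev x)"
  using graph_dist_triangle[of v0 y x] graph_dist_eq_1_iff[of x y] by (simp add: lev_def)

lemma exists_lower_neighbour: "x \<noteq> v0 \<Longrightarrow> \<exists>y. adj x y \<and> Suc (lev y) = lev x"
proof -
  assume "x \<noteq> v0"
  then obtain n where n: "lev x = Suc n" by (metis lev_eq_0_iff not0_implies_Suc)
  then have "(adj ^^ Suc n) v0 x" using graph_dist_walk[of v0 x] by (simp add: lev_def)
  then obtain y where y: "(adj ^^ n) v0 y" "adj y x" by auto
  have "lev y \<le> n" using graph_dist_le[OF y(1)] by (simp add: lev_def)
  moreover have "lev x \<le> Suc (lev y)" using lev_adj y by simp
  ultimately show ?thesis using y n adj_sym by (intro exI[of _ y]) auto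
qed

lemma par_v0 [simp]: "par v0 = v0" by (simp add: par_def)

lemma adj_par: "x \<noteq> v0 \<Longrightarrow> adj x (par x)" and lev_par_Suc: "x \<noteq> v0 \<Longrightarrow> Suc (lev (par x)) = lev x"
  using someI_ex[OF exists_lower_neighbour[of x]] by (simp_all add: par_def)

lemma lev_par: "lev (par x) = lev x - 1"
  using lev_par_Suc[of x] by (cases "x = v0") auto

text \<open>Descending to the root from both ends until the two branches meet joins any two vertices of a
  sphere by a path that meets this sphere only at its ends. An edge inside a sphere, or a vertex with
  two neighbours on the previous sphere, would close such a path to a cycle.\<close>

lemma path_below_sphere:
  assumes "lev x = n" "lev y = n" "x \<noteq> y"
  shows "\<exists>xs. 3 \<le> length xs \<and> distinct xs \<and> successively adj xs \<and> hd xs = x \<and> last xs = y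
    \<and> (\<forall>v\<in>set xs. lev v \<le> n)"
  using assms
proof (induction n arbitrary: x y)
  case 0
  then show ?case by simp
next
  case (Suc n)
  have nz: "x \<noteq> v0" "y \<noteq> v0" using Suc.prems by auto
  have l: "lev (par x) = n" "lev (par y) = n" using Suc.prems by (simp_all add: lev_par)
  show ?case
  proof (cases "par x = par y")
    case True
    have "adj (par x) y" unfolding True by (rule adj_sym[OF adj_par[OF nz(2)]])
    moreover have "x \<noteq> par x" "y \<noteq> par x" using Suc.prems l by (metis n_not_Suc_n)+
    ultimately show ?thesis using Suc.prems l(1) adj_par[OF nz(1)]
      by (intro exI[of _ "[x, par x, y]"]) simp
  next
    case False
    obtain xs where xs: "3 \<le> length xs" "distinct xs" "successively adj xs" "hd xs = par x"
      "last xs = par y" "\<forall>v\<in>set xs. lev v \<le> n"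
      using Suc.IH[OF l False] by blast
    have "xs \<noteq> []" "x \<notin> set xs" "y \<notin> set xs" using xs(1,6) Suc.prems by force+
    moreover have "lev v \<le> Suc n" if "v \<in> set xs" for v using xs(6) that by (simp add: le_SucI)
    moreover note adj_par[OF nz(1)] adj_sym[OF adj_par[OF nz(2)]]
    ultimately show ?thesis using xs Suc.prems
      by (intro exI[of _ "x # xs @ [y]"]) (simp add: successively_Cons successively_append_iff)
  qed
qed

lemma no_edge_in_sphere: "adj x y \<Longrightarrow> lev x \<noteq> lev y"
proof
  assume a: "adj x y" "lev x = lev y"
  then have "x \<noteq> y" using adj_irrefl by auto
  from path_below_sphere[OF a(2) refl this] no_cycle adj_sym[OF a(1)] show False
    by blast
qed

lemma lower_neighbour_unique:
  assumes "adj x y" "adj x z" "Suc (lev y) = lev x" "Suc (lev z) = lev x"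
  shows "y = z"
proof (rule ccontr)
  assume "y \<noteq> z"
  moreover have "lev y = lev z" using assms by simp
  ultimately obtain xs where xs: "3 \<le> length xs" "distinct xs" "successively adj xs" "hd xs = y"
      "last xs = z" "\<forall>v\<in>set xs. lev v \<le> lev z"
    using path_below_sphere[of y "lev z" z] by auto
  then have "xs \<noteq> []" by auto
  then have "3 \<le> length (x # xs) \<and> distinct (x # xs) \<and> successively adj (x # xs)
      \<and> adj (last (x # xs)) (hd (x # xs))"
    using xs assms by (auto simp: successively_Cons intro: adj_sym)
  then show False using no_cycle by blast
qed

lemma par_eqI: "adj x y \<Longrightarrow> Suc (lev y) = lev x \<Longrightarrow> par x = y"
  using lower_neighbour_unique[of x "par x" y] adj_par lev_par_Suc by (cases "x = v0") auto

lemma adj_iff: "adj x y \<longleftrightarrow> y \<in> children x \<or> (x \<noteq> v0 \<and> y = par x)"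
proof
  assume a: "adj x y"
  have "lev y \<le> Suc (lev x)" "lev x \<le> Suc (lev y)" "lev x \<noteq> lev y"
    using lev_adj[OF a] lev_adj[OF adj_sym[OF a]] no_edge_in_sphere[OF a] by auto
  then consider "lev y = Suc (lev x)" | "lev x = Suc (lev y)" by linarith
  then show "y \<in> children x \<or> (x \<noteq> v0 \<and> y = par x)"
  proof cases
    case 1
    then have "y \<noteq> v0" by auto
    then show ?thesis using par_eqI[of y x] adj_sym[OF a] 1 by (simp add: children_def)
  next
    case 2
    then have "x \<noteq> v0" by auto
    then show ?thesis using par_eqI[of x y] a 2 by simp
  qed
qed (auto simp: children_def intro: adj_par adj_sym)

lemma neighbours_eq: "{y. adj x y} = (if x = v0 then children x else insert (par x) (children x))"
  by (auto simp: adj_iff)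

lemma finite_neighbours: "finite {y. adj x y}"
  using degree[of x] by (intro card_ge_0_finite) simp

lemma finite_children [simp, intro]: "finite (children x)"
  using finite_neighbours[of x] by (rule finite_subset[rotated]) (auto simp: adj_iff)

lemma lev_child: "y \<in> children x \<Longrightarrow> lev y = Suc (lev x)"
  using lev_par_Suc[of y] by (auto simp: children_def)

lemma par_notin_children: "par x \<notin> children x"
  using lev_child[of "par x" x] lev_par[of x] by auto

lemma card_children: "card (children x) = (if x = v0 then q + 1 else q)"
  using degree[of x] by (auto simp: neighbours_eq par_notin_children split: if_splits)

lemma children_nonempty: "children x \<noteq> {}"
  using card_children[of x] q_ge_2 by (auto split: if_splits)

lemma sum_neighbours:
  "(\<Sum>y | adj x y. (u y :: 'b :: comm_monoid_add)) = (if x = v0 then 0 else u (par x)) + sum u (children x)"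
  by (simp add: neighbours_eq par_notin_children)

subsection \<open>Spheres and ancestors\<close>

lemma S_0 [simp]: "S 0 = {v0}"
  by (auto simp: S_iff)

lemma S_Suc: "S (Suc n) = (\<Union>x\<in>S n. children x)"
proof -
  have "y \<noteq> v0 \<and> lev (par y) = n" if "lev y = Suc n" for y
    using that lev_par[of y] by auto
  then show ?thesis using lev_child by (fastforce simp: S_iff children_def)
qed

lemma finite_S [simp, intro]: "finite (S n)"
  by (induction n) (auto simp: S_Suc)

lemma children_disjoint: "x \<noteq> y \<Longrightarrow> children x \<inter> children y = {}"
  by (auto simp: children_def)

lemma sum_S_Suc: "sum f (S (Suc n)) = (\<Sum>x\<in>S n. sum f (children x))"
  unfolding S_Suc by (rule sum.UNION_disjoint) (auto simp: children_disjoint)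

lemma S_nonempty: "S n \<noteq> {}"
  by (induction n) (auto simp: S_Suc children_nonempty)

lemma card_S_pos: "0 < card (S n)"
  using S_nonempty by (simp add: card_gt_0_iff)

lemma card_S_Suc_children: "x \<in> S n \<Longrightarrow> card (S (Suc n)) = card (S n) * card (children x)"
proof -
  assume x: "x \<in> S n"
  have "card (children y) = card (children x)" if "y \<in> S n" for y
    using that x by (auto simp: card_children S_iff)
  then show ?thesis
    by (simp add: S_Suc card_UN_disjoint children_disjoint)
qed

lemma card_S_Suc: "card (S (Suc n)) = (q + 1) * q ^ n"
proof (induction n)
  case 0
  show ?case using card_S_Suc_children[of v0 0] by (simp add: card_children)
next
  case (Suc n)
  obtain x where x: "x \<in> S (Suc n)" using S_nonempty by blast
  then have "x \<noteq> v0" by (auto simp: S_iff)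
  then show ?case using card_S_Suc_children[OF x] Suc by (simp add: card_children algebra_simps)
qed

lemma anc_self [simp]: "lev x \<le> j \<Longrightarrow> anc j x = x"
  by (simp add: anc_def)

lemma lev_funpow_par: "lev ((par ^^ k) x) = lev x - k"
  by (induction k) (auto simp: lev_par)

lemma lev_anc: "lev (anc j x) = min j (lev x)"
  by (auto simp: anc_def lev_funpow_par)

lemma anc_par: "j < lev x \<Longrightarrow> anc j (par x) = anc j x"
proof -
  assume j: "j < lev x"
  then have "lev x - j = Suc (lev (par x) - j)" by (simp add: lev_par)
  then show ?thesis by (simp add: anc_def funpow_Suc_right del: funpow.simps)
qed

lemma anc_child: "y \<in> children x \<Longrightarrow> j \<le> lev x \<Longrightarrow> anc j y = anc j x"
  using anc_par[of j y] lev_child[of y x] by (simp add: children_def)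

lemma anc_0 [simp]: "anc 0 x = v0"
  using lev_anc[of 0 x] by simp

lemma par_anc: "j < lev x \<Longrightarrow> par (anc (Suc j) x) = anc j x"
proof -
  assume j: "j < lev x"
  then have "lev x - j = Suc (lev x - Suc j)" by simp
  then show ?thesis by (simp add: anc_def)
qed

lemma anc_anc: "i \<le> j \<Longrightarrow> anc i (anc j x) = anc i x"
proof (induction "lev x - j" arbitrary: x)
  case 0
  then show ?case by simp
next
  case (Suc k)
  then have "anc i (anc j (par x)) = anc i (par x)"
    using lev_par[of x] by (intro Suc.hyps) auto
  then show ?case using Suc by (simp add: anc_par)
qed

lemma walk_down: "(adj ^^ k) ((par ^^ k) x) x" if "k \<le> lev x"
  using that
proof (induction k)
  case (Suc k)
  let ?y = "(par ^^ k) x"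
  have "lev ?y \<noteq> 0" using lev_funpow_par[of k x] Suc.prems by linarith
  then have "?y \<noteq> v0" by simp
  then have "adj (par ?y) ?y" using adj_par adj_sym by blast
  then show ?case using Suc relpowp_Suc_I2[of adj "par ?y" ?y k x] by simp
qed simp

lemma walk_up_unique:
  assumes "(adj ^^ k) z x" "lev x = lev z + k"
  shows "z = (par ^^ k) x"
  using assms
proof (induction k arbitrary: x)
  case (Suc k)
  from Suc.prems(1) obtain y where y: "(adj ^^ k) z y" "adj y x" by auto
  have "lev y \<le> lev z + k"
    using graph_dist_triangle[of v0 y z] graph_dist_le[OF y(1)] by (simp add: lev_def)
  moreover have "lev x \<le> Suc (lev y)" by (rule lev_adj[OF y(2)])
  ultimately have l: "lev y = lev z + k" using Suc.prems(2) by simp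
  then have "par x = y" using Suc.prems(2) by (intro par_eqI adj_sym[OF y(2)]) simp
  then show ?case using Suc.IH[OF y(1) l] by (simp add: funpow_Suc_right del: funpow.simps)
qed simp

lemma graph_dist_anc: "j \<le> lev x \<Longrightarrow> graph_dist adj (anc j x) x = lev x - j"
proof (rule antisym)
  assume j: "j \<le> lev x"
  show "graph_dist adj (anc j x) x \<le> lev x - j"
    unfolding anc_def using walk_down[of "lev x - j" x] by (intro graph_dist_le) simp
  show "lev x - j \<le> graph_dist adj (anc j x) x"
    using graph_dist_triangle[of v0 x "anc j x"] lev_anc[of j x] j by (simp add: lev_def)
qed

lemma graph_dist_eq_lev_diff:
  assumes "lev z + graph_dist adj z x = lev x"
  shows "z = anc (lev z) x"
  using walk_up_unique[OF graph_dist_walk[of z x]] assms by (simp add: anc_def) (metis add_diff_cancel_left')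

lemma geodesic_seg_eq: "geodesic_seg adj v0 x = (\<lambda>j. anc j x) ` {..lev x}"
proof -
  have "(lev z + graph_dist adj z x = lev x) \<longleftrightarrow> (\<exists>j\<le>lev x. z = anc j x)" for z
  proof
    assume "lev z + graph_dist adj z x = lev x"
    then show "\<exists>j\<le>lev x. z = anc j x"
      using graph_dist_eq_lev_diff[of z x] by (metis le_add1)
  next
    assume "\<exists>j\<le>lev x. z = anc j x"
    then show "lev z + graph_dist adj z x = lev x" using graph_dist_anc[of _ x] lev_anc[of _ x] by force
  qed
  then show ?thesis by (auto simp: geodesic_seg_def lev_def[symmetric])
qed

subsection \<open>Rays\<close>

abbreviation \<Omega> :: "(nat \<Rightarrow> 'v) set" where "\<Omega> \<equiv> boundary adj v0"

abbreviation E :: "'v \<Rightarrow> (nat \<Rightarrow> 'v) set" where "E \<equiv> rays_through adj v0"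

lemma boundary_iff: "\<omega> \<in> \<Omega> \<longleftrightarrow> \<omega> 0 = v0 \<and> (\<forall>n. \<omega> (Suc n) \<in> children (\<omega> n))"
proof
  assume w: "\<omega> \<in> \<Omega>"
  then have 0: "\<omega> 0 = v0" and d: "\<And>m n. m \<le> n \<Longrightarrow> graph_dist adj (\<omega> m) (\<omega> n) = n - m"
    by (auto simp: boundary_def)
  have l: "lev (\<omega> n) = n" for n using d[of 0 n] 0 by (simp add: lev_def)
  have "\<omega> (Suc n) \<in> children (\<omega> n)" for n
  proof -
    have "adj (\<omega> n) (\<omega> (Suc n))" using d[of n "Suc n"] graph_dist_eq_1_iff by simp
    then have "\<omega> (Suc n) \<in> children (\<omega> n) \<or> \<omega> (Suc n) = par (\<omega> n)" by (auto simp: adj_iff)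
    moreover have "\<omega> (Suc n) \<noteq> par (\<omega> n)"
      using l[of n] l[of "Suc n"] lev_par[of "\<omega> n"] by auto
    ultimately show ?thesis by simp
  qed
  with 0 show "\<omega> 0 = v0 \<and> (\<forall>n. \<omega> (Suc n) \<in> children (\<omega> n))" by blast
next
  assume w: "\<omega> 0 = v0 \<and> (\<forall>n. \<omega> (Suc n) \<in> children (\<omega> n))"
  then have c: "\<omega> (Suc n) \<in> children (\<omega> n)" for n by blast
  have l: "lev (\<omega> n) = n" for n
    using w by (induction n) (simp_all add: lev_child[OF c])
  have a: "anc m (\<omega> (m + k)) = \<omega> m" for m k
  proof (induction k)
    case (Suc k)
    then show ?case using anc_child[of "\<omega> (Suc (m + k))" "\<omega> (m + k)" m] w l by simp
  qed (simp add: l)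
  have "graph_dist adj (\<omega> m) (\<omega> n) = n - m" if "m \<le> n" for m n
    using graph_dist_anc[of m "\<omega> n"] a[of m "n - m"] that l by simp
  with w show "\<omega> \<in> \<Omega>" by (simp add: boundary_def)
qed

lemma ray_0: "\<omega> \<in> \<Omega> \<Longrightarrow> \<omega> 0 = v0" and ray_child: "\<omega> \<in> \<Omega> \<Longrightarrow> \<omega> (Suc n) \<in> children (\<omega> n)"
  by (auto simp: boundary_iff)

lemma lev_ray: "\<omega> \<in> \<Omega> \<Longrightarrow> lev (\<omega> n) = n"
  by (induction n) (auto simp: ray_0 lev_child[OF ray_child])

lemma ray_in_S: "\<omega> \<in> \<Omega> \<Longrightarrow> \<omega> n \<in> S n"
  by (simp add: S_iff lev_ray)

lemma anc_ray: "\<omega> \<in> \<Omega> \<Longrightarrow> m \<le> n \<Longrightarrow> anc m (\<omega> n) = \<omega> m"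
proof (induction n)
  case (Suc n)
  then show ?case
    using anc_child[OF ray_child[OF Suc.prems(1), of n], of m]
    by (cases "m = Suc n") (auto simp: lev_ray)
qed (simp add: ray_0)

text \<open>The vertices of a ray that are ancestors of \<open>x\<close> form an initial piece of the ray, and the
  confluence point is the last of them.\<close>

lemma confluence_eq:
  fixes x :: 'v
  assumes w: "\<omega> \<in> \<Omega>"
  defines "J \<equiv> {j. j \<le> lev x \<and> anc j x = \<omega> j}"
  shows "lev (confluence adj v0 x \<omega>) = Max J" and "j \<in> J \<longleftrightarrow> j \<le> Max J"
proof -
  have fin: "finite J" and 0: "0 \<in> J" using w by (auto simp: J_def ray_0)
  have "anc i x = \<omega> i" if "i \<le> j" "j \<in> J" for i j
    using that anc_anc[of i j x] anc_ray[OF w, of i j] by (simp add: J_def)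
  then have down: "i \<in> J" if "i \<le> j" "j \<in> J" for i j
    using that by (auto simp: J_def)
  have maxJ: "Max J \<in> J" using fin 0 by (intro Max_in) auto
  show "j \<in> J \<longleftrightarrow> j \<le> Max J" using down maxJ fin by auto
  let ?P = "\<lambda>y. y \<in> geodesic_seg adj v0 x \<and> y \<in> range \<omega>"
  have P: "?P y \<longleftrightarrow> (\<exists>j\<in>J. y = \<omega> j)" for y
  proof
    assume "?P y"
    then obtain j k where "j \<le> lev x" "y = anc j x" "y = \<omega> k"
      by (auto simp: geodesic_seg_eq)
    moreover from this have "j = k" using lev_anc[of j x] lev_ray[OF w, of k] by simp
    ultimately show "\<exists>j\<in>J. y = \<omega> j" by (auto simp: J_def)
  next
    assume "\<exists>j\<in>J. y = \<omega> j"
    then obtain j where "j \<le> lev x" "y = anc j x" "y = \<omega> j" by (auto simp: J_def)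
    then show "?P y" unfolding geodesic_seg_eq by (metis atMost_iff imageI rangeI)
  qed
  have "confluence adj v0 x \<omega> = (ARG_MAX lev y. ?P y)"
    by (simp add: confluence_def lev_def)
  moreover have "lev (ARG_MAX lev y. ?P y) = lev (\<omega> (Max J))"
  proof (rule arg_max_equality[OF _ ])
    show "?P (\<omega> (Max J))" using P maxJ by blast
    show "lev y \<le> lev (\<omega> (Max J))" if y: "?P y" for y
    proof -
      obtain j where "j \<in> J" "y = \<omega> j" using y P[of y] by blast
      then show ?thesis using fin by (simp add: lev_ray[OF w])
    qed
  qed
  ultimately show "lev (confluence adj v0 x \<omega>) = Max J" by (simp add: lev_ray[OF w])
qed

lemma le_lev_confluence_iff:
  assumes "\<omega> \<in> \<Omega>"
  shows "j \<le> lev (confluence adj v0 x \<omega>) \<longleftrightarrow> j \<le> lev x \<and> anc j x = \<omega> j"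
  using confluence_eq(1)[OF assms, where x = x] confluence_eq(2)[OF assms, where x = x and j = j]
  by simp

lemma rays_through_eq: "E x = {\<omega> \<in> \<Omega>. \<omega> (lev x) = x}"
proof -
  have "lev (confluence adj v0 x \<omega>) = lev x \<longleftrightarrow> \<omega> (lev x) = x" if "\<omega> \<in> \<Omega>" for \<omega>
    using le_lev_confluence_iff[OF that, of "lev x" x]
      le_lev_confluence_iff[OF that, of "lev (confluence adj v0 x \<omega>)" x] by auto
  then show ?thesis by (auto simp: rays_through_def lev_def)
qed

lemma E_subset: "E x \<subseteq> \<Omega>"
  by (auto simp: rays_through_eq)

lemma E_v0 [simp]: "E v0 = \<Omega>"
  by (auto simp: rays_through_eq ray_0)

lemma mem_E_anc_iff: "\<omega> \<in> \<Omega> \<Longrightarrow> j \<le> lev x \<Longrightarrow> \<omega> \<in> E (anc j x) \<longleftrightarrow> j \<le> lev (confluence adj v0 x \<omega>)"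
  by (auto simp: rays_through_eq lev_anc le_lev_confluence_iff)

text \<open>Choosing children that keep the property \<open>P\<close> builds the ray. With a trivial \<open>P\<close> this shows that no
  \<open>E x\<close> is empty; compactness of the boundary uses it with \<open>P\<close> a failure of finite coverability.\<close>

lemma exists_ray_along:
  assumes "P x" and step: "\<And>y. P y \<Longrightarrow> \<exists>z\<in>children y. P z"
  shows "\<exists>\<omega>\<in>E x. \<forall>n\<ge>lev x. P (\<omega> n)"
proof -
  obtain c where c: "\<And>y. P y \<Longrightarrow> c y \<in> children y \<and> P (c y)" using step by metis
  define \<omega> where "\<omega> n = (if n \<le> lev x then anc n x else (c ^^ (n - lev x)) x)" for n
  have up: "\<omega> (lev x + k) = (c ^^ k) x" for k by (cases k) (auto simp: \<omega>_def)
  have P: "P ((c ^^ k) x)" for k by (induction k) (auto simp: assms(1) c)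
  have "\<omega> (Suc n) \<in> children (\<omega> n)" for n
  proof (cases "n < lev x")
    case True
    then have "anc (Suc n) x \<noteq> v0" using lev_anc[of "Suc n" x] by auto
    then show ?thesis using True par_anc[OF True] by (simp add: \<omega>_def children_def)
  next
    case False
    then obtain k where "n = lev x + k" by (metis le_add_diff_inverse not_less)
    then show ?thesis using up[of k] up[of "Suc k"] c[OF P[of k]] by simp
  qed
  then have "\<omega> \<in> \<Omega>" unfolding boundary_iff by (simp add: \<omega>_def)
  moreover have "\<omega> (lev x) = x" by (simp add: \<omega>_def)
  moreover have "P (\<omega> n)" if "lev x \<le> n" for n
    using up[of "n - lev x"] P that by simp
  ultimately show ?thesis by (auto simp: rays_through_eq)
qed

lemma E_nonempty: "E x \<noteq> {}"
  using exists_ray_along[of "\<lambda>_. True" x] children_nonempty by blast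

lemma E_subset_iff: "E y \<subseteq> E x \<longleftrightarrow> lev x \<le> lev y \<and> anc (lev x) y = x"
proof
  assume sub: "E y \<subseteq> E x"
  show "lev x \<le> lev y \<and> anc (lev x) y = x"
  proof (cases "lev x \<le> lev y")
    case True
    obtain \<omega> where "\<omega> \<in> E y" using E_nonempty by blast
    then show ?thesis using sub True anc_ray[of \<omega> "lev x" "lev y"] by (auto simp: rays_through_eq)
  next
    case False
    \<comment> \<open>two children of \<open>y\<close> cannot both be the ancestor of \<open>x\<close> on their level\<close>
    have "card (children y) \<noteq> 1" "card (children y) \<noteq> 0" using card_children[of y] q_ge_2 by auto
    then obtain z where z: "z \<in> children y" "z \<noteq> anc (Suc (lev y)) x"
      by (metis children_nonempty is_singletonI' is_singleton_altdef)
    obtain \<omega> where w: "\<omega> \<in> E z" using E_nonempty by blast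
    then have "\<omega> (Suc (lev y)) = z" "\<omega> \<in> \<Omega>" using lev_child[OF z(1)] by (auto simp: rays_through_eq)
    moreover from this have "\<omega> (lev y) = y"
      using ray_child[of \<omega> "lev y"] z(1) by (simp add: children_def)
    ultimately have "\<omega> \<in> E x" using sub by (auto simp: rays_through_eq)
    then have "anc (Suc (lev y)) x = \<omega> (Suc (lev y))"
      using False anc_ray[of \<omega> "Suc (lev y)" "lev x"] by (auto simp: rays_through_eq)
    then show ?thesis using z \<open>\<omega> (Suc (lev y)) = z\<close> by simp
  qed
next
  assume "lev x \<le> lev y \<and> anc (lev x) y = x"
  then show "E y \<subseteq> E x" using anc_ray[of _ "lev x" "lev y"] unfolding rays_through_eq by fastforce
qed

lemma E_cases: "E x \<subseteq> E y \<or> E y \<subseteq> E x \<or> E x \<inter> E y = {}"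
proof (cases "lev x \<le> lev y")
  case True
  then have "anc (lev x) y = x" if "\<omega> \<in> E x" "\<omega> \<in> E y" for \<omega>
    using that anc_ray[of \<omega> "lev x" "lev y"] by (auto simp: rays_through_eq)
  then show ?thesis using True unfolding E_subset_iff by blast
next
  case False
  then have "anc (lev y) x = y" if "\<omega> \<in> E x" "\<omega> \<in> E y" for \<omega>
    using that anc_ray[of \<omega> "lev y" "lev x"] by (auto simp: rays_through_eq)
  then show ?thesis using False unfolding E_subset_iff by (meson disjoint_iff nat_le_linear)
qed

end

section \<open>Additive functions on the tree and measures on the boundary\<close>

context rooted_homogeneous_tree
begin

text \<open>Such functions are the finitely additive set functions on the clopen subsets of the boundary, given by
  their values on the sets \<open>E x\<close>.\<close>

definition additive :: "('v \<Rightarrow> 'b :: comm_monoid_add) \<Rightarrow> bool" where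
  "additive M \<longleftrightarrow> (\<forall>x. sum M (children x) = M x)"

definition below :: "nat \<Rightarrow> 'v \<Rightarrow> 'v set" where
  "below n x = {z \<in> S n. E z \<subseteq> E x}"

lemma finite_below [simp, intro]: "finite (below n x)"
  by (simp add: below_def)

lemma E_subset_if_meets: "\<omega> \<in> E y \<Longrightarrow> \<omega> \<in> E z \<Longrightarrow> lev y \<le> lev z \<Longrightarrow> E z \<subseteq> E y"
  using anc_ray[of \<omega> "lev y" "lev z"] unfolding E_subset_iff by (simp add: rays_through_eq)

lemma below_self [simp]: "below (lev x) x = {x}"
  by (auto simp: below_def E_subset_iff S_iff)

lemma below_Suc: "lev x \<le> n \<Longrightarrow> below (Suc n) x = (\<Union>y\<in>below n x. children y)"
  by (auto simp: below_def E_subset_iff S_Suc S_iff lev_child anc_child)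

lemma E_eq_UN_below: "lev x \<le> n \<Longrightarrow> E x = (\<Union>z\<in>below n x. E z)"
proof
  assume n: "lev x \<le> n"
  show "E x \<subseteq> (\<Union>z\<in>below n x. E z)"
  proof
    fix \<omega> assume w: "\<omega> \<in> E x"
    then have "\<omega> \<in> \<Omega>" using E_subset by blast
    then have "\<omega> \<in> E (\<omega> n)" "lev (\<omega> n) = n" by (auto simp: rays_through_eq lev_ray)
    moreover from this have "E (\<omega> n) \<subseteq> E x" using E_subset_if_meets[OF w] n by simp
    ultimately show "\<omega> \<in> (\<Union>z\<in>below n x. E z)" by (auto simp: below_def S_iff)
  qed
qed (auto simp: below_def)

lemma disjoint_E_S: "y \<in> S n \<Longrightarrow> z \<in> S n \<Longrightarrow> y \<noteq> z \<Longrightarrow> E y \<inter> E z = {}"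
  by (auto simp: rays_through_eq S_iff)

lemma below_Suc_lev: "below (Suc (lev x)) x = children x"
  by (simp add: below_Suc)

lemma E_eq_UN_children: "E x = (\<Union>y\<in>children x. E y)"
  using E_eq_UN_below[of x "Suc (lev x)"] by (simp add: below_Suc_lev)

lemma additive_sum_below:
  assumes "additive M" "lev x \<le> n"
  shows "sum M (below n x) = M x"
  using assms(2)
proof (induction n rule: dec_induct)
  case (step n)
  have "sum M (below (Suc n) x) = (\<Sum>y\<in>below n x. sum M (children y))"
    unfolding below_Suc[OF step.hyps(1)] by (rule sum.UNION_disjoint) (auto simp: children_disjoint)
  also have "\<dots> = M x" using assms(1) step.IH by (simp add: additive_def)
  finally show ?case .
qed simp

text \<open>The boundary is compact: were no finite subfamily to cover \<open>E x\<close>, then some ray through \<open>x\<close> would run, from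
  \<open>x\<close> on, through vertices whose sets are not finitely covered either; but a vertex far enough on that ray has its
  set inside a single member of the cover.\<close>

lemma E_compact:
  assumes cover: "E x \<subseteq> (\<Union>y\<in>Y. E y)"
  shows "\<exists>F\<subseteq>Y. finite F \<and> E x \<subseteq> (\<Union>y\<in>F. E y)"
proof (rule ccontr)
  let ?good = "\<lambda>v. \<exists>F\<subseteq>Y. finite F \<and> E v \<subseteq> (\<Union>y\<in>F. E y)"
  assume "\<not> ?good x"
  moreover have "\<exists>z\<in>children v. \<not> ?good z" if "\<not> ?good v" for v
  proof (rule ccontr)
    assume "\<not> (\<exists>z\<in>children v. \<not> ?good z)"
    then have "\<forall>z\<in>children v. \<exists>F. F \<subseteq> Y \<and> finite F \<and> E z \<subseteq> (\<Union>y\<in>F. E y)" by blast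
    from bchoice[OF this] obtain F
      where F: "\<And>z. z \<in> children v \<Longrightarrow> F z \<subseteq> Y \<and> finite (F z) \<and> E z \<subseteq> (\<Union>y\<in>F z. E y)"
      by blast
    have "?good v"
    proof (intro exI[of _ "\<Union>z\<in>children v. F z"] conjI)
      show "E v \<subseteq> (\<Union>y\<in>(\<Union>z\<in>children v. F z). E y)"
      proof
        fix \<omega> assume "\<omega> \<in> E v"
        then obtain z where "z \<in> children v" "\<omega> \<in> E z" unfolding E_eq_UN_children[of v] by blast
        then show "\<omega> \<in> (\<Union>y\<in>(\<Union>z\<in>children v. F z). E y)" using F[of z] by blast
      qed
    qed (use F in auto)
    then show False using that by simp
  qed
  ultimately obtain \<omega> where w: "\<omega> \<in> E x" "\<And>n. lev x \<le> n \<Longrightarrow> \<not> ?good (\<omega> n)"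
    using exists_ray_along[of "\<lambda>v. \<not> ?good v" x] by blast
  then obtain y where y: "y \<in> Y" "\<omega> \<in> E y" using cover by blast
  let ?n = "max (lev x) (lev y)"
  have "\<omega> \<in> \<Omega>" using w E_subset by blast
  then have "E (\<omega> ?n) \<subseteq> E y"
    by (intro E_subset_if_meets[OF y(2)]) (auto simp: rays_through_eq lev_ray)
  then have "?good (\<omega> ?n)" using y by (intro exI[of _ "{y}"]) auto
  then show False using w(2)[of ?n] by simp
qed

text \<open>All members of the partition can be cut into sets \<open>E z\<close> with \<open>z\<close> on one common sphere, on both sides.\<close>

lemma additive_finite_cover:
  assumes M: "additive (M :: 'v \<Rightarrow> real)" and fin: "finite I"
    and disj: "\<And>i j. i \<in> I \<Longrightarrow> j \<in> I \<Longrightarrow> i \<noteq> j \<Longrightarrow> E (y i) \<inter> E (y j) = {}"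
    and un: "(\<Union>i\<in>I. E (y i)) = E x"
  shows "(\<Sum>i\<in>I. M (y i)) = M x"
proof -
  define n where "n = Max (lev ` insert x (y ` I))"
  have le: "lev v \<le> n" if "v \<in> insert x (y ` I)" for v
    unfolding n_def using fin that by (intro Max_ge) auto
  have "below n x = (\<Union>i\<in>I. below n (y i))"
  proof
    show "below n x \<subseteq> (\<Union>i\<in>I. below n (y i))"
    proof
      fix z assume z: "z \<in> below n x"
      obtain \<omega> where w: "\<omega> \<in> E z" using E_nonempty by blast
      then obtain i where i: "i \<in> I" "\<omega> \<in> E (y i)" using un z by (auto simp: below_def)
      then have "E z \<subseteq> E (y i)" using w le[of "y i"] z
        by (intro E_subset_if_meets[of \<omega>]) (auto simp: below_def S_iff)
      then show "z \<in> (\<Union>i\<in>I. below n (y i))" using i z by (auto simp: below_def)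
    qed
  qed (use un in \<open>auto simp: below_def\<close>)
  moreover have "below n (y i) \<inter> below n (y j) = {}" if "i \<in> I" "j \<in> I" "i \<noteq> j" for i j
    using disj[OF that] E_nonempty by (fastforce simp: below_def)
  ultimately have "sum M (below n x) = (\<Sum>i\<in>I. sum M (below n (y i)))"
    using fin by (simp add: sum.UNION_disjoint)
  then show ?thesis using additive_sum_below[OF M] le by simp
qed

lemma E_semiring: "semiring_of_sets \<Omega> (insert {} (range E))"
proof
  show "insert {} (range E) \<subseteq> Pow \<Omega>" using E_subset by blast
  show "{} \<in> insert {} (range E)" by simp
  fix a b assume "a \<in> insert {} (range E)" "b \<in> insert {} (range E)"
  then have ab: "(a = {} \<or> (\<exists>x. a = E x)) \<and> (b = {} \<or> (\<exists>y. b = E y))" by auto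
  then show "a \<inter> b \<in> insert {} (range E)"
    using E_cases by (metis Int_absorb1 Int_absorb2 Int_empty_left Int_empty_right insert_iff rangeI)
  show "\<exists>C\<subseteq>insert {} (range E). finite C \<and> disjoint C \<and> a - b = \<Union>C"
  proof (cases "a = {} \<or> a \<inter> b = {} \<or> a \<subseteq> b")
    case True
    then consider "a - b = {}" | "a - b = a" by blast
    then show ?thesis
    proof cases
      case 1
      then show ?thesis by (intro exI[of _ "{}"]) auto
    next
      case 2
      then show ?thesis using ab by (intro exI[of _ "{a}"]) auto
    qed
  next
    case False
    then obtain x y where xy: "a = E x" "b = E y" "E y \<subseteq> E x"
      using ab E_cases by (metis Int_empty_right)
    let ?B = "below (lev y) x"
    have y: "y \<in> ?B" using xy by (simp add: below_def S_iff)
    have "lev x \<le> lev y" using xy E_subset_iff by blast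
    then have "E x = (\<Union>z\<in>?B. E z)" by (rule E_eq_UN_below)
    moreover have disj: "E z \<inter> E z' = {}" if "z \<in> ?B" "z' \<in> ?B" "z \<noteq> z'" for z z'
      using that disjoint_E_S[of z "lev y" z'] by (simp add: below_def)
    ultimately have "E x - E y = \<Union>(E ` (?B - {y}))" using y by blast
    moreover have "disjoint (E ` (?B - {y}))"
      using disj by (force simp: disjoint_def)
    ultimately show ?thesis using xy by (intro exI[of _ "E ` (?B - {y})"]) auto
  qed
qed

text \<open>Caratheodory's extension theorem applies: by compactness a countable partition of some \<open>E x\<close> into sets of
  the semiring has only finitely many non-empty members, so countable additivity reduces to the finite
  case. The option type serves to index the empty set, which is not of the form \<open>E x\<close>.\<close>

lemma exists_measure_of_additive:
  fixes M :: "'v \<Rightarrow> real"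
  assumes M: "additive M" and nonneg: "\<And>x. 0 \<le> M x"
  shows "\<exists>N. space N = \<Omega> \<and> sets N = sigma_sets \<Omega> (range E) \<and> (\<forall>x. emeasure N (E x) = ennreal (M x))"
proof -
  define G where "G i = (case i of None \<Rightarrow> {} | Some x \<Rightarrow> E x)" for i
  define \<mu> where "\<mu> i = (case i of None \<Rightarrow> 0 | Some x \<Rightarrow> ennreal (M x))" for i
  have ran: "range G = insert {} (range E)"
    by (auto simp: G_def image_def split: option.splits)
  have G_empty: "G i = {} \<longleftrightarrow> i = None" for i
    using E_nonempty by (auto simp: G_def split: option.splits)
  let ?N = "extend_measure \<Omega> UNIV G \<mu>"
  have Pow: "range G \<subseteq> Pow \<Omega>" unfolding ran using E_subset by blast
  have eq: "\<mu> i = \<mu> j" if "G i = G j" for i j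
  proof (cases i)
    case None
    then have "G i = {}" unfolding G_empty .
    then have "j = None" unfolding that G_empty .
    then show ?thesis using None by simp
  next
    case (Some x)
    then have "G i \<noteq> {}" unfolding G_empty by simp
    then have "j \<noteq> None" unfolding that G_empty .
    then obtain y where "j = Some y" by blast
    then have "E x = E y" using that Some by (simp add: G_def)
    then have "M x = M y" using additive_finite_cover[OF M, of "{y}" "\<lambda>y. y" x] by simp
    then show ?thesis using Some \<open>j = Some y\<close> by (simp add: \<mu>_def)
  qed
  have add: "(\<Sum>n. \<mu> (A n)) = \<mu> j"
    if disj: "disjoint_family (G \<circ> A)" and un: "(\<Union>i. G (A i)) = G j" for A :: "nat \<Rightarrow> 'v option" and j
  proof (cases j)
    case None
    then have "G j = {}" unfolding G_empty .
    then have "G (A i) = {}" for i using un by blast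
    then have "\<mu> (A i) = 0" for i using G_empty by (simp add: \<mu>_def)
    then show ?thesis using None by (simp add: \<mu>_def)
  next
    case (Some x)
    have memG: "\<omega> \<in> G i \<longleftrightarrow> (\<exists>y. i = Some y \<and> \<omega> \<in> E y)" for \<omega> i
      by (simp add: G_def split: option.splits)
    have un': "(\<Union>i. G (A i)) = E x" unfolding un Some by (simp add: G_def)
    have "E x \<subseteq> (\<Union>y\<in>{y. Some y \<in> range A}. E y)"
    proof
      fix \<omega> assume "\<omega> \<in> E x"
      then obtain i y where "A i = Some y" "\<omega> \<in> E y" unfolding un'[symmetric] using memG by blast
      then show "\<omega> \<in> (\<Union>y\<in>{y. Some y \<in> range A}. E y)" by (metis (mono_tags) UN_I mem_Collect_eq rangeI)
    qed
    then obtain F where F: "F \<subseteq> {y. Some y \<in> range A}" "finite F" "E x \<subseteq> (\<Union>y\<in>F. E y)"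
      using E_compact[of x] by blast
    then have "\<forall>y\<in>F. \<exists>i. A i = Some y" by fastforce
    from bchoice[OF this] obtain c where c: "\<And>y. y \<in> F \<Longrightarrow> A (c y) = Some y" by blast
    define I where "I = c ` F"
    have I: "finite I" "\<And>i. i \<in> I \<Longrightarrow> \<exists>y. A i = Some y" using F c by (auto simp: I_def)
    have cov: "E x \<subseteq> (\<Union>i\<in>I. G (A i))"
    proof
      fix \<omega> assume "\<omega> \<in> E x"
      then obtain y where "y \<in> F" "\<omega> \<in> E y" using F(3) by blast
      then have "c y \<in> I" "\<omega> \<in> G (A (c y))" by (simp_all add: I_def memG c)
      then show "\<omega> \<in> (\<Union>i\<in>I. G (A i))" by (rule UN_I)
    qed
    have "A i = None" if "i \<notin> I" for i
    proof (rule ccontr)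
      assume "A i \<noteq> None"
      then have "G (A i) \<noteq> {}" unfolding G_empty .
      then obtain \<omega> where w: "\<omega> \<in> G (A i)" by blast
      then have "\<omega> \<in> E x" unfolding un'[symmetric] by blast
      then obtain k where k: "k \<in> I" "\<omega> \<in> G (A k)" using cov by blast
      then have "i \<noteq> k" using that by blast
      then have "G (A i) \<inter> G (A k) = {}" using disj by (simp add: disjoint_family_on_def)
      then show False using w k by blast
    qed
    then have "(\<Sum>n. \<mu> (A n)) = (\<Sum>i\<in>I. \<mu> (A i))"
      using I by (intro suminf_finite) (auto simp: \<mu>_def)
    also have "\<dots> = (\<Sum>i\<in>I. ennreal (M (the (A i))))"
      using I(2) by (intro sum.cong) (auto simp: \<mu>_def dest: I(2))
    also have "\<dots> = ennreal (\<Sum>i\<in>I. M (the (A i)))"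
      by (rule sum_ennreal) (rule nonneg)
    also have "(\<Sum>i\<in>I. M (the (A i))) = M x"
    proof (rule additive_finite_cover[OF M I(1)])
      have G': "G (A i) = E (the (A i))" if "i \<in> I" for i using I(2)[OF that] by (auto simp: G_def)
      show "E (the (A i)) \<inter> E (the (A j)) = {}" if "i \<in> I" "j \<in> I" "i \<noteq> j" for i j
        using disj that by (simp add: disjoint_family_on_def G'[symmetric])
      have "(\<Union>i\<in>I. G (A i)) = E x" using cov un' by blast
      then show "(\<Union>i\<in>I. E (the (A i))) = E x" by (simp add: G')
    qed
    finally show ?thesis using Some by (simp add: \<mu>_def)
  qed
  have em: "emeasure ?N (G i) = \<mu> i" for i
  proof (rule extend_measure_caratheodory[OF refl])
    show "semiring_of_sets \<Omega> (range G)" unfolding ran by (rule E_semiring)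
  qed (auto simp: G_empty \<mu>_def[of None] intro: eq add)
  have "sigma_sets \<Omega> (range G) = sigma_sets \<Omega> (range E)"
    unfolding ran by (intro sigma_sets_eqI) (auto intro: sigma_sets.intros)
  then have "sets ?N = sigma_sets \<Omega> (range E)" "space ?N = \<Omega>"
    using Pow by (simp_all add: sets_extend_measure space_extend_measure)
  moreover have "emeasure ?N (E x) = ennreal (M x)" for x
    using em[of "Some x"] by (simp add: G_def \<mu>_def)
  ultimately show ?thesis by blast
qed

subsection \<open>The canonical measure\<close>

definition weight :: "'v \<Rightarrow> real" where "weight x = 1 / real (card (S (lev x)))"

abbreviation \<nu> :: "(nat \<Rightarrow> 'v) measure" where "\<nu> \<equiv> boundary_measure adj q v0"

lemma weight_pos: "0 < weight x"
  using card_S_pos[of "lev x"] by (simp add: weight_def)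

lemma weight_S: "x \<in> S n \<Longrightarrow> weight x = 1 / real (card (S n))"
  by (simp add: weight_def S_iff)

lemma weight_child: "y \<in> children x \<Longrightarrow> real (card (children x)) * weight y = weight x"
  using card_S_Suc_children[of x "lev x"] card_children[of x] card_S_pos[of "lev x"] q_ge_2
  by (simp add: weight_def lev_child S_iff field_simps)

lemma additive_weight: "additive weight"
proof -
  have "sum weight (children x) = weight x" for x
  proof -
    obtain z where z: "z \<in> children x" using children_nonempty by blast
    have "weight y = weight z" if "y \<in> children x" for y using that z by (simp add: weight_def lev_child)
    then have "sum weight (children x) = (\<Sum>y\<in>children x. weight z)" by (intro sum.cong) auto
    also have "\<dots> = weight x" using weight_child[OF z] by simp
    finally show ?thesis .
  qed
  then show ?thesis by (simp add: additive_def)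
qed

lemma weight_explicit:
  "weight x = (if x = v0 then 1 else 1 / ((real q + 1) * real q ^ (lev x - 1)))"
proof (cases "lev x")
  case (Suc n)
  then have "x \<noteq> v0" by auto
  then show ?thesis using Suc card_S_Suc[of n] by (simp add: weight_def algebra_simps)
qed (simp add: weight_def)

lemma space_\<nu>: "space \<nu> = \<Omega>" and sets_\<nu>: "sets \<nu> = sigma_sets \<Omega> (range E)"
proof -
  have "range E \<subseteq> Pow \<Omega>" using E_subset by blast
  then show "space \<nu> = \<Omega>" "sets \<nu> = sigma_sets \<Omega> (range E)"
    by (simp_all add: boundary_measure_def space_extend_measure sets_extend_measure)
qed

lemma E_sets [measurable]: "E x \<in> sets \<nu>"
  by (simp add: sets_\<nu> sigma_sets.Basic)

lemma emeasure_\<nu>_E: "emeasure \<nu> (E x) = ennreal (weight x)"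
proof -
  obtain N where N: "space N = \<Omega>" "sets N = sigma_sets \<Omega> (range E)" "\<And>x. emeasure N (E x) = ennreal (weight x)"
    using exists_measure_of_additive[OF additive_weight] weight_pos by (metis less_imp_le)
  have "emeasure \<nu> (E x) = ennreal (if x = v0 then 1 else 1 / ((real q + 1) * real q ^ (graph_dist adj v0 x - 1)))"
  proof (rule emeasure_extend_measure[OF boundary_measure_def, where \<mu>' = "emeasure N"])
    show "positive (sets \<nu>) (emeasure N)" "countably_additive (sets \<nu>) (emeasure N)"
      using measure_space[of N] N(2) sets_\<nu> by (auto simp: measure_space_def)
    show "range E \<subseteq> Pow \<Omega>" using E_subset by blast
  qed (simp_all add: N(3) weight_explicit lev_def)
  then show ?thesis by (simp add: weight_explicit lev_def)
qed

sublocale \<nu>: prob_space \<nu>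
  using emeasure_\<nu>_E[of v0] by (intro prob_spaceI) (simp add: space_\<nu> weight_explicit)

lemma measure_\<nu>_E: "measure \<nu> (E x) = weight x"
  using emeasure_\<nu>_E[of x] weight_pos[of x] by (simp add: measure_def)

lemma sets_eq_imp_space: "sets N = sets \<nu> \<Longrightarrow> space N = \<Omega>"
  using sets_eq_imp_space_eq[of N \<nu>] by (simp add: space_\<nu>)

lemma exists_finite_measure_of_additive:
  fixes M :: "'v \<Rightarrow> real"
  assumes M: "additive M" and nonneg: "\<And>x. 0 \<le> M x"
  shows "\<exists>N. finite_measure N \<and> sets N = sets \<nu> \<and> (\<forall>x. measure N (E x) = M x)"
proof -
  obtain N where N: "space N = \<Omega>" "sets N = sigma_sets \<Omega> (range E)" "\<And>x. emeasure N (E x) = ennreal (M x)"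
    using exists_measure_of_additive[OF assms] by blast
  have "finite_measure N" using N(1) N(3)[of v0] by (intro finite_measureI) simp
  then show ?thesis using N nonneg sets_\<nu> by (intro exI[of _ N]) (auto simp: measure_def)
qed

lemma additive_measure:
  assumes "finite_measure N" "sets N = sets \<nu>"
  shows "additive (\<lambda>x. measure N (E x))"
proof -
  interpret finite_measure N by fact
  have "(\<Sum>y\<in>children x. measure N (E y)) = measure N (E x)" for x
  proof -
    have "measure N (\<Union>y\<in>children x. E y) = (\<Sum>y\<in>children x. measure N (E y))"
    proof (rule finite_measure_finite_Union)
      show "disjoint_family_on E (children x)"
        using disjoint_E_S[of _ "Suc (lev x)"] by (auto simp: disjoint_family_on_def S_iff lev_child)
      show "E ` children x \<subseteq> sets N" unfolding assms(2) using E_sets by blast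
    qed simp
    then show ?thesis unfolding E_eq_UN_children[of x, symmetric] by simp
  qed
  then show ?thesis by (simp add: additive_def)
qed

lemma additive_integral:
  fixes F :: "_ \<Rightarrow> 'b :: {banach, second_countable_topology}"
  assumes "integrable \<nu> F"
  shows "additive (\<lambda>x. LINT \<omega>|\<nu>. indicator (E x) \<omega> *\<^sub>R F \<omega>)"
proof -
  have "(\<Sum>y\<in>children x. (LINT \<omega>|\<nu>. indicator (E y) \<omega> *\<^sub>R F \<omega>)) = (LINT \<omega>|\<nu>. indicator (E x) \<omega> *\<^sub>R F \<omega>)" for x
  proof -
    have "(\<Sum>y\<in>children x. (LINT \<omega>|\<nu>. indicator (E y) \<omega> *\<^sub>R F \<omega>))
        = (LINT \<omega>|\<nu>. (\<Sum>y\<in>children x. indicator (E y) \<omega> *\<^sub>R F \<omega>))"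
      using assms by (intro Bochner_Integration.integral_sum[symmetric] integrable_scaleR_left
          integrable_mult_indicator) (simp_all add: E_sets)
    also have "\<dots> = (LINT \<omega>|\<nu>. indicator (E x) \<omega> *\<^sub>R F \<omega>)"
    proof (rule Bochner_Integration.integral_cong[OF refl])
      fix \<omega>
      have "(\<Sum>y\<in>children x. indicator (E y) \<omega> :: real) = indicator (\<Union>y\<in>children x. E y) \<omega>"
        using disjoint_E_S[of _ "Suc (lev x)"]
        by (intro indicator_UN_disjoint[symmetric]) (auto simp: disjoint_family_on_def S_iff lev_child)
      then show "(\<Sum>y\<in>children x. indicator (E y) \<omega> *\<^sub>R F \<omega>) = indicator (E x) \<omega> *\<^sub>R F \<omega>"
        unfolding E_eq_UN_children[of x, symmetric] by (simp only: scaleR_sum_left[symmetric])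
    qed
    finally show ?thesis .
  qed
  then show ?thesis by (simp add: additive_def)
qed

end

section \<open>The Poisson transform of an additive function\<close>

context rooted_homogeneous_tree
begin

text \<open>The Poisson integral with base \<open>Q\<close> of a set function with masses \<open>M\<close>, after summation by parts over
  the geodesic from the root to \<open>x\<close>.\<close>

definition tree_poisson :: "'b :: field \<Rightarrow> ('v \<Rightarrow> 'b) \<Rightarrow> 'v \<Rightarrow> 'b" where
  "tree_poisson Q M x = (M v0 + (1 - 1 / Q ^ 2) * (\<Sum>j=1..lev x. Q ^ (2 * j) * M (anc j x))) / Q ^ lev x"

lemma tree_poisson_v0 [simp]: "tree_poisson Q M v0 = M v0"
  by (simp add: tree_poisson_def)

text \<open>The sum for \<open>x\<close> has just one more term than the sum for its parent. This is the inversion formula: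
  it determines \<open>M x\<close> from the values of the transform at \<open>x\<close> and at its parent.\<close>

lemma tree_poisson_step:
  assumes Q: "Q \<noteq> 0" and x: "x \<noteq> v0"
  shows "tree_poisson Q M x = tree_poisson Q M (par x) / Q + (1 - 1 / Q ^ 2) * Q ^ lev x * M x"
proof -
  obtain n where n: "lev x = Suc n" using x by (metis lev_eq_0_iff not0_implies_Suc)
  have anc: "anc j (par x) = anc j x" if "j \<in> {1..n}" for j using that n by (intro anc_par) auto
  have "(\<Sum>j=1..lev x. Q ^ (2 * j) * M (anc j x))
      = (\<Sum>j=1..n. Q ^ (2 * j) * M (anc j (par x))) + Q ^ (2 * lev x) * M x"
    using n anc by simp
  then have "tree_poisson Q M x = (M v0 + (1 - 1 / Q ^ 2) * (\<Sum>j=1..n. Q ^ (2 * j) * M (anc j (par x)))) / Q ^ lev x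
      + (1 - 1 / Q ^ 2) * (Q ^ (2 * lev x) / Q ^ lev x) * M x"
    by (simp add: tree_poisson_def add_divide_distrib distrib_left mult.assoc)
  moreover have "Q ^ (2 * lev x) / Q ^ lev x = Q ^ lev x"
    using Q by (simp add: power_mult power2_eq_square power_mult_distrib mult_2 power_add)
  ultimately show ?thesis using n by (simp add: tree_poisson_def lev_par field_simps)
qed

text \<open>Summing the previous formula over the children of \<open>x\<close> replaces their masses by \<open>M x\<close>, which the same
  formula at \<open>x\<close> expresses through \<open>x\<close> and its parent.\<close>

lemma tree_poisson_eigenfunction:
  assumes Q: "Q \<noteq> 0" and M: "additive M"
  shows "(\<Sum>y | adj x y. tree_poisson Q M y) = (Q + of_nat q / Q) * tree_poisson Q M x"
proof -
  let ?u = "tree_poisson Q M" and ?k = "1 - 1 / Q ^ 2"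
  have "?u y = ?u x / Q + ?k * Q ^ Suc (lev x) * M y" if "y \<in> children x" for y
    using that tree_poisson_step[OF Q, of y M] lev_child[OF that] by (simp add: children_def)
  then have ch: "sum ?u (children x) = of_nat (card (children x)) * (?u x / Q) + ?k * Q ^ Suc (lev x) * M x"
    using M by (simp add: additive_def sum.distrib sum_distrib_left[symmetric])
  show ?thesis
  proof (cases "x = v0")
    case True
    have k: "?k * Q = Q - 1 / Q" using Q by (simp add: left_diff_distrib power2_eq_square)
    have "sum ?u (children x) = of_nat (q + 1) * (M v0 / Q) + ?k * Q * M v0"
      unfolding ch using True by (simp add: card_children)
    then have "sum ?u (children x) = of_nat (q + 1) * (M v0 / Q) + (Q - 1 / Q) * M v0"
      unfolding k .
    then show ?thesis using True by (simp add: sum_neighbours algebra_simps add_divide_distrib)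
  next
    case False
    then have "?k * Q ^ lev x * M x = ?u x - ?u (par x) / Q" using tree_poisson_step[OF Q False, of M] by simp
    then have "?k * Q ^ Suc (lev x) * M x = Q * ?u x - ?u (par x)"
      using Q by (simp add: field_simps)
    then have "sum ?u (children x) = of_nat (card (children x)) * (?u x / Q) + (Q * ?u x - ?u (par x))"
      unfolding ch by (simp only:)
    then show ?thesis using False by (simp add: sum_neighbours card_children algebra_simps)
  qed
qed

text \<open>The inversion formula leaves only one candidate for \<open>M\<close>; the computation of the previous lemma, read
  backwards, shows that it is additive.\<close>

lemma eigenfunction_is_tree_poisson:
  fixes u :: "'v \<Rightarrow> 'b :: field"
  assumes Q: "Q \<noteq> 0" "Q ^ 2 \<noteq> 1"
    and eig: "\<And>x. (\<Sum>y | adj x y. u y) = (Q + of_nat q / Q) * u x"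
  shows "\<exists>M. additive M \<and> u = tree_poisson Q M"
proof -
  define k where "k = 1 - 1 / Q ^ 2"
  have k: "k \<noteq> 0" using Q by (simp add: k_def)
  define M where "M x = (if x = v0 then u v0 else (u x - u (par x) / Q) / (k * Q ^ lev x))" for x
  have M0: "k * Q ^ lev x * M x = u x - u (par x) / Q" if "x \<noteq> v0" for x
    using that k Q by (simp add: M_def)
  have "tree_poisson Q M x = u x" for x
  proof (induction "lev x" arbitrary: x)
    case 0
    then show ?case by (simp add: M_def)
  next
    case (Suc n)
    then have x: "x \<noteq> v0" by auto
    have "tree_poisson Q M (par x) = u (par x)" using Suc by (simp add: lev_par flip: Suc.hyps(2))
    then show ?case using tree_poisson_step[OF Q(1) x, of M] M0[OF x] by (simp add: k_def)
  qed
  then have "u = tree_poisson Q M" by auto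
  moreover have "sum M (children x) = M x" for x
  proof -
    have kQ: "k * Q ^ Suc (lev x) \<noteq> 0" using k Q by simp
    have "k * Q ^ Suc (lev x) * M y = u y - u x / Q" if "y \<in> children x" for y
      using M0[of y] that lev_child[OF that] by (simp add: children_def)
    then have "k * Q ^ Suc (lev x) * sum M (children x) = sum u (children x) - of_nat (card (children x)) * (u x / Q)"
      by (simp add: sum_distrib_left sum_subtractf)
    also have "\<dots> = k * Q ^ Suc (lev x) * M x"
    proof (cases "x = v0")
      case True
      then show ?thesis using eig[of x] Q
        by (simp add: sum_neighbours card_children M_def k_def field_simps power2_eq_square)
    next
      case False
      have "sum u (children x) - of_nat (card (children x)) * (u x / Q) = Q * (u x - u (par x) / Q)"
        using eig[of x] False Q by (simp add: sum_neighbours card_children field_simps)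
      then show ?thesis using M0[OF False] by (simp add: mult_ac)
    qed
    finally show ?thesis using kQ by simp
  qed
  then have "additive M" by (simp add: additive_def)
  ultimately show ?thesis by blast
qed

subsection \<open>The kernel\<close>

text \<open>A telescoping sum: only the ancestors of \<open>x\<close> that lie on the ray contribute. With \<open>Q\<close> a power of \<open>q\<close> the
  right-hand side is that power of the Poisson kernel.\<close>

lemma tree_poisson_indicator:
  assumes Q: "Q \<noteq> 0" and w: "\<omega> \<in> \<Omega>"
  shows "tree_poisson Q (\<lambda>y. indicator (E y) \<omega>) x = Q ^ (2 * lev (confluence adj v0 x \<omega>)) / Q ^ lev x"
proof -
  define c where "c = lev (confluence adj v0 x \<omega>)"
  have c: "c \<le> lev x" using le_lev_confluence_iff[OF w, of c x] by (simp add: c_def)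
  have "indicator (E (anc j x)) \<omega> = (if j \<le> c then 1 else 0 :: 'a)" if "j \<in> {1..lev x}" for j
    using mem_E_anc_iff[OF w, of j x] that by (simp add: c_def indicator_def)
  then have "(\<Sum>j=1..lev x. Q ^ (2 * j) * indicator (E (anc j x)) \<omega>)
      = (\<Sum>j=1..lev x. if j \<le> c then Q ^ (2 * j) else 0)"
    by (intro sum.cong) auto
  also have "\<dots> = (\<Sum>j=1..c. Q ^ (2 * j))"
    using c by (intro sum.mono_neutral_cong_right) auto
  finally have "tree_poisson Q (\<lambda>y. indicator (E y) \<omega>) x
      = (1 + (1 - 1 / Q ^ 2) * (\<Sum>j=1..c. Q ^ (2 * j))) / Q ^ lev x"
    using w by (simp add: tree_poisson_def)
  also have "1 + (1 - 1 / Q ^ 2) * (\<Sum>j=1..c. Q ^ (2 * j)) = Q ^ (2 * c)"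
    using Q by (induction c) (simp_all add: field_simps power2_eq_square)
  finally show ?thesis by (simp add: c_def)
qed

lemma q_powr_nonzero: "(of_nat q :: complex) powr s \<noteq> 0"
  using q_ge_2 by simp

lemma norm_q_powr: "norm ((of_nat q :: complex) powr s) = real q powr Re s"
  using norm_powr_real_powr[of "of_nat q" s] by simp

lemma poisson_kernel_powr:
  assumes w: "\<omega> \<in> \<Omega>"
  shows "complex_of_real (poisson_kernel adj q v0 x \<omega>) powr s
    = tree_poisson (of_nat q powr s) (\<lambda>y. indicator (E y) \<omega>) x"
proof -
  define c where "c = lev (confluence adj v0 x \<omega>)"
  let ?Q = "of_nat q powr s :: complex"
  have q: "0 < real q" using q_ge_2 by simp
  have ker: "poisson_kernel adj q v0 x \<omega> = real q ^ (2 * c) / real q ^ lev x"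
    using q by (simp add: poisson_kernel_def c_def lev_def power_int_diff) (metis of_nat_mult of_nat_numeral power_int_of_nat)
  have Q: "?Q = exp (s * of_real (ln (real q)))"
    using q by (simp add: powr_def Ln_of_nat)
  have "complex_of_real (poisson_kernel adj q v0 x \<omega>) powr s
      = exp (s * of_real (ln (real q ^ (2 * c) / real q ^ lev x)))"
    unfolding ker using q by (simp add: powr_def Ln_of_real del: of_real_divide of_real_power)
  also have "ln (real q ^ (2 * c) / real q ^ lev x) = real (2 * c) * ln (real q) - real (lev x) * ln (real q)"
    using q by (simp add: ln_div ln_realpow)
  also have "exp (s * of_real (real (2 * c) * ln (real q) - real (lev x) * ln (real q))) = ?Q ^ (2 * c) / ?Q ^ lev x"
    unfolding Q exp_of_nat_mult[symmetric] exp_diff[symmetric]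
    by (rule arg_cong[where f = exp]) (simp add: algebra_simps)
  finally show ?thesis using tree_poisson_indicator[OF q_powr_nonzero w, of s x] by (simp add: c_def)
qed

lemma norm_tree_poisson_indicator:
  fixes Q :: complex
  assumes "Q \<noteq> 0" "\<omega> \<in> \<Omega>"
  shows "norm (tree_poisson Q (\<lambda>y. indicator (E y) \<omega>) x) = tree_poisson (norm Q) (\<lambda>y. indicator (E y) \<omega>) x"
  using assms by (simp add: tree_poisson_indicator norm_divide norm_power)

lemma tree_poisson_linear:
  "tree_poisson Q (\<lambda>y. a * M y) x = a * tree_poisson Q M x"
  "tree_poisson Q (\<lambda>y. M y + N y) x = tree_poisson Q M x + tree_poisson Q N x"
  "tree_poisson Q (\<lambda>y. M y - N y) x = tree_poisson Q M x - tree_poisson Q N x"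
  by (simp_all add: tree_poisson_def sum_distrib_left sum.distrib sum_subtractf
      algebra_simps add_divide_distrib diff_divide_distrib)

lemma tree_poisson_integral:
  fixes Q :: "'b :: {real_normed_field, banach, second_countable_topology}"
  assumes "\<And>y. integrable N (h y)"
  shows "integrable N (\<lambda>\<omega>. tree_poisson Q (\<lambda>y. h y \<omega>) x)"
    and "(LINT \<omega>|N. tree_poisson Q (\<lambda>y. h y \<omega>) x) = tree_poisson Q (\<lambda>y. LINT \<omega>|N. h y \<omega>) x"
proof -
  have i: "integrable N (\<lambda>\<omega>. \<Sum>j=1..lev x. Q ^ (2 * j) * h (anc j x) \<omega>)"
    by (intro Bochner_Integration.integrable_sum integrable_mult_right assms)
  then show "integrable N (\<lambda>\<omega>. tree_poisson Q (\<lambda>y. h y \<omega>) x)"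
    unfolding tree_poisson_def
    by (intro integrable_divide_zero Bochner_Integration.integrable_add integrable_mult_right assms)
  show "(LINT \<omega>|N. tree_poisson Q (\<lambda>y. h y \<omega>) x) = tree_poisson Q (\<lambda>y. LINT \<omega>|N. h y \<omega>) x"
    unfolding tree_poisson_def using assms i
    by (simp add: Bochner_Integration.integral_sum)
qed

lemma LINT_indicator_E:
  assumes "finite_measure N" "sets N = sets \<nu>"
  shows "integrable N (indicator (E y) :: _ \<Rightarrow> complex)"
    "(LINT \<omega>|N. (indicator (E y) \<omega> :: complex)) = of_real (measure N (E y))"
proof -
  interpret finite_measure N by fact
  have [measurable]: "E y \<in> sets N" using assms E_sets by simp
  have "has_bochner_integral N (\<lambda>\<omega>. indicator (E y) \<omega> *\<^sub>R (1 :: complex)) (measure N (E y) *\<^sub>R 1)"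
    by (rule has_bochner_integral_indicator) (auto simp: less_top[symmetric])
  moreover have "(\<lambda>\<omega>. indicator (E y) \<omega> *\<^sub>R (1 :: complex)) = indicator (E y)"
    by (auto simp: indicator_def)
  ultimately have "has_bochner_integral N (indicator (E y)) (complex_of_real (measure N (E y)))"
    by (simp add: scaleR_conv_of_real)
  then show "integrable N (indicator (E y) :: _ \<Rightarrow> complex)"
    "(LINT \<omega>|N. (indicator (E y) \<omega> :: complex)) = of_real (measure N (E y))"
    by (simp_all add: has_bochner_integral_iff)
qed

text \<open>The kernel is a linear combination of indicators of sets \<open>E y\<close>, so the integral involves the measure only
  through its masses on these sets.\<close>

lemma LINT_kernel_measure:
  assumes N: "finite_measure N" "sets N = sets \<nu>"
  shows "(LINT \<omega>|N. complex_of_real (poisson_kernel adj q v0 x \<omega>) powr s)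
    = tree_poisson (of_nat q powr s) (\<lambda>y. of_real (measure N (E y))) x"
proof -
  have "(LINT \<omega>|N. complex_of_real (poisson_kernel adj q v0 x \<omega>) powr s)
      = (LINT \<omega>|N. tree_poisson (of_nat q powr s) (\<lambda>y. indicator (E y) \<omega>) x)"
    using sets_eq_imp_space[OF N(2)]
    by (intro Bochner_Integration.integral_cong refl poisson_kernel_powr) simp
  then show ?thesis
    using tree_poisson_integral(2)[of N "\<lambda>y. indicator (E y)", OF LINT_indicator_E(1)[OF N]]
      LINT_indicator_E(2)[OF N] by simp
qed

definition mass :: "((nat \<Rightarrow> 'v) \<Rightarrow> 'b :: {banach, second_countable_topology}) \<Rightarrow> 'v \<Rightarrow> 'b" where
  "mass F x = (LINT \<omega>|\<nu>. indicator (E x) \<omega> *\<^sub>R F \<omega>)"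

lemma integrable_indicator_E:
  fixes F :: "_ \<Rightarrow> 'b :: {banach, second_countable_topology}"
  shows "integrable \<nu> F \<Longrightarrow> integrable \<nu> (\<lambda>\<omega>. indicator (E x) \<omega> *\<^sub>R F \<omega>)"
  by (rule integrable_mult_indicator) (rule E_sets)

lemma tree_poisson_indicator_mult:
  fixes F :: "_ \<Rightarrow> 'b :: real_normed_field"
  shows "tree_poisson Q (\<lambda>y. indicator (E y) \<omega>) x * F \<omega> = tree_poisson Q (\<lambda>y. indicator (E y) \<omega> *\<^sub>R F \<omega>) x"
proof -
  have "indicator (E y) \<omega> *\<^sub>R F \<omega> = F \<omega> * indicator (E y) \<omega>" for y
    by (simp add: indicator_def)
  then show ?thesis by (simp add: tree_poisson_linear(1) mult.commute)
qed

lemma poisson_transform_eq: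
  assumes F: "integrable \<nu> F"
  shows "poisson_transform adj q v0 z F = tree_poisson (of_nat q powr (1 / 2 + \<i> * z)) (mass F)"
proof
  fix x
  let ?Q = "of_nat q powr (1 / 2 + \<i> * z) :: complex"
  have "poisson_transform adj q v0 z F x = (LINT \<omega>|\<nu>. tree_poisson ?Q (\<lambda>y. indicator (E y) \<omega> *\<^sub>R F \<omega>) x)"
    unfolding poisson_transform_def
    by (intro Bochner_Integration.integral_cong refl)
       (simp add: space_\<nu> poisson_kernel_powr tree_poisson_indicator_mult)
  then show "poisson_transform adj q v0 z F x = tree_poisson ?Q (mass F) x"
    using tree_poisson_integral(2)[of \<nu> "\<lambda>y \<omega>. indicator (E y) \<omega> *\<^sub>R F \<omega>", OF integrable_indicator_E[OF F]]
    by (simp add: mass_def[abs_def])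
qed

lemma norm_tree_poisson_mass_le:
  fixes Q :: complex
  assumes F: "integrable \<nu> F" and Q: "Q \<noteq> 0"
  shows "norm (tree_poisson Q (mass F) x) \<le> tree_poisson (norm Q) (mass (\<lambda>\<omega>. norm (F \<omega>))) x"
proof -
  have F': "integrable \<nu> (\<lambda>\<omega>. norm (F \<omega>))" using F by simp
  have "norm (tree_poisson Q (mass F) x) = norm (LINT \<omega>|\<nu>. tree_poisson Q (\<lambda>y. indicator (E y) \<omega> *\<^sub>R F \<omega>) x)"
    using tree_poisson_integral(2)[of \<nu> "\<lambda>y \<omega>. indicator (E y) \<omega> *\<^sub>R F \<omega>", OF integrable_indicator_E[OF F]]
    by (simp add: mass_def[abs_def])
  also have "\<dots> \<le> (LINT \<omega>|\<nu>. norm (tree_poisson Q (\<lambda>y. indicator (E y) \<omega> *\<^sub>R F \<omega>) x))"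
    by (rule integral_norm_bound)
  also have "\<dots> = (LINT \<omega>|\<nu>. tree_poisson (norm Q) (\<lambda>y. indicator (E y) \<omega> *\<^sub>R norm (F \<omega>)) x)"
  proof (rule Bochner_Integration.integral_cong[OF refl])
    fix \<omega> assume "\<omega> \<in> space \<nu>"
    then have "norm (tree_poisson Q (\<lambda>y. indicator (E y) \<omega>) x * F \<omega>)
        = tree_poisson (norm Q) (\<lambda>y. indicator (E y) \<omega>) x * norm (F \<omega>)"
      using Q by (simp add: space_\<nu> norm_mult norm_tree_poisson_indicator)
    then show "norm (tree_poisson Q (\<lambda>y. indicator (E y) \<omega> *\<^sub>R F \<omega>) x)
        = tree_poisson (norm Q) (\<lambda>y. indicator (E y) \<omega> *\<^sub>R norm (F \<omega>)) x"
      using tree_poisson_indicator_mult[of "norm Q" \<omega> x "\<lambda>\<omega>. norm (F \<omega>)"]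
      by (simp only: tree_poisson_indicator_mult)
  qed
  also have "\<dots> = tree_poisson (norm Q) (mass (\<lambda>\<omega>. norm (F \<omega>))) x"
    using tree_poisson_integral(2)[of \<nu> "\<lambda>y \<omega>. indicator (E y) \<omega> *\<^sub>R norm (F \<omega>)", OF integrable_indicator_E[OF F']]
    by (simp add: mass_def[abs_def])
  finally show ?thesis .
qed

lemma additive_mass: "integrable \<nu> F \<Longrightarrow> additive (mass F)"
  using additive_integral[of F] by (simp add: mass_def[abs_def])

subsection \<open>Spherical functions\<close>

text \<open>The value at distance \<open>n\<close> from the root of the spherical function with base \<open>R\<close>, that is, of the
  Poisson transform of \<open>\<nu>\<close>.\<close>

definition sph :: "real \<Rightarrow> nat \<Rightarrow> real" where
  "sph R n = (1 + (1 - 1 / R ^ 2) * (real q / (real q + 1)) * (\<Sum>j=1..n. (R ^ 2 / real q) ^ j)) / R ^ n"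

lemma weight_level: "0 < lev x \<Longrightarrow> weight x = real q / (real q + 1) / real q ^ lev x"
proof -
  assume "0 < lev x"
  then obtain n where "lev x = Suc n" "x \<noteq> v0" by (metis gr0_implies_Suc lev_v0 less_irrefl)
  then show ?thesis using q_ge_2 by (simp add: weight_explicit)
qed

lemma weight_v0 [simp]: "weight v0 = 1"
  by (simp add: weight_explicit)

lemma tree_poisson_weight: "tree_poisson R weight x = sph R (lev x)"
proof -
  have "R ^ (2 * j) * weight (anc j x) = real q / (real q + 1) * (R ^ 2 / real q) ^ j" if "j \<in> {1..lev x}" for j
    using that by (simp add: weight_level lev_anc power_divide power_mult)
  then have "(\<Sum>j=1..lev x. R ^ (2 * j) * weight (anc j x)) = (\<Sum>j=1..lev x. real q / (real q + 1) * (R ^ 2 / real q) ^ j)"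
    by (rule sum.cong[OF refl])
  also have "\<dots> = real q / (real q + 1) * (\<Sum>j=1..lev x. (R ^ 2 / real q) ^ j)"
    by (rule sum_distrib_left[symmetric])
  finally show ?thesis unfolding tree_poisson_def sph_def by (simp only: weight_v0 mult.assoc)
qed

lemma sph_0 [simp]: "sph R 0 = 1"
  by (simp add: sph_def)

lemma sph_Suc: "R \<noteq> 0 \<Longrightarrow>
  sph R (Suc n) = sph R n / R + (1 - 1 / R ^ 2) * (real q / (real q + 1)) * (R / real q) ^ Suc n"
proof -
  assume R: "R \<noteq> 0"
  have "R ^ 2 / real q / R = R / real q" using R by (simp add: power2_eq_square)
  then have "(R ^ 2 / real q) ^ Suc n / R ^ Suc n = (R / real q) ^ Suc n"
    by (simp only: power_divide[symmetric])
  moreover define K where "K = (1 - 1 / R ^ 2) * (real q / (real q + 1))"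
  moreover define A where "A = (\<Sum>j=1..n. (R ^ 2 / real q) ^ j)"
  have "sph R (Suc n) = (1 + K * A) / R ^ Suc n + K * ((R ^ 2 / real q) ^ Suc n / R ^ Suc n)"
    by (simp add: sph_def K_def A_def distrib_left add_divide_distrib)
  moreover have "sph R n / R = (1 + K * A) / R ^ Suc n"
    by (simp add: sph_def K_def A_def mult.commute)
  ultimately show ?thesis by simp
qed

lemma sph_Suc_Suc:
  assumes R: "R \<noteq> 0"
  shows "sph R (Suc (Suc n)) = (1 / R + R / real q) * sph R (Suc n) - sph R n / real q"
proof -
  have "sph R (Suc (Suc n)) = sph R (Suc n) / R + R / real q * (sph R (Suc n) - sph R n / R)"
    using sph_Suc[OF R, of "Suc n"] sph_Suc[OF R, of n] by simp
  then show ?thesis using R by (simp add: algebra_simps)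
qed

text \<open>Both sides satisfy the same second order recursion with the same initial values.\<close>

lemma sph_symmetric:
  assumes R: "R \<noteq> 0"
  shows "sph (real q / R) n = sph R n"
proof -
  have q: "real q \<noteq> 0" "real q + 1 \<noteq> 0" using q_ge_2 by auto
  have one: "sph T 1 = (real q / T + T) / (real q + 1)" if "T \<noteq> 0" for T
  proof -
    have "(1 - 1 / T ^ 2) * T = T - 1 / T" using that by (simp add: left_diff_distrib power2_eq_square)
    moreover have "(1 - 1 / T ^ 2) * (real q / (real q + 1)) * (T / real q) = ((1 - 1 / T ^ 2) * T) / (real q + 1)"
      using q by simp
    ultimately have "(1 - 1 / T ^ 2) * (real q / (real q + 1)) * (T / real q) = (T - 1 / T) / (real q + 1)"
      by (simp only:)
    then have "sph T 1 = 1 / T + (T - 1 / T) / (real q + 1)"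
      using sph_Suc[OF that, of 0] by simp
    also have "\<dots> = ((real q + 1) * (1 / T) + (T - 1 / T)) / (real q + 1)"
      by (subst add_divide_distrib) (use q in simp)
    also have "(real q + 1) * (1 / T) + (T - 1 / T) = real q / T + T"
      by (simp add: algebra_simps add_divide_distrib)
    finally show ?thesis .
  qed
  have R': "real q / R \<noteq> 0" using R q by simp
  have "sph (real q / R) n = sph R n \<and> sph (real q / R) (Suc n) = sph R (Suc n)"
  proof (induction n)
    case 0
    show ?case using one[OF R] one[OF R'] R q by (simp add: add.commute)
  next
    case (Suc n)
    then show ?case using sph_Suc_Suc[OF R, of n] sph_Suc_Suc[OF R', of n] R q by (simp add: add.commute)
  qed
  then show ?thesis by simp
qed

lemma sph_pos: "1 \<le> R \<Longrightarrow> 0 < sph R n"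
  unfolding sph_def
  by (intro divide_pos_pos add_pos_nonneg mult_nonneg_nonneg sum_nonneg) (auto simp: divide_simps)

text \<open>The exponent of the kernel is \<open>1 - 1/p\<close> here and \<open>1/p\<close> in the transforms to be estimated; the symmetry
  identifies the two spherical functions.\<close>

lemma Re_spherical_fun:
  assumes "1 \<le> p"
  shows "Re (spherical_fun adj q v0 (\<i> * delta p) x) = sph (real q powr (1 / p)) (lev x)"
proof -
  have s: "1 / 2 + \<i> * (\<i> * complex_of_real (delta p)) = complex_of_real (1 - 1 / p)"
    by (simp add: delta_def field_simps)
  have Q: "(of_nat q :: complex) powr of_real (1 - 1 / p) = of_real (real q powr (1 - 1 / p))"
    using powr_of_real[of "real q" "1 - 1 / p"] by simp
  have "mass (\<lambda>_. 1 :: complex) = (\<lambda>y. of_real (weight y))"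
    using LINT_indicator_E(2)[of \<nu>] \<nu>.finite_measure_axioms
    by (simp add: mass_def[abs_def] scaleR_conv_of_real measure_\<nu>_E)
  then have "spherical_fun adj q v0 (\<i> * delta p) x
      = tree_poisson (of_real (real q powr (1 - 1 / p))) (\<lambda>y. complex_of_real (weight y)) x"
    using poisson_transform_eq[of "\<lambda>_. 1" "\<i> * delta p"] unfolding spherical_fun_def s Q by simp
  also have "\<dots> = of_real (tree_poisson (real q powr (1 - 1 / p)) weight x)"
    by (simp add: tree_poisson_def)
  finally have "Re (spherical_fun adj q v0 (\<i> * delta p) x) = sph (real q powr (1 - 1 / p)) (lev x)"
    by (simp add: tree_poisson_weight)
  also have "real q powr (1 - 1 / p) = real q / real q powr (1 / p)"
    using q_ge_2 by (simp add: powr_diff)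
  also have "sph \<dots> (lev x) = sph (real q powr (1 / p)) (lev x)"
    using q_ge_2 by (intro sph_symmetric) simp
  finally show ?thesis .
qed

lemma Re_spherical_fun_radial:
  assumes "1 \<le> p"
  shows "Re (spherical_fun_radial adj q v0 (\<i> * delta p) n) = sph (real q powr (1 / p)) n"
proof -
  have "(SOME x. x \<in> S n) \<in> S n" using S_nonempty by (simp add: some_in_eq)
  then show ?thesis using Re_spherical_fun[OF assms] by (simp add: spherical_fun_radial_def S_iff)
qed

subsection \<open>The eigenvalue equation\<close>

lemma laplacian_eigen_iff:
  "laplacian adj q u x = gamma_eigenvalue q z * u x \<longleftrightarrow>
    (\<Sum>y | adj x y. u y) = (of_nat q powr (1 / 2 + \<i> * z) + of_nat q / of_nat q powr (1 / 2 + \<i> * z)) * u x"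
proof -
  let ?Q = "of_nat q powr (1 / 2 + \<i> * z) :: complex"
  have "(of_nat q :: complex) powr (1 / 2 - \<i> * z) = of_nat q powr (1 - (1 / 2 + \<i> * z))"
    by (simp add: algebra_simps)
  also have "\<dots> = of_nat q / ?Q" using q_ge_2 by (subst powr_diff) simp
  finally have e: "(of_nat q :: complex) powr (1 / 2 - \<i> * z) = of_nat q / ?Q" .
  have q1: "(of_nat q + 1 :: complex) \<noteq> 0"
    by (metis of_nat_1 of_nat_add of_nat_eq_0_iff add_is_0 one_neq_zero)
  let ?s = "\<Sum>y | adj x y. u y" and ?l = "?Q + of_nat q / ?Q"
  have "laplacian adj q u x = gamma_eigenvalue q z * u x \<longleftrightarrow>
      u x - 1 / (of_nat q + 1) * ?s = (1 - ?l / (of_nat q + 1)) * u x"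
    unfolding laplacian_def gamma_eigenvalue_def e graph_dist_eq_1_iff ..
  also have "\<dots> \<longleftrightarrow> ?s = ?l * u x"
    using q1 by (simp add: left_diff_distrib)
  finally show ?thesis .
qed

end

section \<open>Power means over spheres\<close>

lemma powr_le_powr_iff:
  fixes s t r :: real
  assumes "0 < r" "0 \<le> s" "0 \<le> t"
  shows "s powr r \<le> t powr r \<longleftrightarrow> s \<le> t"
  using assms powr_mono2[of r s t] powr_less_mono2[of r t s] by (meson less_imp_le not_less)

text \<open>The graph of \<open>t \<mapsto> t\<^sup>r\<close> lies above its tangents, also at the boundary point \<open>0\<close>. Jensen's inequality for sums
  and for integrals follows by averaging, with the tangent taken at the mean.\<close>

lemma powr_tangent:
  fixes s t r :: real
  assumes "1 \<le> r" "0 \<le> s" "0 \<le> t"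
  shows "s powr r + r * s powr (r - 1) * (t - s) \<le> t powr r"
proof (cases "s = 0 \<or> t = 0")
  case True
  then show ?thesis
  proof
    assume t: "t = 0"
    have "s powr (r - 1) * s = s powr r" using assms by (cases "s = 0") (simp_all add: powr_diff)
    moreover have "s powr r \<le> r * s powr r" using assms by (simp add: mult_le_cancel_right1)
    ultimately show ?thesis using t assms by (simp add: mult.assoc)
  qed simp
next
  case False
  then have "t powr r - s powr r \<ge> r * s powr (r - 1) * (t - s)"
    using assms by (intro convex_on_imp_above_tangent[OF powr_convex])
      (auto simp: interior_open intro: has_real_derivative_powr[THEN DERIV_subset])
  then show ?thesis by simp
qed

lemma powr_jensen_sum:
  fixes f w :: "'a \<Rightarrow> real"
  assumes "1 \<le> r" and w: "\<And>i. i \<in> I \<Longrightarrow> 0 \<le> w i" "sum w I = 1" and f: "\<And>i. i \<in> I \<Longrightarrow> 0 \<le> f i"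
  shows "(\<Sum>i\<in>I. w i * f i) powr r \<le> (\<Sum>i\<in>I. w i * f i powr r)"
proof -
  define a where "a = (\<Sum>i\<in>I. w i * f i)"
  have a: "0 \<le> a" unfolding a_def by (intro sum_nonneg mult_nonneg_nonneg w f)
  have "(\<Sum>i\<in>I. w i * (a powr r + r * a powr (r - 1) * (f i - a))) \<le> (\<Sum>i\<in>I. w i * f i powr r)"
    using powr_tangent[OF assms(1) a f] w by (intro sum_mono mult_left_mono) auto
  also have "(\<Sum>i\<in>I. w i * (a powr r + r * a powr (r - 1) * (f i - a)))
      = sum w I * a powr r + r * a powr (r - 1) * ((\<Sum>i\<in>I. w i * f i) - sum w I * a)"
    by (simp add: algebra_simps sum.distrib sum_subtractf sum_distrib_left sum_distrib_right)
  also have "\<dots> = a powr r" using w by (simp add: a_def)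
  finally show ?thesis by (simp add: a_def)
qed

context rooted_homogeneous_tree
begin

text \<open>This is the mean of \<open>f\<^sup>r\<close>, without the final root of order \<open>r\<close>; norm bounds therefore take the form
  \<open>pmean r n f \<le> B powr r\<close>.\<close>

definition pmean :: "real \<Rightarrow> nat \<Rightarrow> ('v \<Rightarrow> real) \<Rightarrow> real" where
  "pmean r n f = (\<Sum>x\<in>S n. weight x * f x powr r)"

text \<open>The conditional expectation from one generation to the previous one. Fixed points of \<open>avg\<close> are
  martingales.\<close>

definition avg :: "('v \<Rightarrow> 'b :: real_normed_field) \<Rightarrow> 'v \<Rightarrow> 'b" where
  "avg f x = sum f (children x) / of_nat (card (children x))"

lemma pmean_mono: "0 \<le> r \<Longrightarrow> (\<And>x. x \<in> S n \<Longrightarrow> 0 \<le> f x \<and> f x \<le> g x) \<Longrightarrow> pmean r n f \<le> pmean r n g"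
  unfolding pmean_def using weight_pos by (intro sum_mono mult_left_mono powr_mono2) (auto intro: less_imp_le)

lemma pmean_cmult: "pmean r n (\<lambda>x. c * f x) = c powr r * pmean r n f"
  by (simp add: pmean_def powr_mult sum_distrib_left mult_ac)

lemma pmean_nonneg: "0 \<le> pmean r n f"
  unfolding pmean_def using weight_pos by (intro sum_nonneg mult_nonneg_nonneg) (auto intro: less_imp_le)

lemma sum_weight_S: "sum weight (S n) = 1"
proof -
  have "sum weight (S n) = (\<Sum>x\<in>S n. 1 / real (card (S n)))" by (intro sum.cong refl weight_S)
  then show ?thesis using S_nonempty[of n] by simp
qed

lemma pmean_const: "0 \<le> c \<Longrightarrow> pmean r n (\<lambda>_. c) = c powr r"
  using sum_weight_S[of n] by (simp add: pmean_def sum_distrib_right[symmetric])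

lemma pmean_0: "pmean r 0 f = f v0 powr r"
  by (simp add: pmean_def)

lemma pmean_eq_average: "pmean r n f = (\<Sum>x\<in>S n. f x powr r) / real (card (S n))"
proof -
  have "pmean r n f = (\<Sum>x\<in>S n. 1 / real (card (S n)) * f x powr r)"
    unfolding pmean_def by (intro sum.cong refl) (simp add: weight_S)
  then show ?thesis by (simp add: sum_divide_distrib)
qed

text \<open>If \<open>A\<close> and \<open>B\<close> are positive, \<open>(f + g) / (A + B)\<close> is a convex combination of \<open>f / A\<close> and \<open>g / B\<close>.\<close>

lemma pmean_minkowski:
  assumes r: "1 \<le> r" and f: "\<And>x. 0 \<le> f x" and g: "\<And>x. 0 \<le> g x" and A: "0 \<le> A" and B: "0 \<le> B"
    and fA: "pmean r n f \<le> A powr r" and gB: "pmean r n g \<le> B powr r"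
  shows "pmean r n (\<lambda>x. f x + g x) \<le> (A + B) powr r"
proof -
  have zero: "h x = 0" if "pmean r n h \<le> 0 powr r" "x \<in> S n" for h :: "'v \<Rightarrow> real" and x
  proof -
    have "(\<Sum>x\<in>S n. weight x * h x powr r) = 0"
      using that pmean_nonneg[of r n h] r by (simp add: pmean_def)
    then have "weight x * h x powr r = 0"
      using that less_imp_le[OF weight_pos] by (subst (asm) sum_nonneg_eq_0_iff) auto
    then show ?thesis using weight_pos[of x] by simp
  qed
  consider "A = 0" | "B = 0" | "0 < A" "0 < B" using A B by linarith
  then show ?thesis
  proof cases
    case 1
    then have "pmean r n (\<lambda>x. f x + g x) = pmean r n g"
      unfolding pmean_def using zero[of f] fA by (intro sum.cong) auto
    then show ?thesis using 1 gB by simp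
  next
    case 2
    then have "pmean r n (\<lambda>x. f x + g x) = pmean r n f"
      unfolding pmean_def using zero[of g] gB by (intro sum.cong) auto
    then show ?thesis using 2 fA by simp
  next
    case 3
    define a b where "a = A / (A + B)" and "b = B / (A + B)"
    have ab: "0 \<le> a" "0 \<le> b" "a + b = 1" using 3 by (auto simp: a_def b_def add_divide_distrib[symmetric])
    have "weight x * (f x + g x) powr r
        \<le> (A + B) powr r * (a / A powr r * (weight x * f x powr r) + b / B powr r * (weight x * g x powr r))" for x
    proof -
      have "f x + g x = (A + B) * (a * (f x / A) + b * (g x / B))"
        using 3 by (simp add: a_def b_def distrib_left)
      moreover have "(a * (f x / A) + b * (g x / B)) powr r \<le> a * (f x / A) powr r + b * (g x / B) powr r"
        using powr_jensen_sum[OF r, of "{True, False}" "\<lambda>i. if i then a else b" "\<lambda>i. if i then f x / A else g x / B"]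
          ab f[of x] g[of x] 3 by simp
      ultimately have "(f x + g x) powr r \<le> (A + B) powr r * (a * (f x / A) powr r + b * (g x / B) powr r)"
        using 3 by (simp add: powr_mult mult_left_mono)
      then have "weight x * (f x + g x) powr r
          \<le> weight x * ((A + B) powr r * (a * (f x / A) powr r + b * (g x / B) powr r))"
        using weight_pos[of x] by (intro mult_left_mono) auto
      then show ?thesis using 3 f[of x] g[of x] by (simp add: powr_divide algebra_simps)
    qed
    then have "pmean r n (\<lambda>x. f x + g x)
        \<le> (A + B) powr r * (a / A powr r * pmean r n f + b / B powr r * pmean r n g)"
      unfolding pmean_def sum_distrib_left sum.distrib[symmetric] by (rule sum_mono)
    also have "\<dots> \<le> (A + B) powr r * (a / A powr r * A powr r + b / B powr r * B powr r)"
      using ab fA gB by (intro mult_left_mono add_mono) auto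
    also have "\<dots> = (A + B) powr r" using 3 ab by simp
    finally show ?thesis .
  qed
qed

lemma sum_weight_avg: "(\<Sum>x\<in>S n. weight x * avg f x) = (\<Sum>y\<in>S (Suc n). weight y * f y)"
proof -
  have "weight x * avg f x = (\<Sum>y\<in>children x. weight y * f y)" for x
  proof -
    have "weight y = weight x / real (card (children x))" if "y \<in> children x" for y
      using weight_child[OF that] children_nonempty[of x] by (simp add: field_simps)
    then have "(\<Sum>y\<in>children x. weight y * f y) = (\<Sum>y\<in>children x. weight x / real (card (children x)) * f y)"
      by (intro sum.cong) auto
    then show ?thesis by (simp add: avg_def sum_distrib_left sum_divide_distrib)
  qed
  then show ?thesis by (simp add: sum_S_Suc)
qed

lemma avg_const: "avg (\<lambda>_. c) x = c"
  using children_nonempty[of x] by (simp add: avg_def)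

lemma avg_parent: "avg (\<lambda>y. f (par y)) x = f x"
proof -
  have "avg (\<lambda>y. f (par y)) x = avg (\<lambda>_. f x) x"
    unfolding avg_def by (intro arg_cong2[where f = "(/)"] sum.cong) (auto simp: children_def)
  then show ?thesis by (simp add: avg_const)
qed

lemma sum_weight_anc:
  assumes "j \<le> n"
  shows "(\<Sum>x\<in>S n. weight x * f (anc j x)) = (\<Sum>y\<in>S j. weight y * f y)"
  using assms
proof (induction n rule: dec_induct)
  case base
  show ?case by (intro sum.cong) (auto simp: S_iff)
next
  case (step n)
  have "(\<Sum>x\<in>S (Suc n). weight x * f (anc j x)) = (\<Sum>x\<in>S n. weight x * avg (\<lambda>y. f (anc j y)) x)"
    by (rule sum_weight_avg[symmetric])
  also have "\<dots> = (\<Sum>x\<in>S n. weight x * f (anc j x))"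
  proof (intro sum.cong refl)
    fix x assume x: "x \<in> S n"
    have "avg (\<lambda>y. f (anc j y)) x = avg (\<lambda>y. f (anc j (par y))) x"
      unfolding avg_def using x step.hyps
      by (intro arg_cong2[where f = "(/)"] sum.cong refl) (auto simp: anc_par S_iff lev_child)
    then show "weight x * avg (\<lambda>y. f (anc j y)) x = weight x * f (anc j x)"
      using avg_parent[of "\<lambda>y. f (anc j y)" x] by simp
  qed
  finally show ?case using step.IH by simp
qed

text \<open>Every vertex of the sphere of radius \<open>j\<close> has the same number of descendants on that of radius \<open>n\<close>.\<close>

lemma pmean_anc: "j \<le> n \<Longrightarrow> pmean r n (\<lambda>x. f (anc j x)) = pmean r j f"
  unfolding pmean_def by (rule sum_weight_anc)

lemma avg_nonneg: "(\<And>x. 0 \<le> f x) \<Longrightarrow> 0 \<le> avg f x" for f :: "'v \<Rightarrow> real"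
  by (simp add: avg_def sum_nonneg)

lemma avg_mono: "(\<And>x. f x \<le> g x) \<Longrightarrow> avg f x \<le> avg g x" for f g :: "'v \<Rightarrow> real"
  unfolding avg_def by (intro divide_right_mono sum_mono) auto

lemma norm_avg_le: "norm (avg f x) \<le> avg (\<lambda>y. norm (f y)) x"
  by (simp add: avg_def norm_divide divide_right_mono norm_sum)

lemma avg_add: "avg (\<lambda>y. f y + g y) x = avg f x + avg g x"
  and avg_cmult: "avg (\<lambda>y. c * f y) x = c * avg f x"
  by (simp_all add: avg_def sum.distrib add_divide_distrib sum_distrib_left)

lemma pmean_avg_le:
  assumes r: "1 \<le> r" and f: "\<And>x. 0 \<le> f x"
  shows "pmean r n (avg f) \<le> pmean r (Suc n) f"
proof -
  have "avg f x powr r \<le> avg (\<lambda>y. f y powr r) x" for x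
    using powr_jensen_sum[OF r, of "children x" "\<lambda>_. 1 / real (card (children x))" f] f children_nonempty[of x]
    by (simp add: avg_def sum_divide_distrib)
  then have "pmean r n (avg f) \<le> (\<Sum>x\<in>S n. weight x * avg (\<lambda>y. f y powr r) x)"
    unfolding pmean_def using weight_pos by (intro sum_mono mult_left_mono) (auto intro: less_imp_le)
  then show ?thesis by (simp add: sum_weight_avg pmean_def)
qed

lemma pmean_avg_funpow_le:
  assumes r: "1 \<le> r" and f: "\<And>x. 0 \<le> f x"
  shows "pmean r n ((avg ^^ k) f) \<le> pmean r (n + k) f"
proof (induction k arbitrary: n)
  case (Suc k)
  have "0 \<le> (avg ^^ k) f x" for x using f by (induction k arbitrary: x) (auto intro: avg_nonneg)
  then have "pmean r n (avg ((avg ^^ k) f)) \<le> pmean r (Suc n) ((avg ^^ k) f)" by (rule pmean_avg_le[OF r])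
  also have "\<dots> \<le> pmean r (Suc n + k) f" by (rule Suc.IH)
  finally show ?case by simp
qed simp

lemma additive_iff_avg:
  "additive (\<lambda>x. of_real (weight x) * g x) \<longleftrightarrow> avg g = g" for g :: "'v \<Rightarrow> 'b :: real_normed_field"
proof -
  have "(\<Sum>y\<in>children x. of_real (weight y) * g y) = of_real (weight x) * avg g x" for x
  proof -
    have "weight y = weight x / real (card (children x))" if "y \<in> children x" for y
      using weight_child[OF that] children_nonempty[of x] by (simp add: field_simps)
    then have "(\<Sum>y\<in>children x. of_real (weight y) * g y)
        = (\<Sum>y\<in>children x. of_real (weight x / real (card (children x))) * g y)"
      by (intro sum.cong) auto
    then show ?thesis by (simp add: avg_def sum_distrib_left sum_divide_distrib)
  qed
  then have "additive (\<lambda>x. of_real (weight x) * g x) \<longleftrightarrow> (\<forall>x. avg g x = g x)"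
    using weight_pos by (simp add: additive_def) (metis less_irrefl)
  then show ?thesis by (simp add: fun_eq_iff)
qed

subsection \<open>The Poisson transform is a contraction\<close>

text \<open>The coefficients of the Poisson transform when it is written in terms of densities instead of masses.
  The spherical function is their sum, because \<open>\<nu>\<close> has density \<open>1\<close>.\<close>

definition coef :: "'b :: real_normed_field \<Rightarrow> nat \<Rightarrow> nat \<Rightarrow> 'b" where
  "coef Q n j = (if j = 0 then 1 else (1 - 1 / Q ^ 2) * of_real (real q / (real q + 1)) * (Q ^ 2 / of_nat q) ^ j) / Q ^ n"

lemma sum_atMost_split: "(\<Sum>j\<le>n. f j) = f 0 + (\<Sum>j=1..n. f j)" for f :: "nat \<Rightarrow> 'b :: comm_monoid_add"
proof -
  have "{..n} = insert 0 {1..n}" by auto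
  then show ?thesis by simp
qed

lemma tree_poisson_density:
  "tree_poisson Q (\<lambda>y. of_real (weight y) * g y) x = (\<Sum>j\<le>lev x. coef Q (lev x) j * g (anc j x))"
proof -
  have "(1 - 1 / Q ^ 2) * (Q ^ (2 * j) * (of_real (weight (anc j x)) * g (anc j x))) / Q ^ lev x
      = coef Q (lev x) j * g (anc j x)" if "j \<in> {1..lev x}" for j
    using that by (simp add: coef_def weight_level lev_anc power_divide power_mult)
  then show ?thesis
    by (simp add: tree_poisson_def sum_atMost_split add_divide_distrib sum_distrib_left sum_divide_distrib coef_def[of _ _ 0])
qed

lemma sum_coef: "(\<Sum>j\<le>n. coef R n j) = sph R n"
  by (simp add: sum_atMost_split sph_def coef_def add_divide_distrib sum_distrib_left sum_divide_distrib)

lemma coef_nonneg: "1 \<le> R \<Longrightarrow> 0 \<le> coef R n j" for R :: real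
proof -
  assume R: "1 \<le> R"
  then have "0 \<le> 1 - 1 / R ^ 2" by (simp add: divide_simps)
  then show ?thesis unfolding coef_def using R by simp
qed

text \<open>Divided by the spherical function, the transform is a weighted mean of the values of \<open>g\<close> along the
  geodesic, to which Jensen's inequality applies; passing to ancestors does not change means.\<close>

lemma pmean_tree_poisson_le:
  assumes r: "1 \<le> r" and R: "1 \<le> R" and g: "\<And>x. 0 \<le> g x"
    and B: "0 \<le> B" "\<And>j. pmean r j g \<le> B powr r"
  shows "pmean r n (tree_poisson R (\<lambda>y. weight y * g y)) \<le> (sph R n * B) powr r"
proof -
  define w where "w j = coef R n j / sph R n" for j
  have s: "0 < sph R n" by (rule sph_pos[OF R])
  have w: "0 \<le> w j" "sum w {..n} = 1" for j
    using s coef_nonneg[OF R, of n] sum_coef[of R n] by (simp_all add: w_def sum_divide_distrib[symmetric])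
  have u: "tree_poisson R (\<lambda>y. weight y * g y) x = sph R n * (\<Sum>j\<le>n. w j * g (anc j x))" if "x \<in> S n" for x
    using that tree_poisson_density[of R g x] s by (simp add: w_def S_iff sum_distrib_left)
  have "pmean r n (tree_poisson R (\<lambda>y. weight y * g y)) = pmean r n (\<lambda>x. sph R n * (\<Sum>j\<le>n. w j * g (anc j x)))"
    unfolding pmean_def using u by (intro sum.cong) auto
  also have "\<dots> = sph R n powr r * pmean r n (\<lambda>x. \<Sum>j\<le>n. w j * g (anc j x))" by (rule pmean_cmult)
  also have "pmean r n (\<lambda>x. \<Sum>j\<le>n. w j * g (anc j x)) \<le> (\<Sum>x\<in>S n. weight x * (\<Sum>j\<le>n. w j * g (anc j x) powr r))"
    unfolding pmean_def using weight_pos w g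
    by (intro sum_mono mult_left_mono powr_jensen_sum[OF r]) (auto intro: less_imp_le)
  also have "(\<Sum>x\<in>S n. weight x * (\<Sum>j\<le>n. w j * g (anc j x) powr r)) = (\<Sum>j\<le>n. w j * pmean r n (\<lambda>x. g (anc j x)))"
    unfolding pmean_def sum_distrib_left by (subst sum.swap) (simp add: mult_ac)
  also have "\<dots> \<le> (\<Sum>j\<le>n. w j * B powr r)"
    using w B by (intro sum_mono mult_left_mono) (simp_all add: pmean_anc)
  also have "\<dots> = B powr r" using w by (simp add: sum_distrib_right[symmetric])
  finally show ?thesis using s B by (simp add: powr_mult mult_left_mono)
qed

subsection \<open>Recovering the density\<close>

text \<open>The constant factor by which a value of the density enters the inversion formula.\<close>

definition gap_const :: "real \<Rightarrow> real" where
  "gap_const R = (1 - 1 / R ^ 2) * (real q / (real q + 1))"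

text \<open>In the first case averaging over ever later generations gives the constant \<open>1\<close>. In the second, the factor \<open>2\<close> stems from
  the two terms of the inversion formula and the quotient of \<open>R\<^sup>2\<close> from summing a geometric series.\<close>

definition density_const :: "real \<Rightarrow> real" where
  "density_const R = (if R ^ 2 = real q then 1
    else 2 / gap_const R * (1 + gap_const R * (R ^ 2 / (R ^ 2 - real q))))"

lemma gap_const:
  assumes "real q \<le> R ^ 2"
  shows "0 < gap_const R" "gap_const R \<le> 1"
proof -
  have "2 \<le> real q" using q_ge_2 by simp
  then have "2 \<le> R ^ 2" using assms by linarith
  then have "0 < 1 - 1 / R ^ 2" "1 - 1 / R ^ 2 \<le> 1" by (auto simp: divide_simps)
  moreover have "0 < real q / (real q + 1)" "real q / (real q + 1) \<le> 1" using q_ge_2 by (auto simp: divide_simps)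
  ultimately show "0 < gap_const R" "gap_const R \<le> 1" unfolding gap_const_def
    by (auto intro: mult_pos_pos mult_le_one simp del: times_divide_eq_right)
qed

lemma density_const_ge_1:
  assumes "real q \<le> R ^ 2"
  shows "1 \<le> density_const R"
proof (cases "R ^ 2 = real q")
  case False
  then have "0 < R ^ 2 - real q" "0 < R ^ 2" using assms by auto
  then have "1 \<le> 1 + gap_const R * (R ^ 2 / (R ^ 2 - real q))"
    using gap_const[OF assms] by simp
  moreover have "1 \<le> 2 / gap_const R" using gap_const[OF assms] by (simp add: divide_simps)
  ultimately have "1 * 1 \<le> 2 / gap_const R * (1 + gap_const R * (R ^ 2 / (R ^ 2 - real q)))"
    using gap_const(1)[OF assms] by (intro mult_mono) auto
  then show ?thesis using False by (simp add: density_const_def)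
qed (simp add: density_const_def)

lemma sph_scaled: "R \<noteq> 0 \<Longrightarrow> R ^ n * sph R n = 1 + gap_const R * (\<Sum>j=1..n. (R ^ 2 / real q) ^ j)"
  by (simp add: sph_def gap_const_def)

text \<open>The geometric series in \<open>R\<^sup>2 / q > 1\<close> is comparable to its last term.\<close>

lemma sph_growth:
  assumes R: "1 \<le> R" and gap: "real q < R ^ 2"
  shows "sph R n \<le> (R / real q) ^ n * (1 + gap_const R * (R ^ 2 / (R ^ 2 - real q)))"
proof -
  define w where "w = R ^ 2 / real q"
  have q: "0 < real q" using q_ge_2 by simp
  have w: "1 < w" using gap q by (simp add: w_def)
  have "(\<Sum>j=1..n. w ^ j) \<le> w ^ n * (w / (w - 1))"
  proof (induction n)
    case 0
    then show ?case using w by simp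
  next
    case (Suc n)
    have "w ^ n * (w / (w - 1)) + w ^ Suc n = w ^ Suc n * (w / (w - 1))"
      using w by (simp add: field_simps)
    then show ?case using Suc by simp
  qed
  also have "w / (w - 1) = R ^ 2 / (R ^ 2 - real q)"
    using q gap by (simp add: w_def field_simps)
  finally have "1 + gap_const R * (\<Sum>j=1..n. w ^ j)
      \<le> w ^ n + gap_const R * (w ^ n * (R ^ 2 / (R ^ 2 - real q)))"
    using w gap_const[of R] gap by (intro add_mono mult_left_mono) auto
  then have "R ^ n * sph R n \<le> w ^ n * (1 + gap_const R * (R ^ 2 / (R ^ 2 - real q)))"
    using R by (simp add: sph_scaled w_def[symmetric] algebra_simps)
  moreover have "w ^ n = R ^ n * (R / real q) ^ n"
    by (simp add: w_def power2_eq_square power_mult_distrib[symmetric])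
  ultimately have "R ^ n * sph R n \<le> R ^ n * ((R / real q) ^ n * (1 + gap_const R * (R ^ 2 / (R ^ 2 - real q))))"
    by (simp add: mult.assoc)
  then show ?thesis using R by simp
qed

text \<open>With \<open>R = \<bar>Q\<bar>\<close> the inversion formula gives
  \<open>gap_const R * (R / q) ^ n * \<bar>g x\<bar> \<le> \<bar>u x\<bar> + \<bar>u (par x)\<bar> / R\<close> for \<open>x\<close> at distance \<open>n > 0\<close> from the root. The
  right-hand side is controlled by the spherical function, which for \<open>R\<^sup>2 > q\<close> is itself of the order of
  \<open>(R / q) ^ n\<close>.\<close>

lemma density_bound_gap:
  fixes Q :: complex and g :: "'v \<Rightarrow> complex"
  assumes gap: "real q < norm Q ^ 2" and R: "1 \<le> norm Q" and r: "1 \<le> r" and B: "0 \<le> B"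
    and u: "u = tree_poisson Q (\<lambda>y. of_real (weight y) * g y)"
    and bound: "\<And>n. pmean r n (\<lambda>x. norm (u x)) \<le> (sph (norm Q) n * B) powr r"
  shows "pmean r n (\<lambda>x. norm (g x)) \<le> (density_const (norm Q) * B) powr r"
proof (cases n)
  case 0
  have "pmean r 0 (\<lambda>x. norm (g x)) \<le> B powr r"
    using bound[of 0] u by (simp add: pmean_0)
  also have "\<dots> \<le> (density_const (norm Q) * B) powr r"
    using r B density_const_ge_1[of "norm Q"] gap by (intro powr_mono2) (auto simp: mult_le_cancel_right1)
  finally show ?thesis using 0 by simp
next
  case (Suc m)
  let ?R = "norm Q" and ?\<kappa> = "gap_const (norm Q)"
  have k: "0 < ?\<kappa>" using gap_const[of ?R] gap by simp
  have Q0: "Q \<noteq> 0" using R by auto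
  have q: "0 < real q" using q_ge_2 by simp
  have s: "0 < sph ?R j" for j by (rule sph_pos[OF R])
  define c where "c = ?\<kappa> * (?R / real q) ^ n"
  have c: "0 < c" using k R q unfolding c_def by (intro mult_pos_pos zero_less_power divide_pos_pos) auto
  \<comment> \<open>the step from the parent of \<open>x\<close> to \<open>x\<close> isolates the value of the density at \<open>x\<close>\<close>
  have step: "c * norm (g x) \<le> norm (u x) + norm (u (anc m x)) / ?R" if "x \<in> S n" for x
  proof -
    have x: "lev x = n" "x \<noteq> v0" using that Suc by (auto simp: S_iff)
    have "anc m x = par x" using par_anc[of m x] x Suc by simp
    then have "(1 - 1 / Q ^ 2) * Q ^ n * (of_real (weight x) * g x) = u x - u (anc m x) / Q"
      using tree_poisson_step[OF Q0 x(2), of "\<lambda>y. of_real (weight y) * g y"] u x by simp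
    then have "norm (1 - 1 / Q ^ 2) * ?R ^ n * (weight x * norm (g x)) = norm (u x - u (anc m x) / Q)"
      using weight_pos[of x] by (metis abs_of_pos norm_mult norm_of_real norm_power)
    also have "\<dots> \<le> norm (u x) + norm (u (anc m x)) / ?R"
      using norm_triangle_ineq4[of "u x" "u (anc m x) / Q"] by (simp add: norm_divide)
    finally have "norm (1 - 1 / Q ^ 2) * ?R ^ n * (weight x * norm (g x)) \<le> norm (u x) + norm (u (anc m x)) / ?R" .
    moreover have "1 - 1 / ?R ^ 2 \<le> norm (1 - 1 / Q ^ 2)"
      using norm_triangle_ineq2[of 1 "1 / Q ^ 2"] by (simp add: norm_divide norm_power)
    then have "(1 - 1 / ?R ^ 2) * (?R ^ n * (weight x * norm (g x)))
        \<le> norm (1 - 1 / Q ^ 2) * (?R ^ n * (weight x * norm (g x)))"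
      using weight_pos[of x] by (intro mult_right_mono) (auto intro!: mult_nonneg_nonneg)
    moreover have "c * norm (g x) = (1 - 1 / ?R ^ 2) * (?R ^ n * (weight x * norm (g x)))"
      using x Suc by (simp add: c_def gap_const_def weight_level power_divide)
    ultimately show ?thesis unfolding mult.assoc by linarith
  qed
  have "pmean r n (\<lambda>x. c * norm (g x)) \<le> pmean r n (\<lambda>x. norm (u x) + 1 / ?R * norm (u (anc m x)))"
    using step r c by (intro pmean_mono) (auto simp: divide_inverse mult.commute)
  also have "\<dots> \<le> (sph ?R n * B + 1 / ?R * (sph ?R m * B)) powr r"
  proof (rule pmean_minkowski[OF r])
    show "pmean r n (\<lambda>x. 1 / ?R * norm (u (anc m x))) \<le> (1 / ?R * (sph ?R m * B)) powr r"
      unfolding pmean_cmult powr_mult[of "1 / ?R"]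
      using bound[of m] Suc pmean_anc[of m n r "\<lambda>x. norm (u x)"] by (intro mult_left_mono) auto
    show "0 \<le> sph ?R n * B" "0 \<le> 1 / ?R * (sph ?R m * B)"
      using less_imp_le[OF s] B by simp_all
  qed (use bound in auto)
  also have "\<dots> \<le> (2 * (sph ?R n * B)) powr r"
  proof (rule powr_mono2)
    have "sph ?R m / ?R \<le> sph ?R n"
    proof -
      have "0 \<le> ?\<kappa> * (?R / real q) ^ Suc m" using k by (intro mult_nonneg_nonneg) auto
      then show ?thesis using sph_Suc[of ?R m, folded gap_const_def] Q0 Suc by simp
    qed
    then have "sph ?R m / ?R * B \<le> sph ?R n * B" using B by (rule mult_right_mono)
    then show "sph ?R n * B + 1 / ?R * (sph ?R m * B) \<le> 2 * (sph ?R n * B)" by (simp add: mult_ac)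
  qed (use r B s[THEN less_imp_le] in auto)
  finally have "c powr r * pmean r n (\<lambda>x. norm (g x)) \<le> (2 * (sph ?R n * B)) powr r"
    unfolding pmean_cmult .
  also have "\<dots> \<le> (c * (density_const ?R * B)) powr r"
  proof (rule powr_mono2)
    have "2 * sph ?R n \<le> c * density_const ?R"
    proof -
      define X where "X = 1 + ?\<kappa> * (?R ^ 2 / (?R ^ 2 - real q))"
      have "density_const ?R = 2 / ?\<kappa> * X" using gap by (simp add: density_const_def X_def)
      then have "c * density_const ?R = 2 * ((?R / real q) ^ n * X)" using k by (simp add: c_def)
      then show ?thesis using sph_growth[OF R gap, of n, folded X_def] by simp
    qed
    then show "2 * (sph ?R n * B) \<le> c * (density_const ?R * B)"
      using mult_right_mono[of "2 * sph ?R n" "c * density_const ?R" B] B by (simp add: mult.assoc)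
  qed (use r B s[THEN less_imp_le] in auto)
  finally show ?thesis using c by (simp add: powr_mult)
qed

text \<open>The function \<open>V x = Q ^ lev x * u x\<close> is \<open>g v0\<close> plus \<open>\<kappa>\<close> times the sum of the martingale over the rest of the
  geodesic. Each averaging over children therefore adds \<open>\<kappa> * g x\<close> to it, and after \<open>k\<close> of them the term
  \<open>\<kappa> * k * g x\<close> dominates, while the bound on \<open>V\<close> in generation \<open>k\<close> below \<open>x\<close> is \<open>\<kappa> * k * B\<close> to leading order.\<close>

lemma density_bound_critical:
  fixes Q :: complex and g :: "'v \<Rightarrow> complex"
  assumes Q: "Q ^ 2 = of_nat q" and r: "1 \<le> r" and B: "0 \<le> B"
    and g: "avg g = g"
    and u: "u = tree_poisson Q (\<lambda>y. of_real (weight y) * g y)"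
    and bound: "\<And>n. pmean r n (\<lambda>x. norm (u x)) \<le> (sph (norm Q) n * B) powr r"
  shows "pmean r m (\<lambda>x. norm (g x)) \<le> B powr r"
proof -
  have q: "0 < real q" "(of_nat q :: complex) \<noteq> 0" using q_ge_2 by auto
  have Q0: "Q \<noteq> 0" using Q q by auto
  have R2: "norm Q ^ 2 = real q" using arg_cong[OF Q, of norm] by (simp add: norm_power)
  define \<kappa> where "\<kappa> = gap_const (norm Q)"
  have k: "0 < \<kappa>" using gap_const[of "norm Q"] R2 by (simp add: \<kappa>_def)
  define V where "V x = Q ^ lev x * u x" for x
  have avgV: "avg V x = V x + of_real \<kappa> * g x" for x
  proof -
    have "V y = V (par y) + of_real \<kappa> * g y" if "y \<in> children x" for y
    proof -
      have y: "y \<noteq> v0" "par y = x" using that by (auto simp: children_def)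
      have "V y = Q ^ Suc (lev x) * (u x / Q + (1 - 1 / Q ^ 2) * Q ^ Suc (lev x) * (of_real (weight y) * g y))"
        using tree_poisson_step[OF Q0 y(1), of "\<lambda>y. of_real (weight y) * g y"] y lev_child[OF that] u by (simp add: V_def)
      also have "\<dots> = V x + (1 - 1 / Q ^ 2) * (Q ^ 2) ^ Suc (lev x) * (of_real (weight y) * g y)"
        using Q0 by (simp add: V_def distrib_left power2_eq_square power_mult_distrib)
      also have "(1 - 1 / Q ^ 2) * (Q ^ 2) ^ Suc (lev x) * (of_real (weight y) * g y) = of_real \<kappa> * g y"
        using q unfolding Q by (simp add: \<kappa>_def gap_const_def R2 weight_level lev_child[OF that])
      finally show ?thesis using y by simp
    qed
    then have "avg V x = avg (\<lambda>y. V (par y) + of_real \<kappa> * g y) x"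
      unfolding avg_def by (intro arg_cong2[where f = "(/)"] sum.cong) auto
    also have "\<dots> = V x + of_real \<kappa> * avg g x" by (simp add: avg_add avg_cmult avg_parent)
    finally show ?thesis using g by simp
  qed
  have avgV_pow: "(avg ^^ k) V x = V x + of_nat k * (of_real \<kappa> * g x)" for k x
  proof (induction k arbitrary: x)
    case (Suc k)
    have "(avg ^^ Suc k) V x = avg (\<lambda>y. V y + (of_nat k * of_real \<kappa>) * g y) x"
      using ext[of "(avg ^^ k) V", OF Suc] by (simp add: mult.assoc)
    also have "\<dots> = V x + of_real \<kappa> * g x + (of_nat k * of_real \<kappa>) * g x"
      using g by (simp add: avg_add avg_cmult avgV)
    finally show ?case by (simp add: algebra_simps)
  qed simp
  have norm_pow: "norm ((avg ^^ k) V x) \<le> (avg ^^ k) (\<lambda>y. norm (V y)) x" for k x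
  proof (induction k arbitrary: x)
    case (Suc k)
    have "norm (avg ((avg ^^ k) V) x) \<le> avg (\<lambda>y. norm ((avg ^^ k) V y)) x" by (rule norm_avg_le)
    also have "\<dots> \<le> avg ((avg ^^ k) (\<lambda>y. norm (V y))) x" using Suc by (rule avg_mono)
    finally show ?case by simp
  qed simp
  have Vn: "pmean r n (\<lambda>x. norm (V x)) \<le> ((1 + \<kappa> * real n) * B) powr r" for n
  proof -
    have "pmean r n (\<lambda>x. norm (V x)) = pmean r n (\<lambda>x. norm Q ^ n * norm (u x))"
      unfolding pmean_def by (intro sum.cong) (auto simp: V_def S_iff norm_mult norm_power)
    also have "\<dots> \<le> (norm Q ^ n) powr r * (sph (norm Q) n * B) powr r"
      unfolding pmean_cmult using bound by (intro mult_left_mono) auto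
    also have "\<dots> = ((norm Q ^ n * sph (norm Q) n) * B) powr r" by (simp add: powr_mult)
    also have "norm Q ^ n * sph (norm Q) n = 1 + \<kappa> * real n"
      using sph_scaled[of "norm Q" n] Q0 R2 q by (simp add: \<kappa>_def)
    finally show ?thesis .
  qed
  have main: "pmean r m (\<lambda>x. norm (g x)) \<le> ((2 + 2 * \<kappa> * real m) / (\<kappa> * real k) * B + B) powr r" if "0 < k" for k
  proof -
    have kk: "0 < \<kappa> * real k" using k that by simp
    have "\<kappa> * real k * norm (g x) \<le> (avg ^^ k) (\<lambda>y. norm (V y)) x + norm (V x)" for x
    proof -
      have "of_nat k * (of_real \<kappa> * g x) = (avg ^^ k) V x - V x" using avgV_pow by simp
      then have "norm (of_nat k * (of_real \<kappa> * g x)) \<le> norm ((avg ^^ k) V x) + norm (V x)"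
        by (metis norm_triangle_ineq4)
      then show ?thesis using norm_pow[of k x] k by (simp add: norm_mult mult_ac)
    qed
    then have "pmean r m (\<lambda>x. \<kappa> * real k * norm (g x)) \<le> pmean r m (\<lambda>x. (avg ^^ k) (\<lambda>y. norm (V y)) x + norm (V x))"
      using r kk by (intro pmean_mono) auto
    also have "\<dots> \<le> ((1 + \<kappa> * real (m + k)) * B + (1 + \<kappa> * real m) * B) powr r"
    proof (rule pmean_minkowski[OF r])
      show "0 \<le> (avg ^^ k) (\<lambda>y. norm (V y)) x" for x
        using order_trans[OF norm_ge_zero norm_pow] .
      show "pmean r m ((avg ^^ k) (\<lambda>y. norm (V y))) \<le> ((1 + \<kappa> * real (m + k)) * B) powr r"
        by (rule order_trans[OF pmean_avg_funpow_le[OF r] Vn]) simp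
    qed (use Vn k B in auto)
    also have "(1 + \<kappa> * real (m + k)) * B + (1 + \<kappa> * real m) * B
        = \<kappa> * real k * ((2 + 2 * \<kappa> * real m) / (\<kappa> * real k) * B + B)"
      using k that by (simp add: field_simps)
    finally have "pmean r m (\<lambda>x. \<kappa> * real k * norm (g x))
      \<le> (\<kappa> * real k * ((2 + 2 * \<kappa> * real m) / (\<kappa> * real k) * B + B)) powr r" .
    moreover have "0 < (\<kappa> * real k) powr r" using k that by simp
    ultimately show ?thesis
      unfolding pmean_cmult powr_mult[of "\<kappa> * real k"] by (simp only: mult_le_cancel_left_pos)
  qed
  have "(\<lambda>k. ((2 + 2 * \<kappa> * real m) / (\<kappa> * real k) * B + B) powr r) \<longlonglongrightarrow> (0 * B + B) powr r"
  proof (intro tendsto_powr' tendsto_add tendsto_mult tendsto_const)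
    have "(\<lambda>k. (2 + 2 * \<kappa> * real m) / \<kappa> * (1 / real k)) \<longlonglongrightarrow> (2 + 2 * \<kappa> * real m) / \<kappa> * 0"
      by (intro tendsto_mult tendsto_const lim_1_over_n)
    then show "(\<lambda>k. (2 + 2 * \<kappa> * real m) / (\<kappa> * real k)) \<longlonglongrightarrow> 0" by simp
    show "0 * B + B \<noteq> 0 \<or> 0 < r \<and> (\<forall>\<^sub>F k in sequentially. 0 \<le> (2 + 2 * \<kappa> * real m) / (\<kappa> * real k) * B + B)"
      using r k B by (intro disjI2 conjI always_eventually allI) auto
  qed
  then have "(\<lambda>k. ((2 + 2 * \<kappa> * real m) / (\<kappa> * real k) * B + B) powr r) \<longlonglongrightarrow> B powr r" by simp
  then show ?thesis by (rule LIMSEQ_le_const) (use main in \<open>auto intro!: exI[of _ 1]\<close>)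
qed

lemma density_bound:
  fixes Q :: complex and g :: "'v \<Rightarrow> complex"
  assumes Q: "real q < norm Q ^ 2 \<or> Q ^ 2 = of_nat q" and R: "1 \<le> norm Q" and r: "1 \<le> r" and B: "0 \<le> B"
    and g: "avg g = g"
    and u: "u = tree_poisson Q (\<lambda>y. of_real (weight y) * g y)"
    and bound: "\<And>n. pmean r n (\<lambda>x. norm (u x)) \<le> (sph (norm Q) n * B) powr r"
  shows "pmean r m (\<lambda>x. norm (g x)) \<le> (density_const (norm Q) * B) powr r"
  using Q
proof
  assume Q2: "Q ^ 2 = of_nat q"
  then have "norm Q ^ 2 = real q" by (metis norm_of_nat norm_power)
  then show ?thesis using density_bound_critical[OF Q2 r B g u bound] by (simp add: density_const_def)
qed (rule density_bound_gap[OF _ R r B u bound])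

end

section \<open>Lebesgue spaces on the boundary\<close>

context rooted_homogeneous_tree
begin

lemma below_v0 [simp]: "below n v0 = S n"
  using E_subset by (auto simp: below_def)

lemma additive_sum_S: "additive M \<Longrightarrow> sum M (S n) = M v0"
  using additive_sum_below[of M v0 n] by simp

lemma mass_v0: "mass F v0 = (LINT \<omega>|\<nu>. F \<omega>)"
  unfolding mass_def by (intro Bochner_Integration.integral_cong) (simp_all add: space_\<nu>)

lemma sum_mass_S: "integrable \<nu> F \<Longrightarrow> sum (mass F) (S n) = (LINT \<omega>|\<nu>. F \<omega>)"
  using additive_sum_S[OF additive_mass] mass_v0 by metis

lemma mass_const: "mass (\<lambda>_. c) x = weight x *\<^sub>R c"
  using E_subset[of x] by (simp add: mass_def measure_\<nu>_E Int_absorb2 space_\<nu> E_sets less_top[symmetric])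

lemma mass_add: "integrable \<nu> F \<Longrightarrow> integrable \<nu> G \<Longrightarrow> mass (\<lambda>\<omega>. F \<omega> + G \<omega>) x = mass F x + mass G x"
  and mass_diff: "integrable \<nu> F \<Longrightarrow> integrable \<nu> G \<Longrightarrow> mass (\<lambda>\<omega>. F \<omega> - G \<omega>) x = mass F x - mass G x"
  using integrable_indicator_E[of F x] integrable_indicator_E[of G x]
  by (simp_all add: mass_def scaleR_add_right scaleR_diff_right)

lemma mass_cmult: "mass (\<lambda>\<omega>. c * F \<omega>) x = c * mass F x" for F :: "_ \<Rightarrow> real"
  by (simp add: mass_def mult.left_commute)

lemma mass_mono:
  fixes F G :: "_ \<Rightarrow> real"
  assumes "integrable \<nu> F" "integrable \<nu> G" "\<And>\<omega>. F \<omega> \<le> G \<omega>"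
  shows "mass F x \<le> mass G x"
  unfolding mass_def using assms integrable_indicator_E[of F x] integrable_indicator_E[of G x]
  by (intro integral_mono) (auto intro: mult_left_mono)

lemma norm_mass_le:
  fixes F :: "_ \<Rightarrow> 'b :: {banach, second_countable_topology}"
  shows "norm (mass F x) \<le> mass (\<lambda>\<omega>. norm (F \<omega>)) x"
proof -
  have "norm (mass F x) \<le> (LINT \<omega>|\<nu>. norm (indicator (E x) \<omega> *\<^sub>R F \<omega>))"
    unfolding mass_def by (rule integral_norm_bound)
  then show ?thesis by (simp add: mass_def)
qed

lemma mass_norm_nonneg: "0 \<le> mass (\<lambda>\<omega>. norm (F \<omega>)) x"
  unfolding mass_def by (intro Bochner_Integration.integral_nonneg) auto

text \<open>Jensen's inequality on each of the sets \<open>E x\<close>, where the tangent to \<open>t \<mapsto> t\<^sup>r\<close> is taken at the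
  mean value.\<close>

lemma pmean_mass_le:
  fixes F :: "_ \<Rightarrow> complex"
  assumes F: "integrable \<nu> F" and r: "1 \<le> r" and Fr: "integrable \<nu> (\<lambda>\<omega>. norm (F \<omega>) powr r)"
  shows "pmean r n (\<lambda>x. mass (\<lambda>\<omega>. norm (F \<omega>)) x / weight x) \<le> (LINT \<omega>|\<nu>. norm (F \<omega>) powr r)"
proof -
  have "weight x * (mass (\<lambda>\<omega>. norm (F \<omega>)) x / weight x) powr r \<le> mass (\<lambda>\<omega>. norm (F \<omega>) powr r) x" for x
  proof -
    define s where "s = mass (\<lambda>\<omega>. norm (F \<omega>)) x / weight x"
    define b where "b = r * s powr (r - 1)"
    have s: "0 \<le> s" using mass_norm_nonneg[of F x] weight_pos[of x] by (simp add: s_def)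
    have m: "mass (\<lambda>\<omega>. norm (F \<omega>)) x = s * weight x" using weight_pos[of x] by (simp add: s_def)
    have i: "integrable \<nu> (\<lambda>\<omega>. norm (F \<omega>))" using F by simp
    have "mass (\<lambda>\<omega>. (s powr r - b * s) + b * norm (F \<omega>)) x = weight x * (s powr r - b * s) + b * (s * weight x)"
      using i m by (simp add: mass_add mass_const mass_cmult)
    then have "weight x * s powr r = mass (\<lambda>\<omega>. (s powr r - b * s) + b * norm (F \<omega>)) x"
      by (simp add: algebra_simps)
    also have "\<dots> \<le> mass (\<lambda>\<omega>. norm (F \<omega>) powr r) x"
    proof (rule mass_mono)
      show "s powr r - b * s + b * norm (F \<omega>) \<le> norm (F \<omega>) powr r" for \<omega>
        using powr_tangent[OF r s, of "norm (F \<omega>)"] by (simp add: b_def algebra_simps)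
    qed (use i Fr in auto)
    finally show ?thesis by (simp add: s_def)
  qed
  then have "pmean r n (\<lambda>x. mass (\<lambda>\<omega>. norm (F \<omega>)) x / weight x) \<le> (\<Sum>x\<in>S n. mass (\<lambda>\<omega>. norm (F \<omega>) powr r) x)"
    unfolding pmean_def by (rule sum_mono)
  then show ?thesis using sum_mass_S[OF Fr] by simp
qed

lemma level_function:
  assumes w: "\<omega> \<in> \<Omega>"
  shows "(\<Sum>x\<in>S n. indicator (E x) \<omega> *\<^sub>R f x) = (f (\<omega> n) :: 'b :: real_vector)"
proof -
  have "indicator (E x) \<omega> *\<^sub>R f x = (if x = \<omega> n then f x else 0)" if "x \<in> S n" for x
    using that w by (auto simp: rays_through_eq S_iff)
  then have "(\<Sum>x\<in>S n. indicator (E x) \<omega> *\<^sub>R f x) = (\<Sum>x\<in>S n. if x = \<omega> n then f x else 0)"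
    by (intro sum.cong) auto
  then show ?thesis using ray_in_S[OF w, of n] by simp
qed

lemma integral_level_function:
  fixes f :: "'v \<Rightarrow> 'b :: {banach, second_countable_topology}"
  shows "integrable \<nu> (\<lambda>\<omega>. f (\<omega> n))" "(LINT \<omega>|\<nu>. f (\<omega> n)) = (\<Sum>x\<in>S n. weight x *\<^sub>R f x)"
proof -
  have "integrable \<nu> (\<lambda>\<omega>. f (\<omega> n)) \<longleftrightarrow> integrable \<nu> (\<lambda>\<omega>. \<Sum>x\<in>S n. indicator (E x) \<omega> *\<^sub>R f x)"
    by (rule Bochner_Integration.integrable_cong) (simp_all add: space_\<nu> level_function del: sum_indicator_scaleR)
  moreover have i: "integrable \<nu> (\<lambda>\<omega>. indicator (E x) \<omega> *\<^sub>R f x)" for x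
    by (rule integrable_indicator_E) simp
  ultimately show "integrable \<nu> (\<lambda>\<omega>. f (\<omega> n))" by (simp del: sum_indicator_scaleR)
  have "(LINT \<omega>|\<nu>. f (\<omega> n)) = (LINT \<omega>|\<nu>. (\<Sum>x\<in>S n. indicator (E x) \<omega> *\<^sub>R f x))"
    by (rule Bochner_Integration.integral_cong) (simp_all add: space_\<nu> level_function del: sum_indicator_scaleR)
  also have "\<dots> = (\<Sum>x\<in>S n. mass (\<lambda>_. f x) x)"
    unfolding mass_def using i by (rule Bochner_Integration.integral_sum)
  finally show "(LINT \<omega>|\<nu>. f (\<omega> n)) = (\<Sum>x\<in>S n. weight x *\<^sub>R f x)" by (simp add: mass_const)
qed

subsection \<open>Approximation by functions of finitely many coordinates\<close>

definition cylinder :: "nat \<Rightarrow> (nat \<Rightarrow> 'v) set \<Rightarrow> bool" where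
  "cylinder n C \<longleftrightarrow> (\<exists>T. C = {\<omega> \<in> \<Omega>. \<omega> n \<in> T})"

lemma cylinder_lift: "cylinder m C \<Longrightarrow> m \<le> n \<Longrightarrow> cylinder n C"
  unfolding cylinder_def by (elim exE, rule_tac x = "{x. anc m x \<in> T}" in exI) (auto simp: anc_ray)

lemma cylinder_compl: "cylinder n C \<Longrightarrow> cylinder n (\<Omega> - C)"
  unfolding cylinder_def by (elim exE, rule_tac x = "- T" in exI) auto

lemma cylinder_union: "cylinder n C \<Longrightarrow> cylinder n D \<Longrightarrow> cylinder n (C \<union> D)"
  unfolding cylinder_def by (elim exE, rule_tac x = "T \<union> Ta" in exI) auto

lemma cylinder_eq_UN: "cylinder n C \<Longrightarrow> \<exists>T\<subseteq>S n. C = (\<Union>x\<in>T. E x)"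
  unfolding cylinder_def by (elim exE, rule_tac x = "T \<inter> S n" in exI) (auto simp: rays_through_eq S_iff lev_ray)

lemma cylinder_sets: "cylinder n C \<Longrightarrow> C \<in> sets \<nu>"
proof -
  assume "cylinder n C"
  then obtain T where T: "T \<subseteq> S n" "C = (\<Union>x\<in>T. E x)" using cylinder_eq_UN by blast
  then have "finite T" using finite_subset by blast
  then show ?thesis using T E_sets by auto
qed

text \<open>The sets that can be approximated in this way form a \<open>\<sigma>\<close>-algebra. One approximating set has to serve for
  \<open>N\<close> and \<open>\<nu>\<close> at the same time in the proof that certain measures are absolutely continuous.\<close>

lemma cylinder_approx:
  assumes N: "finite_measure N" "sets N = sets \<nu>" and A: "A \<in> sets \<nu>" and e: "0 < e"
  shows "\<exists>n C. cylinder n C \<and> measure N (sym_diff A C) + measure \<nu> (sym_diff A C) < e"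
proof -
  interpret N: finite_measure N by fact
  define m where "m X = measure N X + measure \<nu> X" for X
  have m_mono: "m X \<le> m Y" if "X \<subseteq> Y" "Y \<in> sets \<nu>" for X Y
    unfolding m_def using that N(2) by (intro add_mono N.finite_measure_mono \<nu>.finite_measure_mono) auto
  have m_Un: "m (X \<union> Y) \<le> m X + m Y" if "X \<in> sets \<nu>" "Y \<in> sets \<nu>" for X Y
    using measure_Un_le[of X N Y] measure_Un_le[of X \<nu> Y] that N(2) by (simp add: m_def)
  have m_tail: "(\<lambda>k. m ((\<Union>i. B i) - (\<Union>i<k. B i))) \<longlonglongrightarrow> 0" if B: "\<And>i. B i \<in> sets \<nu>" for B :: "nat \<Rightarrow> _"
  proof -
    have BN: "B i \<in> sets N" for i using B N(2) by simp
    have Inter: "(\<Inter>k. (\<Union>i. B i) - (\<Union>i<k. B i)) = {}" by auto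
    have dec: "decseq (\<lambda>k. (\<Union>i. B i) - (\<Union>i<k. B i))"
      by (auto simp: decseq_def intro: less_le_trans)
    have "(\<lambda>k. measure N ((\<Union>i. B i) - (\<Union>i<k. B i))) \<longlonglongrightarrow> measure N {}"
      unfolding Inter[symmetric] using BN dec by (intro N.finite_Lim_measure_decseq) auto
    moreover have "(\<lambda>k. measure \<nu> ((\<Union>i. B i) - (\<Union>i<k. B i))) \<longlonglongrightarrow> measure \<nu> {}"
      unfolding Inter[symmetric] using B dec by (intro \<nu>.finite_Lim_measure_decseq) auto
    ultimately show ?thesis unfolding m_def using tendsto_add by fastforce
  qed
  have "A \<in> sigma_sets \<Omega> (range E)" using A by (simp add: sets_\<nu>)
  then have "\<exists>n C. cylinder n C \<and> m (sym_diff A C) < e" using e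
  proof (induction A arbitrary: e rule: sigma_sets.induct)
    case (Basic A)
    then obtain x where "A = E x" by auto
    then show ?case using Basic
      by (intro exI[of _ "lev x"] exI[of _ A]) (auto simp: cylinder_def rays_through_eq m_def)
  next
    case Empty
    then show ?case by (intro exI[of _ 0] exI[of _ "{}"]) (auto simp: cylinder_def m_def)
  next
    case (Compl A)
    then obtain n C where C: "cylinder n C" "m (sym_diff A C) < e" by blast
    have "A \<subseteq> \<Omega>" using Compl.hyps sigma_sets_into_sp[of "range E" \<Omega>] E_subset by blast
    moreover have "C \<subseteq> \<Omega>" using C by (auto simp: cylinder_def)
    ultimately have "sym_diff (\<Omega> - A) (\<Omega> - C) = sym_diff A C" by blast
    then show ?case using C cylinder_compl by (intro exI[of _ n] exI[of _ "\<Omega> - C"]) simp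
  next
    case (Union A)
    have A: "A i \<in> sets \<nu>" for i using Union.hyps by (simp add: sets_\<nu>)
    have fin: "\<exists>n C. cylinder n C \<and> m (sym_diff (\<Union>i<k. A i) C) < d" if "0 < d" for k d
      using that
    proof (induction k arbitrary: d)
      case 0
      then show ?case by (intro exI[of _ 0] exI[of _ "{}"]) (auto simp: cylinder_def m_def)
    next
      case (Suc k)
      obtain n C where C: "cylinder n C" "m (sym_diff (\<Union>i<k. A i) C) < d / 2"
        using Suc.IH[of "d / 2"] Suc.prems by auto
      obtain l D where D: "cylinder l D" "m (sym_diff (A k) D) < d / 2"
        using Union.IH[of "d / 2" k] Suc.prems by auto
      have sets: "C \<in> sets \<nu>" "D \<in> sets \<nu>" using C D cylinder_sets by auto
      have "cylinder (max n l) (C \<union> D)"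
        using C D cylinder_lift[of _ _ "max n l"] by (intro cylinder_union) auto
      moreover have "m (sym_diff (\<Union>i<Suc k. A i) (C \<union> D))
          \<le> m (sym_diff (\<Union>i<k. A i) C \<union> sym_diff (A k) D)"
        using A sets by (intro m_mono) (auto simp: lessThan_Suc)
      moreover have "\<dots> \<le> m (sym_diff (\<Union>i<k. A i) C) + m (sym_diff (A k) D)"
        using A sets by (intro m_Un) auto
      ultimately show ?case using C D by (intro exI[of _ "max n l"] exI[of _ "C \<union> D"]) auto
    qed
    obtain k where k: "\<bar>m ((\<Union>i. A i) - (\<Union>i<k. A i))\<bar> < e / 2"
      using LIMSEQ_D[OF m_tail[of A, OF A], of "e / 2"] Union.prems by auto
    obtain n C where C: "cylinder n C" "m (sym_diff (\<Union>i<k. A i) C) < e / 2"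
      using fin[of "e / 2" k] Union.prems by auto
    have C': "C \<in> sets \<nu>" using C cylinder_sets by auto
    have "m (sym_diff (\<Union>i. A i) C)
        \<le> m (((\<Union>i. A i) - (\<Union>i<k. A i)) \<union> sym_diff (\<Union>i<k. A i) C)"
      using A C' by (intro m_mono) auto
    also have "\<dots> \<le> m ((\<Union>i. A i) - (\<Union>i<k. A i)) + m (sym_diff (\<Union>i<k. A i) C)"
      using A C' by (intro m_Un) auto
    finally have "m (sym_diff (\<Union>i. A i) C) < e" using k C by linarith
    then show ?case using C by blast
  qed
  then show ?thesis by (simp add: m_def)
qed

lemma level_function_approx:
  fixes F :: "_ \<Rightarrow> complex"
  assumes F: "integrable \<nu> F" and e: "0 < e"
  shows "\<exists>n h. (LINT \<omega>|\<nu>. norm (F \<omega> - h (\<omega> n))) < e"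
  using F e
proof (induction F arbitrary: e rule: integrable_induct)
  case (base A c)
  obtain n C where C: "cylinder n C" "measure \<nu> (sym_diff A C) < e / (norm c + 1)"
  proof -
    have "0 < e / (norm c + 1)" using base(3) by (simp add: divide_pos_pos add_nonneg_pos)
    then obtain n C where "cylinder n C" "measure \<nu> (sym_diff A C) + measure \<nu> (sym_diff A C) < e / (norm c + 1)"
      using cylinder_approx[OF \<nu>.finite_measure_axioms refl base(1)] by blast
    then have "measure \<nu> (sym_diff A C) < e / (norm c + 1)" using measure_nonneg[of \<nu> "sym_diff A C"] by linarith
    with \<open>cylinder n C\<close> show ?thesis by (rule that)
  qed
  then obtain T where T: "C = {\<omega> \<in> \<Omega>. \<omega> n \<in> T}" by (auto simp: cylinder_def)
  have sets: "C \<in> sets \<nu>" using C cylinder_sets by auto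
  have "(LINT \<omega>|\<nu>. norm (indicator A \<omega> *\<^sub>R c - indicator T (\<omega> n) *\<^sub>R c))
      = (LINT \<omega>|\<nu>. indicator (sym_diff A C) \<omega> * norm c)"
    using T by (intro Bochner_Integration.integral_cong) (auto simp: indicator_def space_\<nu>)
  also have "\<dots> = measure \<nu> (sym_diff A C) * norm c"
    using base(1) sets sets.sets_into_space[of "sym_diff A C" \<nu>]
    by (simp add: Int_absorb2)
  also have "\<dots> \<le> measure \<nu> (sym_diff A C) * (norm c + 1)" by (intro mult_left_mono) auto
  also have "\<dots> < e" using C(2) by (simp add: pos_less_divide_eq add_nonneg_pos)
  finally show ?case by (intro exI[of _ n] exI[of _ "\<lambda>x. indicator T x *\<^sub>R c"])
next
  case (add F G)
  obtain n h where h: "(LINT \<omega>|\<nu>. norm (F \<omega> - h (\<omega> n))) < e / 2" using add.IH(1)[of "e / 2"] add.prems by auto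
  obtain m k where k: "(LINT \<omega>|\<nu>. norm (G \<omega> - k (\<omega> m))) < e / 2" using add.IH(2)[of "e / 2"] add.prems by auto
  let ?l = "\<lambda>x. h (anc n x) + k (anc m x)"
  have i: "integrable \<nu> (\<lambda>\<omega>. norm (F \<omega> - h (\<omega> n)))" "integrable \<nu> (\<lambda>\<omega>. norm (G \<omega> - k (\<omega> m)))"
    using add integral_level_function(1)[of h n] integral_level_function(1)[of k m] by auto
  have "(LINT \<omega>|\<nu>. norm (F \<omega> + G \<omega> - ?l (\<omega> (max n m))))
      \<le> (LINT \<omega>|\<nu>. norm (F \<omega> - h (\<omega> n)) + norm (G \<omega> - k (\<omega> m)))"
  proof (rule integral_mono)
    show "integrable \<nu> (\<lambda>\<omega>. norm (F \<omega> + G \<omega> - ?l (\<omega> (max n m))))"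
      using add integral_level_function(1)[of ?l "max n m"] by auto
    fix \<omega> assume "\<omega> \<in> space \<nu>"
    then have "?l (\<omega> (max n m)) = h (\<omega> n) + k (\<omega> m)" by (simp add: anc_ray space_\<nu>)
    then show "norm (F \<omega> + G \<omega> - ?l (\<omega> (max n m))) \<le> norm (F \<omega> - h (\<omega> n)) + norm (G \<omega> - k (\<omega> m))"
      using norm_triangle_ineq[of "F \<omega> - h (\<omega> n)" "G \<omega> - k (\<omega> m)"] by (simp add: algebra_simps)
  qed (use i in auto)
  also have "\<dots> < e" using h k i by simp
  finally show ?case by (intro exI[of _ "max n m"] exI[of _ ?l])
next
  case (lim F s)
  have "(\<lambda>i. LINT \<omega>|\<nu>. norm (F \<omega> - s i \<omega>)) \<longlonglongrightarrow> (LINT \<omega>|\<nu>. 0)"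
  proof (rule integral_dominated_convergence[where w = "\<lambda>\<omega>. 3 * norm (F \<omega>)"])
    show "AE \<omega> in \<nu>. (\<lambda>i. norm (F \<omega> - s i \<omega>)) \<longlonglongrightarrow> 0"
    proof (rule AE_I2)
      fix \<omega> assume "\<omega> \<in> space \<nu>"
      then have "(\<lambda>i. norm (F \<omega> - s i \<omega>)) \<longlonglongrightarrow> norm (F \<omega> - F \<omega>)"
        by (intro tendsto_intros lim)
      then show "(\<lambda>i. norm (F \<omega> - s i \<omega>)) \<longlonglongrightarrow> 0" by simp
    qed
    show "AE \<omega> in \<nu>. norm (norm (F \<omega> - s i \<omega>)) \<le> 3 * norm (F \<omega>)" for i
    proof (rule AE_I2)
      fix \<omega> assume "\<omega> \<in> space \<nu>"
      then show "norm (norm (F \<omega> - s i \<omega>)) \<le> 3 * norm (F \<omega>)"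
        using norm_triangle_ineq4[of "F \<omega>" "s i \<omega>"] lim(3)[of \<omega> i] by simp
    qed
  qed (use lim in auto)
  then obtain i where i: "(LINT \<omega>|\<nu>. norm (F \<omega> - s i \<omega>)) < e / 2"
    using LIMSEQ_D[of _ 0 "e / 2"] lim.prems by fastforce
  obtain n h where h: "(LINT \<omega>|\<nu>. norm (s i \<omega> - h (\<omega> n))) < e / 2" using lim.IH[of "e / 2" i] lim.prems by auto
  have int: "integrable \<nu> (\<lambda>\<omega>. norm (F \<omega> - s i \<omega>))" "integrable \<nu> (\<lambda>\<omega>. norm (s i \<omega> - h (\<omega> n)))"
    "integrable \<nu> (\<lambda>\<omega>. norm (F \<omega> - h (\<omega> n)))"
    using lim integral_level_function(1)[of h n] by auto
  have "(LINT \<omega>|\<nu>. norm (F \<omega> - h (\<omega> n))) \<le> (LINT \<omega>|\<nu>. norm (F \<omega> - s i \<omega>) + norm (s i \<omega> - h (\<omega> n)))"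
  proof (rule integral_mono)
    show "norm (F \<omega> - h (\<omega> n)) \<le> norm (F \<omega> - s i \<omega>) + norm (s i \<omega> - h (\<omega> n))" for \<omega>
      using norm_triangle_ineq[of "F \<omega> - s i \<omega>" "s i \<omega> - h (\<omega> n)"] by simp
  qed (use int in auto)
  also have "\<dots> < e" using int i h by simp
  finally show ?case by blast
qed

definition density_of :: "('v \<Rightarrow> 'b :: real_vector) \<Rightarrow> 'v \<Rightarrow> 'b" where
  "density_of M x = M x /\<^sub>R weight x"

lemma weight_density_of: "complex_of_real (weight x) * density_of M x = M x"
  using weight_pos[of x] by (simp add: density_of_def scaleR_conv_of_real)

text \<open>On functions of the \<open>n\<close>-th coordinate the averaging over the sets \<open>E x\<close> is the identity, and it
  is a contraction in the mean; so convergence follows from density.\<close>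

lemma martingale_tendsto_L1:
  fixes F :: "_ \<Rightarrow> complex"
  assumes F: "integrable \<nu> F"
  shows "(\<lambda>n. LINT \<omega>|\<nu>. norm (density_of (mass F) (\<omega> n) - F \<omega>)) \<longlonglongrightarrow> 0"
proof (rule LIMSEQ_I)
  fix e :: real assume "0 < e"
  then obtain m h where h: "(LINT \<omega>|\<nu>. norm (F \<omega> - h (\<omega> m))) < e / 2"
    using level_function_approx[OF F, of "e / 2"] by auto
  have "norm ((LINT \<omega>|\<nu>. norm (density_of (mass F) (\<omega> n) - F \<omega>)) - 0) < e" if n: "m \<le> n" for n
  proof -
    define k where "k x = h (anc m x)" for x
    let ?D = "\<lambda>\<omega>. F \<omega> - k (\<omega> n)"
    have kn: "k (\<omega> n) = h (\<omega> m)" if "\<omega> \<in> space \<nu>" for \<omega> using that n by (simp add: k_def anc_ray space_\<nu>)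
    have D: "integrable \<nu> ?D" using F integral_level_function(1)[of k n] by simp
    have De: "(LINT \<omega>|\<nu>. norm (?D \<omega>)) < e / 2"
      using h kn by (simp cong: Bochner_Integration.integral_cong)
    have i: "integrable \<nu> (\<lambda>\<omega>. norm (density_of (mass F) (\<omega> n) - k (\<omega> n)))"
      "integrable \<nu> (\<lambda>\<omega>. norm (density_of (mass F) (\<omega> n) - F \<omega>))"
      using F integral_level_function(1)[of k n] integral_level_function(1)[of "density_of (mass F)" n] by auto
    have "weight x * norm (density_of (mass F) x - k x) = norm (mass ?D x)" if x: "x \<in> S n" for x
    proof -
      have "mass (\<lambda>\<omega>. k (\<omega> n)) x = mass (\<lambda>_. k x) x"
        unfolding mass_def using x by (intro Bochner_Integration.integral_cong)
          (auto simp: indicator_def rays_through_eq S_iff)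
      then have "mass ?D x = mass F x - weight x *\<^sub>R k x"
        using F integral_level_function(1)[of k n] by (simp add: mass_diff mass_const)
      also have "\<dots> = weight x *\<^sub>R (density_of (mass F) x - k x)"
        using weight_pos[of x] by (simp add: density_of_def scaleR_diff_right)
      finally show ?thesis using weight_pos[of x] by simp
    qed
    then have "(LINT \<omega>|\<nu>. norm (density_of (mass F) (\<omega> n) - k (\<omega> n))) = (\<Sum>x\<in>S n. norm (mass ?D x))"
      using integral_level_function(2)[of "\<lambda>x. norm (density_of (mass F) x - k x)" n] by simp
    also have "\<dots> \<le> (\<Sum>x\<in>S n. mass (\<lambda>\<omega>. norm (?D \<omega>)) x)" by (intro sum_mono norm_mass_le)
    also have "\<dots> = (LINT \<omega>|\<nu>. norm (?D \<omega>))" using D by (intro sum_mass_S) simp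
    finally have "(LINT \<omega>|\<nu>. norm (density_of (mass F) (\<omega> n) - k (\<omega> n))) < e / 2" using De by simp
    moreover have "(LINT \<omega>|\<nu>. norm (density_of (mass F) (\<omega> n) - F \<omega>))
        \<le> (LINT \<omega>|\<nu>. norm (density_of (mass F) (\<omega> n) - k (\<omega> n)) + norm (?D \<omega>))"
    proof (rule integral_mono)
      show "norm (density_of (mass F) (\<omega> n) - F \<omega>) \<le> norm (density_of (mass F) (\<omega> n) - k (\<omega> n)) + norm (?D \<omega>)" for \<omega>
        using norm_triangle_ineq4[of "density_of (mass F) (\<omega> n) - k (\<omega> n)" "?D \<omega>"] by simp
    qed (use i D in auto)
    ultimately have "(LINT \<omega>|\<nu>. norm (density_of (mass F) (\<omega> n) - F \<omega>)) < e" using i D De by simp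
    then show ?thesis by simp
  qed
  then show "\<exists>no. \<forall>n\<ge>no. norm ((LINT \<omega>|\<nu>. norm (density_of (mass F) (\<omega> n) - F \<omega>)) - 0) < e" by blast
qed

lemma martingale_subseq_AE:
  fixes F :: "_ \<Rightarrow> complex"
  assumes F: "integrable \<nu> F"
  shows "\<exists>s. strict_mono (s :: nat \<Rightarrow> nat) \<and> (AE \<omega> in \<nu>. (\<lambda>k. density_of (mass F) (\<omega> (s k))) \<longlonglongrightarrow> F \<omega>)"
proof -
  have "\<exists>s. strict_mono (s :: nat \<Rightarrow> nat) \<and> (AE \<omega> in \<nu>. (\<lambda>k. density_of (mass F) (\<omega> (s k)) - F \<omega>) \<longlonglongrightarrow> 0)"
    using F integral_level_function(1)[of "density_of (mass F)"] martingale_tendsto_L1[OF F]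
    by (intro tendsto_L1_AE_subseq) auto
  then show ?thesis by (simp add: Lim_null[symmetric])
qed

subsection \<open>Bounding all exponents at once\<close>

text \<open>A bound by \<open>B\<close> in the norm of order \<open>\<infinity>\<close> is equivalent to the bound by \<open>B\<close> in all finite orders. Stated for
  all exponents in this set, estimates for finite orders cover the supremum norm as well.\<close>

definition exponents :: "ereal \<Rightarrow> real set" where
  "exponents r = (if r = \<infinity> then {1..} else {real_of_ereal r})"

lemma exponents_ge_1: "1 \<le> r \<Longrightarrow> s \<in> exponents r \<Longrightarrow> 1 \<le> s"
  by (cases r) (auto simp: exponents_def split: if_splits)

text \<open>The supremum norm is the limit of the power means.\<close>

lemma le_of_all_pmean_le:
  assumes b: "0 \<le> b" and f: "0 \<le> f x" and bound: "\<And>r. 1 \<le> r \<Longrightarrow> pmean r (lev x) f \<le> b powr r"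
  shows "f x \<le> b"
proof (rule ccontr)
  assume less: "\<not> f x \<le> b"
  have le: "weight x * f x powr r \<le> b powr r" if "1 \<le> r" for r
  proof -
    have "weight x * f x powr r \<le> pmean r (lev x) f"
      unfolding pmean_def using less_imp_le[OF weight_pos] by (intro member_le_sum) (auto simp: S_iff)
    then show ?thesis using bound[OF that] by simp
  qed
  show False
  proof (cases "b = 0")
    case True
    then show False using le[of 1] less f weight_pos[of x] by (simp add: mult_le_0_iff)
  next
    case False
    then have b: "0 < b" using b by simp
    then have "1 < f x / b" using less by simp
    then obtain n where n: "1 / weight x < (f x / b) ^ n" using real_arch_pow by blast
    have "(f x / b) ^ n \<le> (f x / b) ^ Suc n" using \<open>1 < f x / b\<close> by (intro power_increasing) auto
    then have "1 / weight x < (f x / b) ^ Suc n" using n by simp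
    moreover have "weight x * f x ^ Suc n \<le> b ^ Suc n"
      using le[of "real (Suc n)"] b less by (simp add: powr_realpow del: of_nat_Suc power_Suc)
    then have "(f x / b) ^ Suc n \<le> 1 / weight x"
      using b weight_pos[of x] by (simp add: power_divide divide_simps mult.commute del: power_Suc)
    ultimately show False by simp
  qed
qed

lemma Lp_space_bounds:
  assumes r: "1 \<le> r" and F: "F \<in> Lp_space \<nu> r"
  shows "integrable \<nu> F" "0 \<le> Lp_norm \<nu> r F"
    and "\<And>s. s \<in> exponents r \<Longrightarrow> integrable \<nu> (\<lambda>\<omega>. norm (F \<omega>) powr s)
      \<and> (LINT \<omega>|\<nu>. norm (F \<omega>) powr s) \<le> Lp_norm \<nu> r F powr s"
proof -
  have [measurable]: "F \<in> borel_measurable \<nu>" using F by (simp add: Lp_space_def)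
  have "integrable \<nu> F \<and> 0 \<le> Lp_norm \<nu> r F \<and> (\<forall>s\<in>exponents r. integrable \<nu> (\<lambda>\<omega>. norm (F \<omega>) powr s)
      \<and> (LINT \<omega>|\<nu>. norm (F \<omega>) powr s) \<le> Lp_norm \<nu> r F powr s)"
  proof (cases "r = \<infinity>")
    case True
    define e where "e = esssup \<nu> (\<lambda>\<omega>. ereal (norm (F \<omega>)))"
    have ae: "AE \<omega> in \<nu>. ereal (norm (F \<omega>)) \<le> e" unfolding e_def by (rule esssup_AE)
    have e0: "0 \<le> e"
    proof (rule ccontr)
      assume "\<not> 0 \<le> e"
      then have "ereal (norm (F \<omega>)) \<le> e \<Longrightarrow> False" for \<omega>
        by (meson ereal_less_eq(5) norm_ge_zero order_trans)
      then have "AE \<omega> in \<nu>. False" using ae by (rule_tac eventually_mono)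
      then show False by simp
    qed
    have "e < \<infinity>" using F True by (simp add: Lp_space_def e_def)
    with e0 obtain c where c: "e = ereal c" "0 \<le> c" by (cases e) auto
    have norm: "Lp_norm \<nu> r F = c" using True c by (simp add: Lp_norm_def e_def)
    have ae': "AE \<omega> in \<nu>. norm (F \<omega>) \<le> c" using ae c by simp
    have int: "integrable \<nu> F" by (rule \<nu>.integrable_const_bound[OF ae']) simp
    have "integrable \<nu> (\<lambda>\<omega>. norm (F \<omega>) powr s) \<and> (LINT \<omega>|\<nu>. norm (F \<omega>) powr s) \<le> c powr s" if "1 \<le> s" for s
    proof -
      have ae_s: "AE \<omega> in \<nu>. norm (F \<omega>) powr s \<le> c powr s"
        using ae' by eventually_elim (use that in \<open>auto intro: powr_mono2\<close>)
      have i: "integrable \<nu> (\<lambda>\<omega>. norm (F \<omega>) powr s)"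
        by (rule \<nu>.integrable_const_bound[of _ "c powr s"]) (use ae_s in auto)
      have "(LINT \<omega>|\<nu>. norm (F \<omega>) powr s) \<le> (LINT \<omega>|\<nu>. c powr s)"
        using ae_s i by (intro integral_mono_AE) auto
      then show ?thesis using i \<nu>.prob_space by simp
    qed
    then show ?thesis using int c norm True by (auto simp: exponents_def)
  next
    case False
    with r obtain s where s: "r = ereal s" "1 \<le> s" by (cases r) auto
    have i: "integrable \<nu> (\<lambda>\<omega>. norm (F \<omega>) powr s)" using F s by (simp add: Lp_space_def)
    have int: "integrable \<nu> F"
    proof (rule Bochner_Integration.integrable_bound[of _ "\<lambda>\<omega>. 1 + norm (F \<omega>) powr s"])
      have "norm (F \<omega>) \<le> 1 + norm (F \<omega>) powr s" for \<omega>
      proof (cases "norm (F \<omega>) \<le> 1")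
        case False
        then show ?thesis using powr_mono[of 1 s "norm (F \<omega>)"] s by simp
      qed (simp add: add_increasing2)
      then show "AE \<omega> in \<nu>. norm (F \<omega>) \<le> norm (1 + norm (F \<omega>) powr s)" by simp
    qed (use i in auto)
    have I: "0 \<le> (LINT \<omega>|\<nu>. norm (F \<omega>) powr s)" by simp
    have norm: "Lp_norm \<nu> r F = (LINT \<omega>|\<nu>. norm (F \<omega>) powr s) powr (1 / s)" using s by (simp add: Lp_norm_def)
    then have "Lp_norm \<nu> r F powr s = (LINT \<omega>|\<nu>. norm (F \<omega>) powr s)"
      using s I by (simp add: powr_powr)
    then show ?thesis using i int norm s by (auto simp: exponents_def)
  qed
  then show "integrable \<nu> F" "0 \<le> Lp_norm \<nu> r F"
    "\<And>s. s \<in> exponents r \<Longrightarrow> integrable \<nu> (\<lambda>\<omega>. norm (F \<omega>) powr s)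
      \<and> (LINT \<omega>|\<nu>. norm (F \<omega>) powr s) \<le> Lp_norm \<nu> r F powr s" by auto
qed

text \<open>Fatou's lemma along a subsequence of the martingale that converges almost everywhere; for \<open>r = \<infinity>\<close>
  the bound passes to the limit pointwise.\<close>

lemma Lp_norm_le_martingale:
  assumes r: "1 \<le> r" and F: "integrable \<nu> F" and B: "0 \<le> B"
    and bound: "\<And>s n. s \<in> exponents r \<Longrightarrow> pmean s n (\<lambda>x. norm (density_of (mass F) x)) \<le> B powr s"
  shows "F \<in> Lp_space \<nu> r \<and> Lp_norm \<nu> r F \<le> B"
proof -
  have [measurable]: "F \<in> borel_measurable \<nu>" using F by auto
  obtain t :: "nat \<Rightarrow> nat" where t: "strict_mono t"
    "AE \<omega> in \<nu>. (\<lambda>k. density_of (mass F) (\<omega> (t k))) \<longlonglongrightarrow> F \<omega>"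
    using martingale_subseq_AE[OF F] by blast
  show ?thesis
  proof (cases "r = \<infinity>")
    case True
    have D: "norm (density_of (mass F) x) \<le> B" for x
      using B bound True by (intro le_of_all_pmean_le[of B "\<lambda>x. norm (density_of (mass F) x)"]) (auto simp: exponents_def)
    have "AE \<omega> in \<nu>. ereal (norm (F \<omega>)) \<le> ereal B"
      using t(2)
    proof eventually_elim
      case (elim \<omega>)
      then have "norm (F \<omega>) \<le> B"
        by (rule Lim_bounded[OF tendsto_norm]) (use D in auto)
      then show ?case by simp
    qed
    then have le: "esssup \<nu> (\<lambda>\<omega>. ereal (norm (F \<omega>))) \<le> ereal B" by (intro esssup_I) auto
    then have F': "F \<in> Lp_space \<nu> r" using True by (auto simp: Lp_space_def intro: le_less_trans)
    have "real_of_ereal (esssup \<nu> (\<lambda>\<omega>. ereal (norm (F \<omega>)))) \<le> B"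
      using le B by (cases "esssup \<nu> (\<lambda>\<omega>. ereal (norm (F \<omega>)))") auto
    then show ?thesis using F' True by (simp add: Lp_norm_def)
  next
    case False
    with r obtain s where s: "r = ereal s" "1 \<le> s" by (cases r) auto
    have [measurable]: "(\<lambda>\<omega>. density_of (mass F) (\<omega> n)) \<in> borel_measurable \<nu>" for n
      using integral_level_function(1)[of "density_of (mass F)" n] by auto
    have le: "(\<integral>\<^sup>+\<omega>. ennreal (norm (density_of (mass F) (\<omega> n)) powr s) \<partial>\<nu>) \<le> ennreal (B powr s)" for n
    proof -
      have "(\<integral>\<^sup>+\<omega>. ennreal (norm (density_of (mass F) (\<omega> n)) powr s) \<partial>\<nu>)
          = ennreal (pmean s n (\<lambda>x. norm (density_of (mass F) x)))"
        using integral_level_function[of "\<lambda>x. norm (density_of (mass F) x) powr s" n]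
        by (subst nn_integral_eq_integral) (auto simp: pmean_def)
      then show ?thesis using bound[of s n] s by (simp add: exponents_def ennreal_leI)
    qed
    have "(\<integral>\<^sup>+\<omega>. ennreal (norm (F \<omega>) powr s) \<partial>\<nu>)
        = (\<integral>\<^sup>+\<omega>. liminf (\<lambda>k. ennreal (norm (density_of (mass F) (\<omega> (t k))) powr s)) \<partial>\<nu>)"
    proof (rule nn_integral_cong_AE, use t(2) in eventually_elim)
      fix \<omega> assume "(\<lambda>k. density_of (mass F) (\<omega> (t k))) \<longlonglongrightarrow> F \<omega>"
      then have "(\<lambda>k. norm (density_of (mass F) (\<omega> (t k))) powr s) \<longlonglongrightarrow> norm (F \<omega>) powr s"
        using s by (intro tendsto_powr' tendsto_norm tendsto_const) auto
      then have "(\<lambda>k. ennreal (norm (density_of (mass F) (\<omega> (t k))) powr s)) \<longlonglongrightarrow> ennreal (norm (F \<omega>) powr s)"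
        by (rule tendsto_ennrealI)
      then show "ennreal (norm (F \<omega>) powr s) = liminf (\<lambda>k. ennreal (norm (density_of (mass F) (\<omega> (t k))) powr s))"
        by (rule lim_imp_Liminf[OF trivial_limit_sequentially, symmetric])
    qed
    also have "\<dots> \<le> liminf (\<lambda>k. \<integral>\<^sup>+\<omega>. ennreal (norm (density_of (mass F) (\<omega> (t k))) powr s) \<partial>\<nu>)"
      by (rule nn_integral_liminf) simp
    also have "\<dots> \<le> liminf (\<lambda>k. ennreal (B powr s))"
      by (intro Liminf_mono always_eventually allI le)
    also have "\<dots> = ennreal (B powr s)" by (simp add: Liminf_const)
    finally have fatou: "(\<integral>\<^sup>+\<omega>. ennreal (norm (F \<omega>) powr s) \<partial>\<nu>) \<le> ennreal (B powr s)" .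
    have i: "integrable \<nu> (\<lambda>\<omega>. norm (F \<omega>) powr s)"
      using fatou by (intro integrableI_bounded) (auto intro: le_less_trans)
    have "ennreal (LINT \<omega>|\<nu>. norm (F \<omega>) powr s) \<le> ennreal (B powr s)"
      using fatou i by (subst (asm) nn_integral_eq_integral) auto
    then have "(LINT \<omega>|\<nu>. norm (F \<omega>) powr s) \<le> B powr s" by simp
    then have "(LINT \<omega>|\<nu>. norm (F \<omega>) powr s) powr (1 / s) \<le> (B powr s) powr (1 / s)"
      using s by (intro powr_mono2) auto
    also have "\<dots> = B" using s B by (simp add: powr_powr)
    finally show ?thesis using i s by (simp add: Lp_space_def Lp_norm_def)
  qed
qed

end

section \<open>Jordan decomposition of signed measures\<close>

definition signed_measure :: "'a measure \<Rightarrow> ('a set \<Rightarrow> real) \<Rightarrow> bool" where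
  "signed_measure M m \<longleftrightarrow> (\<forall>A :: nat \<Rightarrow> 'a set. range A \<subseteq> sets M \<longrightarrow> disjoint_family A \<longrightarrow>
      (\<lambda>i. m (A i)) sums m (\<Union>i. A i))"

lemma signed_measure_uminus: "signed_measure M m \<Longrightarrow> signed_measure M (\<lambda>A. - m A)"
  by (simp add: signed_measure_def sums_minus)

lemma signed_measure_Re: "complex_measure M \<mu> \<Longrightarrow> signed_measure M (\<lambda>A. Re (\<mu> A))"
  and signed_measure_Im: "complex_measure M \<mu> \<Longrightarrow> signed_measure M (\<lambda>A. Im (\<mu> A))"
  by (auto simp: signed_measure_def complex_measure_def intro: sums_Re sums_Im)

lemma signed_measure_empty: "signed_measure M m \<Longrightarrow> m {} = 0"
proof -
  assume "signed_measure M m"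
  then have "(\<lambda>i :: nat. m {}) sums m {}"
    unfolding signed_measure_def by (elim allE[of _ "\<lambda>_. {}"]) (simp add: disjoint_family_on_def)
  then have "(\<lambda>i :: nat. m {}) \<longlonglongrightarrow> 0" using sums_summable summable_LIMSEQ_zero by blast
  then show ?thesis by (simp add: LIMSEQ_const_iff)
qed

lemma signed_measure_Un:
  assumes m: "signed_measure M m" and AB: "A \<in> sets M" "B \<in> sets M" "A \<inter> B = {}"
  shows "m (A \<union> B) = m A + m B"
proof -
  have "(\<lambda>i. m (binaryset A B i)) sums m (\<Union>i. binaryset A B i)"
  proof -
    have "disjoint_family (binaryset A B)"
      using AB by (auto simp: disjoint_family_on_def binaryset_def fun_upd_def split: if_split_asm)
    then show ?thesis using m AB unfolding signed_measure_def
      by (elim allE[of _ "binaryset A B"]) (auto simp: range_binaryset_eq)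
  qed
  moreover have "(\<lambda>i. m (binaryset A B i)) sums (m A + m B)"
    by (rule binaryset_sums) (rule signed_measure_empty[OF m])
  ultimately show ?thesis unfolding UN_binaryset_eq by (rule sums_unique2)
qed

lemma signed_measure_Diff:
  assumes m: "signed_measure M m" and AB: "A \<in> sets M" "B \<in> sets M" "B \<subseteq> A"
  shows "m (A - B) = m A - m B"
  using signed_measure_Un[OF m, of B "A - B"] AB by (simp add: Un_absorb1 Diff_partition)

text \<open>The coercion cuts off negative values, which destroys additivity but keeps subadditivity.\<close>

lemma ennreal_add_le: "ennreal (a + b) \<le> ennreal a + ennreal b"
proof (cases "0 \<le> a \<and> 0 \<le> b")
  case False
  then have "ennreal (a + b) \<le> ennreal (max a b)" by (intro ennreal_leI) auto
  also have "\<dots> \<le> ennreal a + ennreal b" by (auto simp: max_def add_increasing add_increasing2)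
  finally show ?thesis .
qed simp

lemma ennreal_sums_le:
  assumes "f sums s"
  shows "ennreal s \<le> (\<Sum>i. ennreal (f i))"
proof (rule LIMSEQ_le_const2)
  show "(\<lambda>n. ennreal (\<Sum>i<n. f i)) \<longlonglongrightarrow> ennreal s"
    using assms unfolding sums_def by (rule tendsto_ennrealI)
  have "ennreal (\<Sum>i<n. f i) \<le> (\<Sum>i<n. ennreal (f i))" for n
  proof (induction n)
    case (Suc n)
    then show ?case using ennreal_add_le[of "\<Sum>i<n. f i" "f n"] by (simp add: order_trans add_right_mono)
  qed simp
  moreover have "(\<Sum>i<n. ennreal (f i)) \<le> (\<Sum>i. ennreal (f i))" for n by (rule sum_le_suminf) auto
  ultimately show "\<exists>N. \<forall>n\<ge>N. ennreal (\<Sum>i<n. f i) \<le> (\<Sum>i. ennreal (f i))" by (meson order_trans)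
qed

context
  fixes M :: "'a measure" and m :: "'a set \<Rightarrow> real"
  assumes m: "signed_measure M m"
begin

definition upper_variation :: "'a set \<Rightarrow> ennreal" where
  "upper_variation A = (SUP B \<in> {B \<in> sets M. B \<subseteq> A}. ennreal (m B))"

lemma upper_variation_mono: "A \<subseteq> B \<Longrightarrow> upper_variation A \<le> upper_variation B"
  unfolding upper_variation_def by (rule SUP_subset_mono) auto

lemma le_upper_variation: "B \<in> sets M \<Longrightarrow> B \<subseteq> A \<Longrightarrow> ennreal (m B) \<le> upper_variation A"
  unfolding upper_variation_def by (rule SUP_upper) simp

lemma upper_variation_empty: "upper_variation {} = 0"
proof -
  have "{B \<in> sets M. B \<subseteq> {}} = {{}}" by auto
  then show ?thesis by (simp add: upper_variation_def signed_measure_empty[OF m])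
qed

lemma upper_variation_superadditive:
  assumes "A \<inter> B = {}"
  shows "upper_variation A + upper_variation B \<le> upper_variation (A \<union> B)"
proof -
  let ?I = "\<lambda>A. {B \<in> sets M. B \<subseteq> A}"
  have ne: "?I X \<noteq> {}" for X by blast
  have le: "ennreal (m C) + ennreal (m D) \<le> upper_variation (A \<union> B)" if "C \<in> ?I A" "D \<in> ?I B" for C D
  proof (cases "0 \<le> m C \<and> 0 \<le> m D")
    case True
    have "C \<inter> D = {}" using that assms by blast
    then have "ennreal (m C) + ennreal (m D) = ennreal (m (C \<union> D))"
      using True that signed_measure_Un[OF m, of C D] by simp
    also have "\<dots> \<le> upper_variation (A \<union> B)" using that by (intro le_upper_variation) auto
    finally show ?thesis .
  next
    case False
    then have "ennreal (m C) = 0 \<or> ennreal (m D) = 0" by (auto simp: ennreal_neg)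
    moreover have "C \<in> sets M" "D \<in> sets M" "C \<subseteq> A \<union> B" "D \<subseteq> A \<union> B" using that by auto
    ultimately show ?thesis using le_upper_variation[of C "A \<union> B"] le_upper_variation[of D "A \<union> B"] by auto
  qed
  have "upper_variation A + upper_variation B = (SUP C\<in>?I A. ennreal (m C) + upper_variation B)"
    unfolding upper_variation_def[of A] by (rule ennreal_SUP_add_left[OF ne, symmetric])
  also have "\<dots> \<le> upper_variation (A \<union> B)"
  proof (rule SUP_least)
    fix C assume C: "C \<in> ?I A"
    have "ennreal (m C) + upper_variation B = (SUP D\<in>?I B. ennreal (m C) + ennreal (m D))"
      unfolding upper_variation_def[of B] by (rule ennreal_SUP_add_right[OF ne])
    also have "\<dots> \<le> upper_variation (A \<union> B)" using le[OF C] by (rule SUP_least)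
    finally show "ennreal (m C) + upper_variation B \<le> upper_variation (A \<union> B)" .
  qed
  finally show ?thesis .
qed

lemma upper_variation_countably_additive: "countably_additive (sets M) upper_variation"
proof (rule countably_additiveI)
  fix A :: "nat \<Rightarrow> 'a set" assume A: "range A \<subseteq> sets M" "disjoint_family A"
  show "(\<Sum>i. upper_variation (A i)) = upper_variation (\<Union>i. A i)"
  proof (rule antisym)
    have "(\<Sum>i<n. upper_variation (A i)) \<le> upper_variation (\<Union>i<n. A i)" for n
    proof (induction n)
      case (Suc n)
      have "A i \<inter> A n = {}" if "i < n" for i using A(2) that by (simp add: disjoint_family_on_def)
      then have "(\<Union>i<n. A i) \<inter> A n = {}" by blast
      from upper_variation_superadditive[OF this] Suc
      show ?case by (simp add: lessThan_Suc Un_commute add.commute) (meson add_left_mono order_trans)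
    qed (simp add: upper_variation_empty)
    moreover have "upper_variation (\<Union>i<n. A i) \<le> upper_variation (\<Union>i. A i)" for n
      by (rule upper_variation_mono) auto
    ultimately show "(\<Sum>i. upper_variation (A i)) \<le> upper_variation (\<Union>i. A i)"
      by (intro suminf_le_const) (auto intro: order_trans)
    show "upper_variation (\<Union>i. A i) \<le> (\<Sum>i. upper_variation (A i))"
      unfolding upper_variation_def[of "\<Union>i. A i"]
    proof (rule SUP_least)
      fix B assume B: "B \<in> {B \<in> sets M. B \<subseteq> (\<Union>i. A i)}"
      have "(\<lambda>i. m (B \<inter> A i)) sums m (\<Union>i. B \<inter> A i)"
        using m A B unfolding signed_measure_def
        by (elim allE[of _ "\<lambda>i. B \<inter> A i"]) (auto simp: disjoint_family_on_def)
      moreover have "(\<Union>i. B \<inter> A i) = B" using B by auto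
      ultimately have "ennreal (m B) \<le> (\<Sum>i. ennreal (m (B \<inter> A i)))" using ennreal_sums_le by fastforce
      also have "\<dots> \<le> (\<Sum>i. upper_variation (A i))"
        using A B by (intro suminf_le le_upper_variation) auto
      finally show "ennreal (m B) \<le> (\<Sum>i. upper_variation (A i))" .
    qed
  qed
qed

lemma space_pos_variation: "space (pos_variation M m) = space M"
  and sets_pos_variation: "sets (pos_variation M m) = sets M"
  by (simp_all add: pos_variation_def)

lemma emeasure_pos_variation: "A \<in> sets M \<Longrightarrow> emeasure (pos_variation M m) A = upper_variation A"
  unfolding pos_variation_def upper_variation_def[symmetric]
  by (rule emeasure_measure_of_sigma[OF sets.sigma_algebra_axioms _ upper_variation_countably_additive])
     (simp_all add: positive_def upper_variation_empty)

text \<open>A set of infinite variation can be split into two parts such that the first has measure of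
  modulus at least \<open>1\<close> and the second still has infinite variation. Iterating this produces
  disjoint sets whose measures do not tend to \<open>0\<close>.\<close>

lemma upper_variation_finite: "upper_variation (space M) < \<infinity>"
proof (rule ccontr)
  assume "\<not> upper_variation (space M) < \<infinity>"
  then have top: "upper_variation (space M) = \<infinity>" by (simp add: less_top[symmetric])
  let ?P = "\<lambda>E. E \<in> sets M \<and> upper_variation E = \<infinity>"
  have split: "\<exists>A. A \<in> sets M \<and> A \<subseteq> E \<and> 1 \<le> \<bar>m A\<bar> \<and> ?P (E - A)" if E: "?P E" for E
  proof -
    have "ennreal (1 + \<bar>m E\<bar>) < upper_variation E" using E by (simp add: less_top[symmetric])
    then obtain B where B: "B \<in> sets M" "B \<subseteq> E" "ennreal (1 + \<bar>m E\<bar>) < ennreal (m B)"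
      unfolding upper_variation_def less_SUP_iff by blast
    have mB: "1 + \<bar>m E\<bar> < m B" using B(3) by (subst (asm) ennreal_less_iff) auto
    have Un: "B \<union> (E - B) = E" and EB: "E - B \<in> sets M" using B E by auto
    have "emeasure (pos_variation M m) (B \<union> (E - B))
        = emeasure (pos_variation M m) B + emeasure (pos_variation M m) (E - B)"
      using B E by (intro plus_emeasure[symmetric]) (auto simp: sets_pos_variation)
    then have "upper_variation E = upper_variation B + upper_variation (E - B)"
      using B E EB unfolding Un by (simp add: emeasure_pos_variation)
    then have "upper_variation (E - B) = \<infinity> \<or> upper_variation B = \<infinity>"
      using E ennreal_add_eq_top[of "upper_variation B" "upper_variation (E - B)"] by auto
    then consider "upper_variation (E - B) = \<infinity>" | "upper_variation B = \<infinity>" by blast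
    then show ?thesis
    proof cases
      case 1
      then show ?thesis using B E mB by (intro exI[of _ B]) auto
    next
      case 2
      have "m (E - B) = m E - m B" using signed_measure_Diff[OF m] B E by simp
      moreover have "E - (E - B) = B" using B by auto
      ultimately show ?thesis using B E mB 2 by (intro exI[of _ "E - B"]) auto
    qed
  qed
  obtain a where a: "\<And>E. ?P E \<Longrightarrow> a E \<in> sets M \<and> a E \<subseteq> E \<and> 1 \<le> \<bar>m (a E)\<bar> \<and> ?P (E - a E)"
    using split by metis
  define X where "X n = ((\<lambda>E. E - a E) ^^ n) (space M)" for n
  have P: "?P (X n)" for n
  proof (induction n)
    case (Suc n)
    then show ?case using a[OF Suc] by (simp add: X_def)
  qed (simp add: X_def top)
  have XS: "X (Suc n) = X n - a (X n)" for n by (simp add: X_def)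
  have dec: "X k \<subseteq> X n" if "n \<le> k" for n k
    using that by (induction k rule: dec_induct) (auto simp: XS)
  have sub: "a (X n) \<subseteq> X n" for n using a[OF P] by blast
  have "a (X n) \<inter> a (X k) = {}" if "n < k" for n k
    using dec[of "Suc n" k] that sub[of k] by (auto simp: XS)
  then have "disjoint_family (\<lambda>n. a (X n))"
    unfolding disjoint_family_on_def by (metis Int_commute linorder_neqE_nat)
  moreover have "range (\<lambda>n. a (X n)) \<subseteq> sets M" using a[OF P] by blast
  ultimately have "(\<lambda>n. m (a (X n))) sums m (\<Union>n. a (X n))"
    using m unfolding signed_measure_def by blast
  then have "(\<lambda>n. m (a (X n))) \<longlonglongrightarrow> 0" using sums_summable summable_LIMSEQ_zero by blast
  then obtain n where "norm (m (a (X n)) - 0) < 1" using LIMSEQ_D[of _ 0 1] by fastforce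
  then show False using a[OF P, of n] by simp
qed

lemma finite_pos_variation: "finite_measure (pos_variation M m)"
  using upper_variation_finite
  by (intro finite_measureI) (simp add: space_pos_variation emeasure_pos_variation less_top)

end

text \<open>If \<open>B\<close> is contained in \<open>A\<close>, then \<open>m B = m A - m (A - B)\<close>, and the last term is controlled by the variation
  of \<open>- m\<close>. The same with \<open>- m\<close> in place of \<open>m\<close> gives the reverse inequality.\<close>

lemma pos_variation_le:
  assumes m: "signed_measure M m" and A: "A \<in> sets M"
  shows "measure (pos_variation M m) A \<le> m A + measure (pos_variation M (\<lambda>A. - m A)) A"
proof -
  note m' = signed_measure_uminus[OF m]
  interpret P: finite_measure "pos_variation M m" by (rule finite_pos_variation[OF m])
  interpret N: finite_measure "pos_variation M (\<lambda>A. - m A)" by (rule finite_pos_variation[OF m'])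
  let ?v = "measure (pos_variation M (\<lambda>A. - m A)) A"
  have v: "- m B \<le> ?v" if "B \<in> sets M" "B \<subseteq> A" for B
  proof -
    have "ennreal (- m B) \<le> ennreal ?v"
      using le_upper_variation[OF m' that] emeasure_pos_variation[OF m' A] N.emeasure_eq_measure by simp
    then show ?thesis by (simp add: ennreal_le_iff)
  qed
  have "ennreal (measure (pos_variation M m) A) \<le> ennreal (m A + ?v)"
    unfolding P.emeasure_eq_measure[symmetric] emeasure_pos_variation[OF m A] upper_variation_def[OF m]
  proof (rule SUP_least)
    fix B assume B: "B \<in> {B \<in> sets M. B \<subseteq> A}"
    have "m (A - B) = m A - m B" using signed_measure_Diff[OF m A] B by simp
    then have "m B \<le> m A + ?v" using v[of "A - B"] A B by auto
    then show "ennreal (m B) \<le> ennreal (m A + ?v)" by (rule ennreal_leI)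
  qed
  moreover have "0 \<le> m A + ?v" using v[of A] A by simp
  ultimately show ?thesis by simp
qed

lemma jordan_decomposition:
  assumes m: "signed_measure M m" and A: "A \<in> sets M"
  shows "m A = measure (pos_variation M m) A - measure (pos_variation M (\<lambda>A. - m A)) A"
  using pos_variation_le[OF m A] pos_variation_le[OF signed_measure_uminus[OF m] A] by simp

section \<open>Representation of eigenfunctions\<close>

context rooted_homogeneous_tree
begin

subsection \<open>Measures and densities with prescribed masses\<close>

text \<open>The densities \<open>\<bar>g\<bar>\<close> form a submartingale, so their averages over the descendants in far
  generations increase to an additive majorant of \<open>\<bar>M\<bar>\<close> with the same mean bounds.\<close>

lemma exists_additive_majorant:
  fixes g :: "'v \<Rightarrow> complex"
  assumes g: "avg g = g" and K: "\<And>n. pmean 1 n (\<lambda>x. norm (g x)) \<le> K"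
  shows "\<exists>G. avg G = G \<and> (\<forall>x. norm (g x) \<le> G x) \<and>
    (\<forall>r B. 1 \<le> r \<longrightarrow> (\<forall>n. pmean r n (\<lambda>x. norm (g x)) \<le> B) \<longrightarrow> (\<forall>n. pmean r n G \<le> B))"
proof -
  define a where "a k = (avg ^^ k) (\<lambda>x. norm (g x))" for k
  have a_Suc: "a (Suc k) = avg (a k)" for k by (simp add: a_def)
  have mono: "a k x \<le> a (Suc k) x" for k x
  proof (induction k arbitrary: x)
    case 0
    have "norm (g x) = norm (avg g x)" using g by simp
    also have "\<dots> \<le> avg (\<lambda>x. norm (g x)) x" by (rule norm_avg_le)
    finally show ?case by (simp add: a_def)
  next
    case (Suc k)
    show ?case unfolding a_Suc[of k] a_Suc[of "Suc k"] by (rule avg_mono) (rule Suc[unfolded a_Suc])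
  qed
  have nonneg: "0 \<le> a k x" for k x
    by (induction k arbitrary: x) (auto simp: a_def intro: avg_nonneg)
  have pm: "pmean r n (a k) \<le> B" if "1 \<le> r" "\<forall>n. pmean r n (\<lambda>x. norm (g x)) \<le> B" for r B n k
    unfolding a_def using that by (intro order_trans[OF pmean_avg_funpow_le]) auto
  have le: "a k x \<le> K / weight x" for k x
  proof -
    have "weight x * a k x powr 1 \<le> pmean 1 (lev x) (a k)"
      unfolding pmean_def using less_imp_le[OF weight_pos] by (intro member_le_sum) (auto simp: S_iff)
    also have "\<dots> \<le> K" by (rule pm) (use K in auto)
    finally show ?thesis using nonneg[of k x] weight_pos[of x] by (simp add: field_simps)
  qed
  define G where "G x = (SUP k. a k x)" for x
  have lim: "(\<lambda>k. a k x) \<longlonglongrightarrow> G x" for x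
    unfolding G_def using le mono by (intro LIMSEQ_incseq_SUP) (auto intro!: bdd_aboveI2 incseq_SucI)
  have "(\<lambda>k. avg (a k) x) \<longlonglongrightarrow> avg G x" for x
    unfolding avg_def using children_nonempty[of x] by (intro tendsto_intros lim) simp
  moreover have "(\<lambda>k. avg (a k) x) \<longlonglongrightarrow> G x" for x
    using LIMSEQ_Suc[OF lim[of x]] by (simp add: a_Suc)
  ultimately have "avg G = G" using LIMSEQ_unique by blast
  moreover have "norm (g x) \<le> G x" for x
    using incseq_le[OF _ lim[of x], of 0] mono by (simp add: incseq_SucI a_def)
  moreover have "pmean r n G \<le> B" if r: "1 \<le> r" and B: "\<forall>n. pmean r n (\<lambda>x. norm (g x)) \<le> B" for r B n
  proof (rule Lim_bounded)
    show "(\<lambda>k. pmean r n (a k)) \<longlonglongrightarrow> pmean r n G"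
      unfolding pmean_def using r nonneg
      by (intro tendsto_sum tendsto_mult tendsto_const tendsto_powr' lim) (auto intro!: always_eventually)
    show "\<forall>k\<ge>0. pmean r n (a k) \<le> B" using pm[OF r B] by blast
  qed
  ultimately show ?thesis by blast
qed

lemma additive_add: "additive M \<Longrightarrow> additive N \<Longrightarrow> additive (\<lambda>x. M x + N x)"
  by (simp add: additive_def sum.distrib)

lemma additive_Re: "additive M \<Longrightarrow> additive (\<lambda>x. Re (M x))"
  and additive_Im: "additive M \<Longrightarrow> additive (\<lambda>x. Im (M x))"
  unfolding additive_def Re_sum[symmetric] Im_sum[symmetric] by simp_all

text \<open>Let \<open>M\<close> be the additive function with density \<open>g\<close>, and \<open>P\<close> an additive majorant of \<open>\<bar>M\<bar>\<close> with density \<open>G\<close>. The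
  functions \<open>P\<close>, \<open>P + Re M\<close> and \<open>P + Im M\<close> are additive and non-negative, hence come from measures, and \<open>M\<close> is
  a combination of them. They are at most \<open>2 * P\<close>, so the bounds on \<open>G\<close> control all three.\<close>

lemma exists_measures_of_density:
  fixes g :: "'v \<Rightarrow> complex"
  assumes g: "avg g = g" and K: "\<And>n. pmean 1 n (\<lambda>x. norm (g x)) \<le> K"
  shows "\<exists>N G. (\<forall>i::nat. finite_measure (N i) \<and> sets (N i) = sets \<nu>) \<and>
    (\<forall>x. of_real (weight x) * g x = Complex (measure (N 1) (E x) - measure (N 0) (E x)) (measure (N 2) (E x) - measure (N 0) (E x))) \<and>
    (\<forall>i x. measure (N i) (E x) \<le> weight x * (2 * G x)) \<and> (\<forall>x. 0 \<le> G x) \<and>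
    (\<forall>r B. 1 \<le> r \<longrightarrow> (\<forall>n. pmean r n (\<lambda>x. norm (g x)) \<le> B) \<longrightarrow> (\<forall>n. pmean r n G \<le> B))"
proof -
  obtain G where G: "avg G = G" "\<And>x. norm (g x) \<le> G x"
    "\<forall>r B. 1 \<le> r \<longrightarrow> (\<forall>n. pmean r n (\<lambda>x. norm (g x)) \<le> B) \<longrightarrow> (\<forall>n. pmean r n G \<le> B)"
    using exists_additive_majorant[OF assms] by blast
  define P where "P x = weight x * G x" for x
  define M where "M x = of_real (weight x) * g x" for x
  have addP: "additive P" using G(1) additive_iff_avg[of G] by (simp add: P_def[abs_def])
  have addM: "additive M" using g additive_iff_avg[of g] by (simp add: M_def[abs_def])
  have G0: "0 \<le> G x" for x using G(2)[of x] norm_ge_zero order_trans by blast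
  have MP: "norm (M x) \<le> P x" for x
    using G(2)[of x] weight_pos[of x] by (simp add: M_def P_def norm_mult)
  define A where "A i x = (if i = 1 then P x + Re (M x) else if i = 2 then P x + Im (M x) else P x)" for i :: nat and x
  have A: "0 \<le> A i x" "A i x \<le> 2 * P x" for i x
    using MP[of x] abs_Re_le_cmod[of "M x"] abs_Im_le_cmod[of "M x"] norm_ge_zero[of "M x"]
    unfolding A_def by auto
  have addA: "additive (A i)" for i
    unfolding A_def[abs_def] using additive_add[OF addP additive_Re[OF addM]] additive_add[OF addP additive_Im[OF addM]] addP
    by (cases "i = 1"; cases "i = 2") simp_all
  have "\<forall>i. \<exists>N. finite_measure N \<and> sets N = sets \<nu> \<and> (\<forall>x. measure N (E x) = A i x)"
    using exists_finite_measure_of_additive[OF addA A(1)] by blast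
  from choice[OF this] obtain N where N: "\<And>i. finite_measure (N i) \<and> sets (N i) = sets \<nu> \<and> (\<forall>x. measure (N i) (E x) = A i x)"
    by blast
  have "M x = Complex (measure (N 1) (E x) - measure (N 0) (E x)) (measure (N 2) (E x) - measure (N 0) (E x))" for x
    by (simp add: N A_def)
  moreover have "measure (N i) (E x) \<le> weight x * (2 * G x)" for i x
    using A(2)[of i x] by (simp add: N P_def mult_ac)
  ultimately show ?thesis using N G0 G(3) by (intro exI[of _ N] exI[of _ G]) (auto simp: M_def)
qed

text \<open>For an exponent greater than \<open>1\<close> bounded means imply uniform integrability, hence a measure
  without singular part.\<close>

lemma absolutely_continuous_of_pmean_bound:
  assumes N: "finite_measure N" "sets N = sets \<nu>" and r: "1 < r"
    and f: "\<And>x. 0 \<le> f x" "\<And>x. measure N (E x) \<le> weight x * f x" and K: "\<And>n. pmean r n f \<le> K"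
  shows "absolutely_continuous \<nu> N"
proof -
  interpret N: finite_measure N by fact
  have K0: "0 \<le> K" using K[of 0] pmean_nonneg[of r 0 f] by simp
  \<comment> \<open>split according to whether \<open>f x\<close> exceeds \<open>L\<close>\<close>
  have split: "f x \<le> L + L powr (1 - r) * f x powr r" if L: "0 < L" for L x
  proof (cases "f x \<le> L")
    case False
    then have "f x powr (1 - r) \<le> L powr (1 - r)" using L r by (intro powr_mono2') auto
    then have "f x powr (1 - r) * f x powr r \<le> L powr (1 - r) * f x powr r" by (rule mult_right_mono) simp
    also have "f x powr (1 - r) * f x powr r = f x" using False L f(1)[of x] by (simp add: powr_add[symmetric])
    finally show ?thesis using L by simp
  qed (simp add: add_increasing2)
  have cyl: "measure N C \<le> L * measure \<nu> C + L powr (1 - r) * K" if C: "cylinder n C" and L: "0 < L" for n C L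
  proof -
    obtain T where T: "T \<subseteq> S n" "C = (\<Union>x\<in>T. E x)" using cylinder_eq_UN[OF C] by blast
    have fin: "finite T" using T finite_subset by blast
    have dis: "disjoint_family_on E T" using T disjoint_E_S[of _ n] by (auto simp: disjoint_family_on_def)
    have "measure N C = (\<Sum>x\<in>T. measure N (E x))"
      unfolding T(2)
    proof (rule N.finite_measure_finite_Union[OF fin _ dis])
      show "E ` T \<subseteq> sets N" unfolding N(2) using E_sets by blast
    qed
    also have "\<dots> \<le> (\<Sum>x\<in>T. L * weight x + L powr (1 - r) * (weight x * f x powr r))"
    proof (rule sum_mono)
      fix x
      have "measure N (E x) \<le> weight x * (L + L powr (1 - r) * f x powr r)"
        using f(2)[of x] mult_left_mono[OF split[OF L, of x], of "weight x"] weight_pos[of x] by linarith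
      then show "measure N (E x) \<le> L * weight x + L powr (1 - r) * (weight x * f x powr r)"
        by (simp add: algebra_simps)
    qed
    also have "\<dots> = L * (\<Sum>x\<in>T. measure \<nu> (E x)) + L powr (1 - r) * (\<Sum>x\<in>T. weight x * f x powr r)"
      by (simp add: sum.distrib sum_distrib_left measure_\<nu>_E)
    also have "(\<Sum>x\<in>T. measure \<nu> (E x)) = measure \<nu> C"
      unfolding T(2)
    proof (rule \<nu>.finite_measure_finite_Union[OF fin _ dis, symmetric])
      show "E ` T \<subseteq> sets \<nu>" using E_sets by blast
    qed
    finally have le: "measure N C \<le> L * measure \<nu> C + L powr (1 - r) * (\<Sum>x\<in>T. weight x * f x powr r)" .
    have "(\<Sum>x\<in>T. weight x * f x powr r) \<le> pmean r n f"
      unfolding pmean_def using T less_imp_le[OF weight_pos] by (intro sum_mono2) auto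
    also have "\<dots> \<le> K" by (rule K)
    finally have "L powr (1 - r) * (\<Sum>x\<in>T. weight x * f x powr r) \<le> L powr (1 - r) * K"
      by (intro mult_left_mono) auto
    with le show ?thesis by linarith
  qed
  have "emeasure N A = 0" if A: "A \<in> sets \<nu>" "emeasure \<nu> A = 0" for A
  proof -
    have \<nu>A: "measure \<nu> A = 0" using A by (simp add: measure_def)
    have "measure N A \<le> e" if e: "0 < e" for e
    proof -
      \<comment> \<open>chosen such that \<open>L powr (1 - r) * K\<close> is at most \<open>e / 3\<close>\<close>
      define L where "L = ((e / 3) / (K + 1)) powr (1 / (1 - r))"
      have L: "0 < L" using e K0 by (simp add: L_def)
      have "L powr (1 - r) = (e / 3) / (K + 1)"
        using r e K0 unfolding L_def powr_powr by simp
      then have LK: "L powr (1 - r) * K \<le> e / 3"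
        using e K0 mult_left_mono[of K "K + 1" e] by (simp add: divide_le_eq)
      define d where "d = min (e / 3) (e / (3 * L))"
      have d: "0 < d" using e L by (simp add: d_def)
      obtain n C where C: "cylinder n C" "measure N (sym_diff A C) + measure \<nu> (sym_diff A C) < d"
        using cylinder_approx[OF N A(1) d] by blast
      have Cs: "C \<in> sets \<nu>" using C cylinder_sets by auto
      have dN: "measure N (sym_diff A C) < d" "measure \<nu> (sym_diff A C) < d"
        using C measure_nonneg[of N "sym_diff A C"] measure_nonneg[of \<nu> "sym_diff A C"] by linarith+
      have "measure \<nu> C \<le> measure \<nu> (A \<union> sym_diff A C)"
        using A Cs by (intro \<nu>.finite_measure_mono) auto
      also have "\<dots> \<le> measure \<nu> A + measure \<nu> (sym_diff A C)" using A Cs by (intro measure_Un_le) auto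
      finally have "measure \<nu> C \<le> d" using \<nu>A dN by simp
      then have "L * measure \<nu> C \<le> L * (e / (3 * L))" using L by (intro mult_left_mono) (auto simp: d_def)
      then have \<nu>C: "L * measure \<nu> C \<le> e / 3" using L by simp
      have "measure N A \<le> measure N (C \<union> sym_diff A C)"
        using A Cs N(2) by (intro N.finite_measure_mono) auto
      also have "\<dots> \<le> measure N C + measure N (sym_diff A C)" using A Cs N(2) by (intro measure_Un_le) auto
      finally have "measure N A \<le> measure N C + d" using dN by simp
      then show ?thesis using cyl[OF C(1) L] \<nu>C LK by (simp add: d_def min_def split: if_splits)
    qed
    then have "measure N A \<le> 0" by (rule field_le_epsilon[where y = 0, simplified])
    then show ?thesis using measure_nonneg[of N A] by (simp add: N.emeasure_eq_measure)
  qed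
  then show ?thesis using N(2) unfolding absolutely_continuous_def by (auto simp: null_sets_def)
qed

lemma exists_density:
  assumes N: "finite_measure N" "sets N = sets \<nu>" and ac: "absolutely_continuous \<nu> N"
  shows "\<exists>h :: _ \<Rightarrow> real. integrable \<nu> h \<and> (\<forall>x. mass h x = measure N (E x))"
proof -
  interpret N: finite_measure N by fact
  obtain f where f [measurable]: "f \<in> borel_measurable \<nu>" and dens: "density \<nu> f = N"
    using \<nu>.Radon_Nikodym[OF ac N(2)] by blast
  have "(\<integral>\<^sup>+\<omega>. f \<omega> \<partial>\<nu>) = emeasure N (space \<nu>)"
    unfolding dens[symmetric] by (subst emeasure_density) (auto intro!: nn_integral_cong)
  then have fin: "(\<integral>\<^sup>+\<omega>. f \<omega> \<partial>\<nu>) \<noteq> \<infinity>" by simp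
  define h where "h \<omega> = enn2real (f \<omega>)" for \<omega>
  have h [measurable]: "h \<in> borel_measurable \<nu>" unfolding h_def by simp
  have ae: "AE \<omega> in \<nu>. f \<omega> = ennreal (h \<omega>)"
    using nn_integral_PInf_AE[OF f fin] by eventually_elim (simp add: h_def less_top)
  have "(\<integral>\<^sup>+\<omega>. ennreal (norm (h \<omega>)) \<partial>\<nu>) = (\<integral>\<^sup>+\<omega>. f \<omega> \<partial>\<nu>)"
    by (rule nn_integral_cong_AE) (use ae in eventually_elim, simp add: h_def)
  then have int: "integrable \<nu> h" using fin by (intro integrableI_bounded) (auto simp: less_top)
  have "mass h x = measure N (E x)" for x
  proof -
    have i: "integrable \<nu> (\<lambda>\<omega>. indicator (E x) \<omega> *\<^sub>R h \<omega>)" by (rule integrable_indicator_E[OF int])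
    have "emeasure N (E x) = (\<integral>\<^sup>+\<omega>. f \<omega> * indicator (E x) \<omega> \<partial>\<nu>)"
      unfolding dens[symmetric] by (rule emeasure_density) (auto simp: E_sets)
    also have "\<dots> = (\<integral>\<^sup>+\<omega>. ennreal (indicator (E x) \<omega> *\<^sub>R h \<omega>) \<partial>\<nu>)"
      by (rule nn_integral_cong_AE) (use ae in eventually_elim, simp add: indicator_def)
    also have "\<dots> = ennreal (mass h x)"
      unfolding mass_def by (rule nn_integral_eq_integral[OF i]) (simp add: h_def)
    finally have "ennreal (measure N (E x)) = ennreal (mass h x)" by (simp add: N.emeasure_eq_measure)
    moreover have "0 \<le> mass h x" unfolding mass_def h_def by (intro Bochner_Integration.integral_nonneg) simp
    ultimately show ?thesis by (simp add: ennreal_inj)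
  qed
  then show ?thesis using int by blast
qed

lemma mass_of_real: "integrable \<nu> h \<Longrightarrow> mass (\<lambda>\<omega>. complex_of_real (h \<omega>)) x = of_real (mass h x)"
  by (simp add: mass_def scaleR_conv_of_real flip: of_real_mult)

text \<open>Boundedness for some exponent above \<open>1\<close> makes the three measures behind \<open>g\<close> absolutely continuous, so that
  their densities combine to \<open>F\<close>.\<close>

lemma exists_function_with_density:
  fixes g :: "'v \<Rightarrow> complex"
  assumes g: "avg g = g" and r: "1 < r" and K: "\<And>n. pmean 1 n (\<lambda>x. norm (g x)) \<le> K"
    and Kr: "\<And>n. pmean r n (\<lambda>x. norm (g x)) \<le> Kr"
  shows "\<exists>F. integrable \<nu> F \<and> density_of (mass F) = g"
proof -
  obtain N :: "nat \<Rightarrow> _" and G where N: "\<And>i. finite_measure (N i)" "\<And>i. sets (N i) = sets \<nu>"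
    and rep: "\<And>x. of_real (weight x) * g x = Complex (measure (N 1) (E x) - measure (N 0) (E x)) (measure (N 2) (E x) - measure (N 0) (E x))"
    and le: "\<And>i x. measure (N i) (E x) \<le> weight x * (2 * G x)" and G0: "\<And>x. 0 \<le> G x"
    and Gr: "\<And>n. pmean r n G \<le> Kr"
    using exists_measures_of_density[OF g K] r Kr by (metis less_imp_le)
  have "\<forall>i. \<exists>h :: _ \<Rightarrow> real. integrable \<nu> h \<and> (\<forall>x. mass h x = measure (N i) (E x))"
  proof
    fix i
    have "absolutely_continuous \<nu> (N i)"
    proof (rule absolutely_continuous_of_pmean_bound[OF N r _ le])
      show "pmean r n (\<lambda>x. 2 * G x) \<le> 2 powr r * Kr" for n
        unfolding pmean_cmult using Gr by (intro mult_left_mono) auto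
    qed (simp add: G0)
    then show "\<exists>h :: _ \<Rightarrow> real. integrable \<nu> h \<and> (\<forall>x. mass h x = measure (N i) (E x))"
      by (rule exists_density[OF N])
  qed
  from choice[OF this] obtain h :: "nat \<Rightarrow> _ \<Rightarrow> real"
    where h: "\<And>i. integrable \<nu> (h i)" "\<And>i x. mass (h i) x = measure (N i) (E x)" by blast
  define F where "F \<omega> = complex_of_real (h 1 \<omega> - h 0 \<omega>) + complex_of_real (h 2 \<omega> - h 0 \<omega>) * \<i>" for \<omega>
  have i: "integrable \<nu> (\<lambda>\<omega>. h 1 \<omega> - h 0 \<omega>)" "integrable \<nu> (\<lambda>\<omega>. h 2 \<omega> - h 0 \<omega>)" using h by auto
  have j: "integrable \<nu> (\<lambda>\<omega>. complex_of_real (h 1 \<omega> - h 0 \<omega>))" "integrable \<nu> (\<lambda>\<omega>. complex_of_real (h 2 \<omega> - h 0 \<omega>))"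
    using i by (intro integrable_of_real; simp)+
  then have F: "integrable \<nu> F" unfolding F_def by (intro Bochner_Integration.integrable_add integrable_mult_left)
  have "mass (\<lambda>\<omega>. complex_of_real (h 2 \<omega> - h 0 \<omega>) * \<i>) x = mass (\<lambda>\<omega>. complex_of_real (h 2 \<omega> - h 0 \<omega>)) x * \<i>" for x
    unfolding mass_def by (simp flip: mult_scaleR_left del: of_real_diff)
  then have "mass F x = of_real (mass (h 1) x - mass (h 0) x) + of_real (mass (h 2) x - mass (h 0) x) * \<i>" for x
    unfolding F_def using i j h(1)
    by (simp add: mass_add mass_of_real mass_diff integrable_mult_left del: of_real_diff)
  then have "mass F x = of_real (weight x) * g x" for x
    by (simp add: h(2) rep complex_eq_iff)
  then have "density_of (mass F) x = g x" for x
    using weight_pos[of x] by (simp add: density_of_def scaleR_conv_of_real)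
  then show ?thesis using F by blast
qed

subsection \<open>The Poisson transform of a complex measure\<close>

text \<open>Decomposing \<open>\<mu>\<close> into the positive and negative variations of its real and imaginary parts reduces everything to
  finite measures; the sum of the four is the majorant \<open>P\<close>.\<close>

lemma poisson_transform_measure_eq:
  assumes \<mu>: "complex_measure \<nu> \<mu>"
  shows "poisson_transform_measure adj q v0 z \<mu> = tree_poisson (of_nat q powr (1 / 2 + \<i> * z)) (\<lambda>y. \<mu> (E y))"
    and "additive (\<lambda>y. \<mu> (E y))"
    and "\<exists>P. additive P \<and> (\<forall>x. 0 \<le> P x) \<and>
      (\<forall>x. norm (poisson_transform_measure adj q v0 z \<mu> x) \<le> tree_poisson (norm (of_nat q powr (1 / 2 + \<i> * z) :: complex)) P x)"
proof -
  let ?Q = "of_nat q powr (1 / 2 + \<i> * z) :: complex"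
  note sm = signed_measure_Re[OF \<mu>] signed_measure_Im[OF \<mu>]
  define N where "N i = (if i = 0 then pos_variation \<nu> (\<lambda>A. Re (\<mu> A)) else if i = 1 then pos_variation \<nu> (\<lambda>A. - Re (\<mu> A))
    else if i = 2 then pos_variation \<nu> (\<lambda>A. Im (\<mu> A)) else pos_variation \<nu> (\<lambda>A. - Im (\<mu> A)))" for i :: nat
  have N: "finite_measure (N i)" "sets (N i) = sets \<nu>" for i
    using sm sm[THEN signed_measure_uminus] by (auto simp: N_def sets_pos_variation intro: finite_pos_variation)
  define P where "P i y = measure (N i) (E y)" for i y
  have \<mu>E: "\<mu> (E y) = (of_real (P 0 y) - of_real (P 1 y)) + \<i> * (of_real (P 2 y) - of_real (P 3 y))" for y
    using sm[THEN jordan_decomposition, OF E_sets[of y]] by (simp add: complex_eq_iff P_def N_def)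
  define k where "k x \<omega> = complex_of_real (poisson_kernel adj q v0 x \<omega>) powr (1 / 2 + \<i> * z)" for x \<omega>
  have int: "(LINT \<omega>|N i. k x \<omega>) = tree_poisson ?Q (\<lambda>y. of_real (P i y)) x" for i x
    unfolding k_def P_def by (rule LINT_kernel_measure[OF N])
  have expand: "poisson_transform_measure adj q v0 z \<mu> x
      = ((LINT \<omega>|N 0. k x \<omega>) - (LINT \<omega>|N 1. k x \<omega>)) + \<i> * ((LINT \<omega>|N 2. k x \<omega>) - (LINT \<omega>|N 3. k x \<omega>))" for x
    by (simp add: poisson_transform_measure_def complex_measure_integral_def N_def k_def)
  have "poisson_transform_measure adj q v0 z \<mu> x = tree_poisson ?Q (\<lambda>y. \<mu> (E y)) x" for x
    unfolding expand int \<mu>E by (simp only: tree_poisson_linear)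
  then show "poisson_transform_measure adj q v0 z \<mu> = tree_poisson ?Q (\<lambda>y. \<mu> (E y))" by blast
  have addP: "sum (P i) (children x) = P i x" for i x
    using additive_measure[OF N, of i] by (simp add: additive_def P_def[abs_def])
  have "(\<Sum>y\<in>children x. complex_of_real (P i y)) = of_real (P i x)" for i x
    unfolding of_real_sum[symmetric] addP ..
  then show "additive (\<lambda>y. \<mu> (E y))"
    unfolding additive_def \<mu>E by (simp add: sum.distrib sum_subtractf sum_distrib_left[symmetric])
  have bound: "norm (LINT \<omega>|N i. k x \<omega>) \<le> tree_poisson (norm ?Q) (P i) x" for i x
  proof -
    have "norm (LINT \<omega>|N i. k x \<omega>) \<le> (LINT \<omega>|N i. norm (k x \<omega>))" by (rule integral_norm_bound)
    also have "\<dots> = (LINT \<omega>|N i. tree_poisson (norm ?Q) (\<lambda>y. indicator (E y) \<omega>) x)"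
      using sets_eq_imp_space[OF N(2)] norm_tree_poisson_indicator[OF q_powr_nonzero]
      by (intro Bochner_Integration.integral_cong refl) (simp add: k_def poisson_kernel_powr)
    also have "\<dots> = tree_poisson (norm ?Q) (\<lambda>y. LINT \<omega>|N i. indicator (E y) \<omega>) x"
    proof (rule tree_poisson_integral(2))
      interpret N: finite_measure "N i" by (rule N)
      show "integrable (N i) (indicator (E y) :: _ \<Rightarrow> real)" for y
        using N(2) E_sets by (intro integrable_real_indicator) (auto simp: less_top[symmetric])
    qed
    also have "(\<lambda>y. LINT \<omega>|N i. indicator (E y) \<omega> :: real) = P i"
      using sets_eq_imp_space[OF N(2), of i] E_subset by (auto simp: P_def Int_absorb2)
    finally show ?thesis .
  qed
  define T where "T y = (P 0 y + P 1 y) + (P 2 y + P 3 y)" for y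
  have "norm (poisson_transform_measure adj q v0 z \<mu> x) \<le> tree_poisson (norm ?Q) T x" for x
  proof -
    have "norm (poisson_transform_measure adj q v0 z \<mu> x)
        \<le> (norm (LINT \<omega>|N 0. k x \<omega>) + norm (LINT \<omega>|N 1. k x \<omega>)) + (norm (LINT \<omega>|N 2. k x \<omega>) + norm (LINT \<omega>|N 3. k x \<omega>))"
      unfolding expand
      by (rule order_trans[OF norm_triangle_ineq]) (simp add: norm_mult add_mono norm_triangle_ineq4)
    then show ?thesis unfolding T_def tree_poisson_linear(2)
      using bound[of 0 x] bound[of 1 x] bound[of 2 x] bound[of 3 x] by linarith
  qed
  moreover have "additive T" unfolding additive_def T_def by (simp add: sum.distrib addP)
  moreover have "0 \<le> T x" for x by (simp add: T_def P_def)
  ultimately show "\<exists>P. additive P \<and> (\<forall>x. 0 \<le> P x) \<and>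
      (\<forall>x. norm (poisson_transform_measure adj q v0 z \<mu> x) \<le> tree_poisson (norm ?Q) P x)" by blast
qed

lemma exists_complex_measure:
  fixes g :: "'v \<Rightarrow> complex"
  assumes g: "avg g = g" and K: "\<And>n. pmean 1 n (\<lambda>x. norm (g x)) \<le> K"
  shows "\<exists>\<mu>. complex_measure \<nu> \<mu> \<and> (\<forall>x. \<mu> (E x) = of_real (weight x) * g x)"
proof -
  obtain N :: "nat \<Rightarrow> _" where N: "\<And>i. finite_measure (N i)" "\<And>i. sets (N i) = sets \<nu>"
    and rep: "\<And>x. of_real (weight x) * g x = Complex (measure (N 1) (E x) - measure (N 0) (E x)) (measure (N 2) (E x) - measure (N 0) (E x))"
    using exists_measures_of_density[OF g K] by blast
  define \<mu> where "\<mu> A = Complex (measure (N 1) A - measure (N 0) A) (measure (N 2) A - measure (N 0) A)" for A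
  have "complex_measure \<nu> \<mu>"
    unfolding complex_measure_def
  proof (intro allI impI)
    fix A :: "nat \<Rightarrow> _" assume A: "range A \<subseteq> sets \<nu>" "disjoint_family A"
    have s: "(\<lambda>i. measure (N j) (A i)) sums measure (N j) (\<Union>i. A i)" for j
      using finite_measure.finite_measure_UNION[OF N(1)] A N(2) by blast
    show "(\<lambda>i. \<mu> (A i)) sums \<mu> (\<Union>i. A i)"
      unfolding sums_complex_iff \<mu>_def using s by (auto intro: sums_diff)
  qed
  then show ?thesis using rep by (intro exI[of _ \<mu>]) (simp add: \<mu>_def)
qed

subsection \<open>Hardy norms and eigenfunctions\<close>

lemma hardy_norm_nonneg: "1 \<le> p \<Longrightarrow> 0 \<le> hardy_norm adj q v0 p r u"
  using sph_pos[of "real q powr (1 / p)"] q_ge_2 less_imp_le[OF sph_pos, of "real q powr (1 / p)"]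
  by (auto simp: hardy_norm_def Re_spherical_fun Re_spherical_fun_radial ge_one_powr_ge_zero
      intro!: SUP_upper2[of v0] SUP_upper2[of 0])

text \<open>This puts the supremum norm and the norms of finite order in one form, so that both are treated by the
  estimates of power means.\<close>

lemma hardy_norm_le_iff:
  assumes p: "1 \<le> p" and r: "1 \<le> r" and B: "0 \<le> B"
  shows "hardy_norm adj q v0 p r u \<le> ereal B \<longleftrightarrow>
    (\<forall>s\<in>exponents r. \<forall>n. pmean s n (\<lambda>x. norm (u x)) \<le> (sph (real q powr (1 / p)) n * B) powr s)"
proof -
  let ?R = "real q powr (1 / p)"
  have s: "0 < sph ?R n" for n using p q_ge_2 by (intro sph_pos ge_one_powr_ge_zero) auto
  show ?thesis
  proof (cases "r = \<infinity>")
    case True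
    have "hardy_norm adj q v0 p r u \<le> ereal B \<longleftrightarrow> (\<forall>x. norm (u x) \<le> sph ?R (lev x) * B)"
      using True s by (simp add: hardy_norm_def Re_spherical_fun[OF p] SUP_le_iff divide_le_eq mult.commute)
    also have "\<dots> \<longleftrightarrow> (\<forall>t\<ge>1. \<forall>n. pmean t n (\<lambda>x. norm (u x)) \<le> (sph ?R n * B) powr t)"
    proof (intro iffI allI impI)
      fix t :: real and n assume le: "\<forall>x. norm (u x) \<le> sph ?R (lev x) * B" and t: "1 \<le> t"
      have "pmean t n (\<lambda>x. norm (u x)) \<le> pmean t n (\<lambda>_. sph ?R n * B)"
      proof (rule pmean_mono)
        show "0 \<le> norm (u x) \<and> norm (u x) \<le> sph ?R n * B" if "x \<in> S n" for x
          using le that unfolding S_iff by auto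
      qed (use t in simp)
      then show "pmean t n (\<lambda>x. norm (u x)) \<le> (sph ?R n * B) powr t"
        using s[of n] B by (simp add: pmean_const)
    next
      fix x assume *: "\<forall>t\<ge>1. \<forall>n. pmean t n (\<lambda>x. norm (u x)) \<le> (sph ?R n * B) powr t"
      show "norm (u x) \<le> sph ?R (lev x) * B"
        using s[of "lev x"] B * by (intro le_of_all_pmean_le[of _ "\<lambda>x. norm (u x)"]) auto
    qed
    finally show ?thesis using True by (simp add: exponents_def Ball_def)
  next
    case False
    with r obtain t where t: "r = ereal t" "1 \<le> t" by (cases r) auto
    have "pmean t n (\<lambda>x. norm (u x)) powr (1 / t) / sph ?R n \<le> B \<longleftrightarrow>
        pmean t n (\<lambda>x. norm (u x)) \<le> (sph ?R n * B) powr t" for n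
    proof -
      have "pmean t n (\<lambda>x. norm (u x)) powr (1 / t) / sph ?R n \<le> B \<longleftrightarrow>
          pmean t n (\<lambda>x. norm (u x)) powr (1 / t) \<le> sph ?R n * B"
        using s[of n] by (simp add: divide_le_eq mult.commute)
      also have "\<dots> \<longleftrightarrow> (pmean t n (\<lambda>x. norm (u x)) powr (1 / t)) powr t \<le> (sph ?R n * B) powr t"
        using s[of n] B t by (intro powr_le_powr_iff[symmetric]) auto
      also have "(pmean t n (\<lambda>x. norm (u x)) powr (1 / t)) powr t = pmean t n (\<lambda>x. norm (u x))"
        using t pmean_nonneg[of t n "\<lambda>x. norm (u x)"] by (simp add: powr_powr)
      finally show ?thesis .
    qed
    then show ?thesis using t
      by (simp add: hardy_norm_def Re_spherical_fun_radial[OF p] SUP_le_iff exponents_def pmean_eq_average[symmetric])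
  qed
qed

lemma hardy_norm_finite:
  assumes "1 \<le> p" "hardy_norm adj q v0 p r u < \<infinity>"
  obtains B where "0 \<le> B" "hardy_norm adj q v0 p r u = ereal B"
  using assms hardy_norm_nonneg[of p r u] by (cases "hardy_norm adj q v0 p r u") auto

text \<open>The condition on \<open>\<alpha>\<close> enters only here: for \<open>p = 2\<close> it makes \<open>q\<^bsup>2i\<alpha>\<^esup>\<close> equal to \<open>1\<close>, hence \<open>Q\<^sup>2 = q\<close>.\<close>

lemma admissible_base:
  assumes adm: "admissible_parameter q p z" and p: "1 \<le> p" "p \<le> 2"
  defines "Q \<equiv> of_nat q powr (1 / 2 + \<i> * z) :: complex"
  shows "norm Q = real q powr (1 / p)" "1 \<le> norm Q" "Q \<noteq> 0" "Q ^ 2 \<noteq> 1"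
    "real q < norm Q ^ 2 \<or> Q ^ 2 = of_nat q" "real q \<le> norm Q ^ 2"
proof -
  obtain \<alpha> where z: "z = of_real \<alpha> + \<i> * of_real (- delta p)"
    and \<alpha>: "p = 2 \<longrightarrow> (\<exists>k::int. \<alpha> = tau q / 2 * of_int k)"
    using adm unfolding admissible_parameter_def by blast
  have q: "1 < real q" using q_ge_2 by simp
  have s: "1 / 2 + \<i> * z = of_real (1 / p) + \<i> * of_real \<alpha>"
    by (simp add: z delta_def algebra_simps complex_eq_iff)
  show nQ: "norm Q = real q powr (1 / p)" unfolding Q_def s norm_q_powr by simp
  show "1 \<le> norm Q" unfolding nQ using q p by (intro ge_one_powr_ge_zero) auto
  then show Q0: "Q \<noteq> 0" by auto
  have sq: "norm Q ^ 2 = real q powr (2 / p)"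
    unfolding nQ using q by (simp add: powr_power)
  have "p = 2 \<Longrightarrow> Q ^ 2 = of_nat q"
  proof -
    assume p2: "p = 2"
    then obtain k :: int where k: "\<alpha> = tau q / 2 * of_int k" using \<alpha> by blast
    have "\<alpha> * ln (real q) = pi * of_int k" using q by (simp add: k tau_def)
    then have "complex_of_real (\<alpha> * ln (real q)) = of_real (pi * of_int k)" by (rule arg_cong)
    then have a: "complex_of_real \<alpha> * of_real (ln (real q)) = of_real pi * of_int k" by simp
    have e: "\<i> * of_real \<alpha> * of_real (ln (real q)) * 2 = 2 * of_int k * of_real pi * \<i>"
      unfolding mult.assoc[of \<i>] a by (simp add: mult_ac)
    have "Q = exp ((1 / 2 + \<i> * of_real \<alpha>) * of_real (ln (real q)))"
      unfolding Q_def s p2 using q by (simp add: powr_def Ln_of_nat)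
    then have "Q ^ 2 = exp (of_real (ln (real q)) + \<i> * of_real \<alpha> * of_real (ln (real q)) * 2)"
      by (simp add: power2_eq_square exp_add[symmetric] algebra_simps)
    also have "\<dots> = of_real (exp (ln (real q)))"
      unfolding e exp_add exp_integer_2pi[of "of_int k", simplified] by (simp add: exp_of_real)
    also have "\<dots> = of_nat q" using q by simp
    finally show ?thesis .
  qed
  moreover have "real q < norm Q ^ 2" if "p \<noteq> 2"
  proof -
    have "real q powr 1 < real q powr (2 / p)" using q p that by (intro powr_less_mono) auto
    then show ?thesis by (simp add: sq)
  qed
  ultimately show "real q < norm Q ^ 2 \<or> Q ^ 2 = of_nat q" by blast
  then show le: "real q \<le> norm Q ^ 2" by (metis less_imp_le norm_of_nat norm_power order_refl)
  then show "Q ^ 2 \<noteq> 1" using q by (metis not_le norm_one norm_power)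
qed

text \<open>The inversion formula supplies the density \<open>g\<close>, and \<open>density_bound\<close> transfers the bounds from \<open>u\<close> to \<open>g\<close>.\<close>

lemma eigenfunction_density:
  fixes u :: "'v \<Rightarrow> complex"
  assumes adm: "admissible_parameter q p z" and p: "1 \<le> p" "p \<le> 2" and r: "1 \<le> r"
    and u: "u \<in> hardy_space adj q v0 p r" and eig: "\<And>x. laplacian adj q u x = gamma_eigenvalue q z * u x"
  shows "\<exists>g B. avg g = g \<and> u = tree_poisson (of_nat q powr (1 / 2 + \<i> * z)) (\<lambda>y. of_real (weight y) * g y) \<and>
    0 \<le> B \<and> (\<forall>s\<in>exponents r. \<forall>n. pmean s n (\<lambda>x. norm (g x)) \<le> B powr s)"
proof -
  let ?Q = "of_nat q powr (1 / 2 + \<i> * z) :: complex"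
  note Q = admissible_base[OF adm p]
  obtain M where M: "additive M" "u = tree_poisson ?Q M"
    using eigenfunction_is_tree_poisson[OF Q(3,4)] eig unfolding laplacian_eigen_iff by blast
  define g where "g = density_of M"
  have Mg: "M = (\<lambda>y. of_real (weight y) * g y)"
    by (simp add: g_def weight_density_of)
  have g: "avg g = g" using M(1) unfolding Mg additive_iff_avg .
  obtain B where B: "0 \<le> B" "hardy_norm adj q v0 p r u = ereal B"
    using u hardy_norm_finite[OF p(1)] unfolding hardy_space_def by blast
  then have bound: "\<forall>s\<in>exponents r. \<forall>n. pmean s n (\<lambda>x. norm (u x)) \<le> (sph (norm ?Q) n * B) powr s"
    using hardy_norm_le_iff[OF p(1) r B(1), of u] unfolding Q(1) by simp
  have "pmean s n (\<lambda>x. norm (g x)) \<le> (density_const (norm ?Q) * B) powr s" if "s \<in> exponents r" for s n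
    using that bound M(2) exponents_ge_1[OF r that] unfolding Mg
    by (intro density_bound[OF Q(5,2) _ B(1) g]) auto
  moreover have "0 \<le> density_const (norm ?Q) * B" using density_const_ge_1[OF Q(6)] B(1) by simp
  ultimately show ?thesis using g M(2) unfolding Mg by blast
qed

lemma hardy_norm_poisson_le:
  assumes adm: "admissible_parameter q p z" and p: "1 \<le> p" "p \<le> 2" and r: "1 \<le> r"
    and F: "F \<in> Lp_space \<nu> r"
  shows "hardy_norm adj q v0 p r (poisson_transform adj q v0 z F) \<le> ereal (Lp_norm \<nu> r F)"
proof -
  let ?Q = "of_nat q powr (1 / 2 + \<i> * z) :: complex"
  note Q = admissible_base[OF adm p]
  note L = Lp_space_bounds[OF r F]
  define g where "g x = mass (\<lambda>\<omega>. norm (F \<omega>)) x / weight x" for x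
  have g0: "0 \<le> g x" for x using mass_norm_nonneg[of F x] weight_pos[of x] by (simp add: g_def)
  have wg: "(\<lambda>x. weight x * g x) = mass (\<lambda>\<omega>. norm (F \<omega>))"
    using weight_pos by (auto simp: g_def fun_eq_iff) (metis less_irrefl)
  have "pmean s n (\<lambda>x. norm (poisson_transform adj q v0 z F x)) \<le> (sph (norm ?Q) n * Lp_norm \<nu> r F) powr s"
    if s: "s \<in> exponents r" for s n
  proof -
    have s1: "1 \<le> s" using exponents_ge_1[OF r s] .
    have "pmean s n (\<lambda>x. norm (poisson_transform adj q v0 z F x)) \<le> pmean s n (tree_poisson (norm ?Q) (\<lambda>x. weight x * g x))"
      unfolding wg poisson_transform_eq[OF L(1)]
      using norm_tree_poisson_mass_le[OF L(1) Q(3)] s1 by (intro pmean_mono) auto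
    also have "\<dots> \<le> (sph (norm ?Q) n * Lp_norm \<nu> r F) powr s"
    proof (rule pmean_tree_poisson_le[OF s1 Q(2) g0 L(2)])
      show "pmean s j g \<le> Lp_norm \<nu> r F powr s" for j
        unfolding g_def using pmean_mass_le[OF L(1) s1, of j] L(3)[OF s] by simp
    qed
    finally show ?thesis .
  qed
  then show ?thesis using hardy_norm_le_iff[OF p(1) r L(2)] unfolding Q(1) by blast
qed

lemma Lp_norm_le_hardy_norm:
  assumes adm: "admissible_parameter q p z" and p: "1 \<le> p" "p \<le> 2" and r: "1 \<le> r"
    and F: "F \<in> Lp_space \<nu> r"
  shows "ereal (1 / density_const (real q powr (1 / p)) * Lp_norm \<nu> r F)
    \<le> hardy_norm adj q v0 p r (poisson_transform adj q v0 z F)"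
proof -
  let ?Q = "of_nat q powr (1 / 2 + \<i> * z) :: complex" and ?u = "poisson_transform adj q v0 z F"
  note Q = admissible_base[OF adm p]
  note L = Lp_space_bounds[OF r F]
  define g where "g = density_of (mass F)"
  have Mg: "mass F = (\<lambda>y. of_real (weight y) * g y)"
    by (simp add: g_def weight_density_of)
  have g: "avg g = g" using additive_mass[OF L(1)] unfolding Mg additive_iff_avg .
  have u: "?u = tree_poisson ?Q (\<lambda>y. of_real (weight y) * g y)"
    unfolding poisson_transform_eq[OF L(1)] Mg ..
  have "hardy_norm adj q v0 p r ?u < \<infinity>"
    using hardy_norm_poisson_le[OF adm p r F] by (rule le_less_trans) simp
  then obtain B where B: "0 \<le> B" "hardy_norm adj q v0 p r ?u = ereal B"
    using hardy_norm_finite[OF p(1)] by blast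
  then have bound: "\<forall>s\<in>exponents r. \<forall>n. pmean s n (\<lambda>x. norm (?u x)) \<le> (sph (norm ?Q) n * B) powr s"
    using hardy_norm_le_iff[OF p(1) r B(1), of ?u] unfolding Q(1) by simp
  let ?C = "density_const (norm ?Q)"
  have C: "1 \<le> ?C" by (rule density_const_ge_1[OF Q(6)])
  have "pmean s n (\<lambda>x. norm (g x)) \<le> (?C * B) powr s" if "s \<in> exponents r" for s n
    using that bound exponents_ge_1[OF r that] by (intro density_bound[OF Q(5,2) _ B(1) g u]) auto
  then have "Lp_norm \<nu> r F \<le> ?C * B"
    using Lp_norm_le_martingale[OF r L(1), of "?C * B"] C B(1) by (simp add: g_def)
  then show ?thesis unfolding B(2) Q(1)[symmetric] using C by (simp add: divide_le_eq mult.commute)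
qed

lemma poisson_transform_representation:
  assumes adm: "admissible_parameter q p z" and p: "1 \<le> p" "p \<le> 2" and r: "1 < r"
  shows "(\<exists>F\<in>Lp_space \<nu> r. u = poisson_transform adj q v0 z F) \<longleftrightarrow>
    u \<in> hardy_space adj q v0 p r \<and> (\<forall>x. laplacian adj q u x = gamma_eigenvalue q z * u x)"
proof
  let ?Q = "of_nat q powr (1 / 2 + \<i> * z) :: complex"
  note Q = admissible_base[OF adm p]
  have r1: "1 \<le> r" using r by simp
  {
    assume "\<exists>F\<in>Lp_space \<nu> r. u = poisson_transform adj q v0 z F"
    then obtain F where F: "F \<in> Lp_space \<nu> r" "u = poisson_transform adj q v0 z F" by blast
    have "hardy_norm adj q v0 p r u < \<infinity>"
      unfolding F(2) using hardy_norm_poisson_le[OF adm p r1 F(1)] by (rule le_less_trans) simp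
    moreover have "laplacian adj q u x = gamma_eigenvalue q z * u x" for x
      unfolding laplacian_eigen_iff F(2) poisson_transform_eq[OF Lp_space_bounds(1)[OF r1 F(1)]]
      by (rule tree_poisson_eigenfunction[OF Q(3) additive_mass[OF Lp_space_bounds(1)[OF r1 F(1)]]])
    ultimately show "u \<in> hardy_space adj q v0 p r \<and> (\<forall>x. laplacian adj q u x = gamma_eigenvalue q z * u x)"
      by (simp add: hardy_space_def)
  }
  assume "u \<in> hardy_space adj q v0 p r \<and> (\<forall>x. laplacian adj q u x = gamma_eigenvalue q z * u x)"
  then obtain g B where g: "avg g = g" "u = tree_poisson ?Q (\<lambda>y. of_real (weight y) * g y)"
    and B: "0 \<le> B" "\<And>s n. s \<in> exponents r \<Longrightarrow> pmean s n (\<lambda>x. norm (g x)) \<le> B powr s"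
    using eigenfunction_density[OF adm p r1, of u] by blast
  obtain t where t: "t \<in> exponents r" "1 < t"
    using r by (cases r) (auto simp: exponents_def intro: that[of 2])
  have one: "pmean 1 n (\<lambda>x. norm (g x)) \<le> 1 + B powr t" for n
  proof -
    have "y powr 1 \<le> 1 + y powr t" if "0 \<le> y" for y :: real
    proof (cases "y \<le> 1")
      case False
      then show ?thesis using powr_mono[of 1 t y] t that by simp
    qed (use that in \<open>simp add: add_increasing2\<close>)
    then have "pmean 1 n (\<lambda>x. norm (g x)) \<le> (\<Sum>x\<in>S n. weight x * (1 + norm (g x) powr t))"
      unfolding pmean_def using less_imp_le[OF weight_pos] by (intro sum_mono mult_left_mono) auto
    also have "\<dots> = 1 + pmean t n (\<lambda>x. norm (g x))"
      by (simp add: pmean_def distrib_left sum.distrib sum_weight_S)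
    finally show ?thesis using B(2)[OF t(1), of n] by simp
  qed
  obtain F where F: "integrable \<nu> F" "density_of (mass F) = g"
    using exists_function_with_density[OF g(1) t(2) one B(2)[OF t(1)]] by blast
  have "F \<in> Lp_space \<nu> r" using Lp_norm_le_martingale[OF r1 F(1) B(1)] B(2) unfolding F(2) by blast
  moreover have "mass F = (\<lambda>y. of_real (weight y) * g y)"
    by (simp add: F(2)[symmetric] weight_density_of)
  then have "u = poisson_transform adj q v0 z F" unfolding g(2) poisson_transform_eq[OF F(1)] by simp
  ultimately show "\<exists>F\<in>Lp_space \<nu> r. u = poisson_transform adj q v0 z F" by blast
qed

lemma poisson_transform_measure_representation:
  assumes adm: "admissible_parameter q p z" and p: "1 \<le> p" "p \<le> 2"
  shows "(\<exists>\<mu>. complex_measure \<nu> \<mu> \<and> u = poisson_transform_measure adj q v0 z \<mu>) \<longleftrightarrow>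
    u \<in> hardy_space adj q v0 p 1 \<and> (\<forall>x. laplacian adj q u x = gamma_eigenvalue q z * u x)"
proof
  let ?Q = "of_nat q powr (1 / 2 + \<i> * z) :: complex"
  note Q = admissible_base[OF adm p]
  have ex: "exponents 1 = {1}" by (simp add: exponents_def)
  {
    assume "\<exists>\<mu>. complex_measure \<nu> \<mu> \<and> u = poisson_transform_measure adj q v0 z \<mu>"
    then obtain \<mu> where \<mu>: "complex_measure \<nu> \<mu>" "u = poisson_transform_measure adj q v0 z \<mu>" by blast
    note T = poisson_transform_measure_eq(1)[OF \<mu>(1), of z] poisson_transform_measure_eq(2)[OF \<mu>(1)]
      poisson_transform_measure_eq(3)[OF \<mu>(1), of z]
    obtain P where P: "additive P" "\<And>x. 0 \<le> P x" "\<And>x. norm (u x) \<le> tree_poisson (norm ?Q) P x"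
      using T(3) unfolding \<mu>(2)[symmetric] by blast
    define g where "g x = P x / weight x" for x
    have g0: "0 \<le> g x" for x using P(2)[of x] weight_pos[of x] by (simp add: g_def)
    have wg: "(\<lambda>x. weight x * g x) = P"
      using weight_pos by (auto simp: g_def fun_eq_iff) (metis less_irrefl)
    have "pmean 1 n (\<lambda>x. norm (u x)) \<le> (sph (norm ?Q) n * P v0) powr 1" for n
    proof -
      have "pmean 1 n (\<lambda>x. norm (u x)) \<le> pmean 1 n (tree_poisson (norm ?Q) (\<lambda>x. weight x * g x))"
        unfolding wg using P(3) by (intro pmean_mono) auto
      also have "\<dots> \<le> (sph (norm ?Q) n * P v0) powr 1"
      proof (rule pmean_tree_poisson_le[OF order_refl Q(2) g0 P(2)])
        show "pmean 1 j g \<le> P v0 powr 1" for j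
          using additive_sum_S[OF P(1), of j] g0 P(2) by (simp add: pmean_def fun_cong[OF wg])
      qed
      finally show ?thesis .
    qed
    then have "hardy_norm adj q v0 p 1 u \<le> ereal (P v0)"
      using hardy_norm_le_iff[OF p(1) order_refl P(2)] unfolding Q(1) ex by simp
    then have "hardy_norm adj q v0 p 1 u < \<infinity>" by (rule le_less_trans) simp
    moreover have "laplacian adj q u x = gamma_eigenvalue q z * u x" for x
      unfolding laplacian_eigen_iff \<mu>(2) T(1) by (rule tree_poisson_eigenfunction[OF Q(3) T(2)])
    ultimately show "u \<in> hardy_space adj q v0 p 1 \<and> (\<forall>x. laplacian adj q u x = gamma_eigenvalue q z * u x)"
      by (simp add: hardy_space_def)
  }
  assume "u \<in> hardy_space adj q v0 p 1 \<and> (\<forall>x. laplacian adj q u x = gamma_eigenvalue q z * u x)"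
  then obtain g B where g: "avg g = g" "u = tree_poisson ?Q (\<lambda>y. of_real (weight y) * g y)"
    and B: "\<And>n. pmean 1 n (\<lambda>x. norm (g x)) \<le> B powr 1"
    using eigenfunction_density[OF adm p order_refl, of u] unfolding ex by blast
  obtain \<mu> where \<mu>: "complex_measure \<nu> \<mu>" "\<And>x. \<mu> (E x) = of_real (weight x) * g x"
    using exists_complex_measure[OF g(1) B] by blast
  then have "u = poisson_transform_measure adj q v0 z \<mu>"
    unfolding g(2) poisson_transform_measure_eq(1)[OF \<mu>(1)] by simp
  then show "\<exists>\<mu>. complex_measure \<nu> \<mu> \<and> u = poisson_transform_measure adj q v0 z \<mu>" using \<mu>(1) by blast
qed

end

section \<open>The characterisation\<close>

theorem theorem1p2:
  fixes adj :: "'v \<Rightarrow> 'v \<Rightarrow> bool" and q :: nat and v0 :: 'v and p :: real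
  assumes "homogeneous_tree adj q" and "2 \<le> q" and "1 \<le> p" and "p \<le> 2"
  shows "(\<forall>z. admissible_parameter q p z \<longrightarrow>
            (\<forall>u. \<forall>r::ereal. 1 < r \<longrightarrow>
              ((\<exists>F \<in> Lp_space (boundary_measure adj q v0) r. u = poisson_transform adj q v0 z F)
               \<longleftrightarrow> (u \<in> hardy_space adj q v0 p r
                    \<and> (\<forall>x. laplacian adj q u x = gamma_eigenvalue q z * u x)))))
       \<and> (\<forall>z. admissible_parameter q p z \<longrightarrow>
            (\<forall>u.
              ((\<exists>\<mu>. complex_measure (boundary_measure adj q v0) \<mu>
                    \<and> u = poisson_transform_measure adj q v0 z \<mu>)
               \<longleftrightarrow> (u \<in> hardy_space adj q v0 p 1
                    \<and> (\<forall>x. laplacian adj q u x = gamma_eigenvalue q z * u x)))))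
       \<and> (\<exists>C::real. 0 < C \<and>
            (\<forall>z. admissible_parameter q p z \<longrightarrow>
              (\<forall>r::ereal. 1 \<le> r \<longrightarrow>
                (\<forall>F \<in> Lp_space (boundary_measure adj q v0) r.
                  ereal (C * Lp_norm (boundary_measure adj q v0) r F)
                    \<le> hardy_norm adj q v0 p r (poisson_transform adj q v0 z F)
                  \<and> hardy_norm adj q v0 p r (poisson_transform adj q v0 z F)
                    \<le> ereal (Lp_norm (boundary_measure adj q v0) r F)))))"
proof -
  interpret rooted_homogeneous_tree adj q v0
    using assms by (simp add: rooted_homogeneous_tree_def rooted_homogeneous_tree_axioms_def)
  have "real q \<le> (real q powr (1 / p)) ^ 2"
  proof -
    have "real q powr 1 \<le> real q powr (2 / p)"
      using assms by (intro powr_mono) auto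
    then show ?thesis using assms by (simp add: powr_power)
  qed
  then have C: "1 \<le> density_const (real q powr (1 / p))" by (rule density_const_ge_1)
  show ?thesis
  proof (intro conjI exI[of _ "1 / density_const (real q powr (1 / p))"] allI impI ballI)
    show "0 < 1 / density_const (real q powr (1 / p))" using C by simp
  qed (use assms in \<open>simp_all only: poisson_transform_representation
      poisson_transform_measure_representation Lp_norm_le_hardy_norm hardy_norm_poisson_le\<close>)
qed

end
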